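(* Let $G$ be a semisimple Lie group and $P\subset G$ a parabolic subgroup. Let $V$ be a finite dimensional irreducible representation of $G$, and let $c_0$ be the scalar by which the Casimir operator acts on $V$. Let $(p:\mathcal G\to M,\omega)$ be a parabolic geometry of type $(G,P)$, let $VM\to M$ be the tractor bundle corresponding to $V$, and let $\nabla^V$ be the canonical tractor connection on this bundle. Then the curved Casimir operator $\mathcal C:\Gamma(VM)\to\Gamma(VM)$ is given by $$\mathcal C(\sigma)=c_0\,\sigma+2\partial^*\nabla^V\sigma .$$
   Context: $\mathfrak g$, $\mathfrak p$ are the Lie algebras of $G$, $P$; $B$ is the Killing form of $\mathfrak g$. The Casimir operator on a representation $V$ of $\mathfrak g$ is $v\mapsto\sum_\ell\xi^\ell\cdot\xi_\ell\cdot v$ for $B$-dual bases $\{\xi^\ell\},\{\xi_\ell\}$ of $\mathfrak g$. A parabolic geometry of type $(G,P)$ is a principal $P$-bundle $p:\mathcal G\to M$ over a smooth manifold with $\dim M=\dim G/P$, together with a Cartan connection $\omega\in\Omega^1(\mathcal G,\mathfrak g)$ (each $\omega_u:T_u\mathcal G\to\mathfrak g$ is a linear isomorphism, $\omega$ is $P$-equivariant and reproduces the generators of fundamental vector fields). For a finite dimensional representation $W$ of $P$ put $WM=\mathcal G\times_PW$, $\Gamma(WM)\cong C^\infty(\mathcal G,W)^P$. $\mathcal AM=\mathcal G\times_P\mathfrak g$ is the adjoint tractor bundle, $\mathcal A^0M=\mathcal G\times_P\mathfrak p$, and $\mathcal A^1M=\mathcal G\times_P\mathfrak p_+$, where $\mathfrak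 p_+$ is the nilradical of $\mathfrak p$. Via $\omega$, $TM\cong\mathcal G\times_P(\mathfrak g/\mathfrak p)\cong\mathcal AM/\mathcal A^0M$ (let $\Pi:\mathcal AM\to TM$ be the projection), and since $B$ induces $(\mathfrak g/\mathfrak p)^*\cong\mathfrak p_+$ as $P$-modules, $T^*M\cong\mathcal A^1M$. The Lie bracket of $\mathfrak g$ induces $\{\ ,\ \}$ on $\mathcal AM$. Fundamental derivative and curved Casimir: via $\omega$, sections $s\in\Gamma(\mathcal AM)$ correspond to $P$-invariant vector fields on $\mathcal G$; $D_s\sigma\in\Gamma(WM)$ is obtained by differentiating the equivariant function of $\sigma$ along this field. Iterating gives $D^2\sigma\in\Gamma(\otimes^2\mathcal A^*M\otimes WM)$, and $\mathcal C=(B\otimes\mathrm{id}_W)\circ D^2$, where $B$ is viewed as a map $\otimes^2\mathcal A^*M\to M\times\mathbb R$ through the isomorphism $\mathcal AM\cong\mathcal A^*M$ it induces. Tractor bundles: for a representation $V$ of $G$, restricted to $P$, $VM=\mathcal G\times_PV$ is the corresponding tractor bundle. The infinitesimal action $\mathfrak g\times V\to V$ induces a bundle map $\bullet:\mathcal AM\times VM\to VM$. The tractor connection $\nabla^V$ is the linear connection on $VM$ characterized by $\nabla^V_{\Pi(s)}\sigma=D_s\sigma+s\bullet\sigma$ for $s\in\Gamma(\mathcal AM)$, $\sigma\in\Gamma(VM)$. Kostant codifferential: $\partial^*:\Lambda^kT^*M\otimes VM\to\Lambda^{k-1}T^*M\otimes VM$ is the bundle map $$\partial^*(\varphi_1\wedge\dots\wedge\varphi_k\otimes\sigma)=\sum_{i=1}^k(-1)^i\varphi_1\wedge\dots\wedge\widehat{\varphi_i}\wedge\dots\wedge\varphi_k\otimes\varphi_i\bullet\sigma+\sum_{i<j}(-1)^{i+j}\{\varphi_i,\varphi_j\}\wedge\varphi_1\wedge\dots\wedge\widehat{\varphi_i}\wedge\dots\wedge\widehat{\varphi_j}\wedge\dots\wedge\varphi_k\otimes\sigma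 ,$$ with $\varphi_i\in T^*M\cong\mathcal A^1M$. *)

theory Defs
  imports "HOL-Analysis.Analysis" "HOL-Algebra.Group"
begin

section \<open>Smooth manifolds and tangent maps\<close>

text \<open>Only used for an open set \<open>S\<close> and a finite-dimensional domain type, where it says that
  all partial derivatives up to order \<open>k\<close> exist and are continuous.\<close>

primrec Ck_on :: "nat \<Rightarrow> 'a::real_normed_vector set \<Rightarrow> ('a \<Rightarrow> 'b::real_normed_vector) \<Rightarrow> bool" where
  "Ck_on 0 S f \<longleftrightarrow> continuous_on S f"
| "Ck_on (Suc k) S f \<longleftrightarrow> (\<forall>x\<in>S. f differentiable (at x)) \<and>
     (\<forall>v. Ck_on k S (\<lambda>x. frechet_derivative f (at x) v))"

definition smooth_on :: "'a::real_normed_vector set \<Rightarrow> ('a \<Rightarrow> 'b::real_normed_vector) \<Rightarrow> bool" where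
  "smooth_on S f \<longleftrightarrow> (\<forall>k. Ck_on k S f)"

text \<open>A chart is a pair of its domain and the chart map (whose values outside the domain are
  irrelevant). The manifold is the union of the chart domains, with the subspace topology;
  it is Hausdorff and second countable by the type class of the points.\<close>

type_synonym ('a, 'e) atlas = "('a set \<times> ('a \<Rightarrow> 'e)) set"

definition points :: "('a, 'e) atlas \<Rightarrow> 'a set" where
  "points A = \<Union> (fst ` A)"

definition smooth_manifold ::
  "('a::{second_countable_topology,t2_space}, 'e::real_normed_vector) atlas \<Rightarrow> bool" where
  "smooth_manifold A \<longleftrightarrow>
     (\<exists>B :: 'e set. finite B \<and> span B = UNIV) \<and>
     (\<forall>(U, \<phi>)\<in>A. openin (top_of_set (points A)) U \<and> open (\<phi> ` U) \<and>
        (\<exists>\<psi>. homeomorphism U (\<phi> ` U) \<phi> \<psi>)) \<and>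
     (\<forall>(U, \<phi>)\<in>A. \<forall>(V, \<psi>)\<in>A. smooth_on (\<phi> ` (U \<inter> V)) (\<psi> \<circ> inv_into U \<phi>))"

definition euclid :: "('e, 'e) atlas" where
  "euclid = {(UNIV, id)}"

definition restrict_atlas :: "('a, 'e) atlas \<Rightarrow> 'a set \<Rightarrow> ('a, 'e) atlas" where
  "restrict_atlas A S = (\<lambda>(U, \<phi>). (U \<inter> S, \<phi>)) ` A"

definition prod_atlas :: "('a, 'e) atlas \<Rightarrow> ('b, 'f) atlas \<Rightarrow> ('a \<times> 'b, 'e \<times> 'f) atlas" where
  "prod_atlas A B = {(U \<times> V, map_prod \<phi> \<psi>) | U \<phi> V \<psi>. (U, \<phi>) \<in> A \<and> (V, \<psi>) \<in> B}"

definition smooth_map ::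
  "('a::topological_space, 'e::real_normed_vector) atlas \<Rightarrow>
   ('b::topological_space, 'f::real_normed_vector) atlas \<Rightarrow> ('a \<Rightarrow> 'b) \<Rightarrow> bool" where
  "smooth_map A B f \<longleftrightarrow>
     f ` points A \<subseteq> points B \<and> continuous_on (points A) f \<and>
     (\<forall>(U, \<phi>)\<in>A. \<forall>(V, \<psi>)\<in>B. smooth_on (\<phi> ` (U \<inter> f -` V)) (\<psi> \<circ> f \<circ> inv_into U \<phi>))"

definition diffeo ::
  "('a::topological_space, 'e::real_normed_vector) atlas \<Rightarrow>
   ('b::topological_space, 'f::real_normed_vector) atlas \<Rightarrow> ('a \<Rightarrow> 'b) \<Rightarrow> bool" where
  "diffeo A B f \<longleftrightarrow> bij_betw f (points A) (points B) \<and> smooth_map A B f \<and>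
     smooth_map B A (inv_into (points A) f)"

text \<open>Every tangent space is identified with the model space through one chosen chart around the
  point. The differential at \<open>x\<close> is the resulting linear map between the model spaces, and tangent
  vectors at \<open>x\<close> are just elements of the model space. On \<open>euclid\<close> the chosen chart is the
  identity, so there the differential is the usual one.\<close>

definition chart_at :: "('a, 'e) atlas \<Rightarrow> 'a \<Rightarrow> 'a set \<times> ('a \<Rightarrow> 'e)" where
  "chart_at A x = (SOME c. c \<in> A \<and> x \<in> fst c)"

definition differential ::
  "('a, 'e::real_normed_vector) atlas \<Rightarrow> ('b, 'f::real_normed_vector) atlas \<Rightarrow>
   ('a \<Rightarrow> 'b) \<Rightarrow> 'a \<Rightarrow> 'e \<Rightarrow> 'f" where
  "differential A B f x =
     frechet_derivative
       (snd (chart_at B (f x)) \<circ> f \<circ> inv_into (fst (chart_at A x)) (snd (chart_at A x)))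
       (at (snd (chart_at A x) x))"

text \<open>Smoothness of a vector-valued one-form: its coefficients with respect to the coordinate
  vector fields of each chart are smooth.\<close>

definition smooth_one_form ::
  "('a, 'e::real_normed_vector) atlas \<Rightarrow> ('a \<Rightarrow> 'e \<Rightarrow> 'w::real_normed_vector) \<Rightarrow> bool" where
  "smooth_one_form A \<omega> \<longleftrightarrow>
     (\<forall>(U, \<phi>)\<in>A. \<forall>w. smooth_on (\<phi> ` U)
        (\<lambda>y. \<omega> (inv_into U \<phi> y) (differential euclid A (inv_into U \<phi>) y w)))"


section \<open>Lie algebras\<close>

definition bracket_span ::
  "('e::real_vector \<Rightarrow> 'e \<Rightarrow> 'e) \<Rightarrow> 'e set \<Rightarrow> 'e set \<Rightarrow> 'e set" where
  "bracket_span br S T = span {br x y | x y. x \<in> S \<and> y \<in> T}"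

definition lie_ideal :: "('e::real_vector \<Rightarrow> 'e \<Rightarrow> 'e) \<Rightarrow> 'e set \<Rightarrow> 'e set \<Rightarrow> bool" where
  "lie_ideal br L I \<longleftrightarrow> subspace I \<and> I \<subseteq> L \<and> (\<forall>x\<in>L. \<forall>y\<in>I. br x y \<in> I)"

definition subalgebra :: "('e::real_vector \<Rightarrow> 'e \<Rightarrow> 'e) \<Rightarrow> 'e set \<Rightarrow> bool" where
  "subalgebra br L \<longleftrightarrow> subspace L \<and> (\<forall>x\<in>L. \<forall>y\<in>L. br x y \<in> L)"

definition solvable :: "('e::real_vector \<Rightarrow> 'e \<Rightarrow> 'e) \<Rightarrow> 'e set \<Rightarrow> bool" where
  "solvable br L \<longleftrightarrow> (\<exists>n. ((\<lambda>S. bracket_span br S S) ^^ n) L = {0})"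

definition nilpotent :: "('e::real_vector \<Rightarrow> 'e \<Rightarrow> 'e) \<Rightarrow> 'e set \<Rightarrow> bool" where
  "nilpotent br L \<longleftrightarrow> (\<exists>n. (bracket_span br L ^^ n) L = {0})"

definition semisimple :: "('e::real_vector \<Rightarrow> 'e \<Rightarrow> 'e) \<Rightarrow> bool" where
  "semisimple br \<longleftrightarrow> (\<forall>I. lie_ideal br UNIV I \<and> solvable br I \<longrightarrow> I = {0})"

text \<open>The largest nilpotent ideal, as the sum of all nilpotent ideals.\<close>

definition nilradical :: "('e::real_vector \<Rightarrow> 'e \<Rightarrow> 'e) \<Rightarrow> 'e set \<Rightarrow> 'e set" where
  "nilradical br L = span (\<Union> {I. lie_ideal br L I \<and> nilpotent br I})"

definition grading :: "('e::real_vector \<Rightarrow> 'e \<Rightarrow> 'e) \<Rightarrow> nat \<Rightarrow> (int \<Rightarrow> 'e set) \<Rightarrow> bool" where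
  "grading br k gr \<longleftrightarrow>
     (\<forall>i. subspace (gr i)) \<and> (\<forall>i. \<bar>i\<bar> > int k \<longrightarrow> gr i = {0}) \<and>
     (\<forall>x. \<exists>!f. (\<forall>i. f i \<in> gr i) \<and> x = (\<Sum>i\<in>{- int k..int k}. f i)) \<and>
     (\<forall>i j. \<forall>x\<in>gr i. \<forall>y\<in>gr j. br x y \<in> gr (i + j)) \<and>
     \<Inter> {L. subalgebra br L \<and> gr (-1) \<subseteq> L} = span (\<Union>i\<in>{i. i < 0}. gr i)"

text \<open>Parabolic subalgebras are the non-negative parts of \<open>|k|\<close>-gradings. The extreme case
  of the whole algebra (\<open>k = 0\<close>) is not excluded.\<close>

definition parabolic_subalgebra :: "('e::real_vector \<Rightarrow> 'e \<Rightarrow> 'e) \<Rightarrow> 'e set \<Rightarrow> bool" where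
  "parabolic_subalgebra br p \<longleftrightarrow> (\<exists>k gr. grading br k gr \<and> p = span (\<Union>i\<in>{i. i \<ge> 0}. gr i))"

definition killing_form :: "('e::euclidean_space \<Rightarrow> 'e \<Rightarrow> 'e) \<Rightarrow> 'e \<Rightarrow> 'e \<Rightarrow> real" where
  "killing_form br X Y = (\<Sum>b\<in>Basis. br X (br Y b) \<bullet> b)"

text \<open>\<open>DIM('e)\<close> vectors dual to each other in this sense are automatically bases.\<close>

definition dual_bases ::
  "('e::euclidean_space \<Rightarrow> 'e \<Rightarrow> real) \<Rightarrow> (nat \<Rightarrow> 'e) \<Rightarrow> (nat \<Rightarrow> 'e) \<Rightarrow> bool" where
  "dual_bases b \<xi> \<eta> \<longleftrightarrow>
     (\<forall>i<DIM('e). \<forall>j<DIM('e). b (\<xi> i) (\<eta> j) = (if i = j then 1 else 0))"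


section \<open>Lie groups, representations, parabolic subgroups\<close>

definition lie_group ::
  "'g::{second_countable_topology,t2_space} monoid \<Rightarrow> ('g, 'e::real_normed_vector) atlas \<Rightarrow> bool" where
  "lie_group G A \<longleftrightarrow> group G \<and> smooth_manifold A \<and> carrier G = points A \<and>
     smooth_map (prod_atlas A A) A (\<lambda>(x, y). x \<otimes>\<^bsub>G\<^esub> y) \<and> smooth_map A A (\<lambda>x. inv\<^bsub>G\<^esub> x)"

text \<open>The Lie algebra of \<open>G\<close> is the tangent space at the unit, i.e. the model space, with bracket
  \<open>[X, Y] = ad X Y\<close>, where \<open>ad\<close> is the derivative of \<open>Ad\<close> at the unit.\<close>

definition Ad :: "'g monoid \<Rightarrow> ('g, 'e::real_normed_vector) atlas \<Rightarrow> 'g \<Rightarrow> 'e \<Rightarrow> 'e" where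
  "Ad G A h = differential A A (\<lambda>x. h \<otimes>\<^bsub>G\<^esub> x \<otimes>\<^bsub>G\<^esub> inv\<^bsub>G\<^esub> h) \<one>\<^bsub>G\<^esub>"

definition lie_bracket :: "'g monoid \<Rightarrow> ('g, 'e::real_normed_vector) atlas \<Rightarrow> 'e \<Rightarrow> 'e \<Rightarrow> 'e" where
  "lie_bracket G A X Y = differential A euclid (\<lambda>h. Ad G A h Y) \<one>\<^bsub>G\<^esub> X"

definition semisimple_lie_group ::
  "'g::{second_countable_topology,t2_space} monoid \<Rightarrow> ('g, 'e::real_normed_vector) atlas \<Rightarrow> bool" where
  "semisimple_lie_group G A \<longleftrightarrow> lie_group G A \<and> semisimple (lie_bracket G A)"

text \<open>\<open>AP\<close> is the atlas of \<open>P\<close> as an embedded submanifold of \<open>G\<close>; its Lie algebra is the image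
  of the tangent map of the inclusion at the unit.\<close>

definition subgroup_algebra ::
  "'g monoid \<Rightarrow> ('g, 'e::real_normed_vector) atlas \<Rightarrow> ('g, 'f::real_normed_vector) atlas \<Rightarrow> 'e set" where
  "subgroup_algebra G A AP = range (differential AP A (\<lambda>x. x) \<one>\<^bsub>G\<^esub>)"

definition closed_lie_subgroup ::
  "'g::{second_countable_topology,t2_space} monoid \<Rightarrow> ('g, 'e::real_normed_vector) atlas \<Rightarrow>
   'g set \<Rightarrow> ('g, 'f::real_normed_vector) atlas \<Rightarrow> bool" where
  "closed_lie_subgroup G A P AP \<longleftrightarrow>
     subgroup P G \<and> closedin (top_of_set (carrier G)) P \<and>
     smooth_manifold AP \<and> points AP = P \<and> smooth_map AP A (\<lambda>x. x) \<and>
     (\<forall>x\<in>P. inj (differential AP A (\<lambda>x. x) x))"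

definition parabolic_subgroup ::
  "'g::{second_countable_topology,t2_space} monoid \<Rightarrow> ('g, 'e::real_normed_vector) atlas \<Rightarrow>
   'g set \<Rightarrow> ('g, 'f::real_normed_vector) atlas \<Rightarrow> bool" where
  "parabolic_subgroup G A P AP \<longleftrightarrow>
     closed_lie_subgroup G A P AP \<and>
     parabolic_subalgebra (lie_bracket G A) (subgroup_algebra G A AP)"

text \<open>Representation spaces are finite-dimensional over \<open>K\<close>, the real or the complex numbers.
  They are always carried by a real vector space type, whose inner product plays no role; \<open>sc\<close> is
  the scalar multiplication by elements of \<open>K\<close>, extending that by real numbers.\<close>

definition scalar_action :: "complex set \<Rightarrow> (complex \<Rightarrow> 'v::euclidean_space \<Rightarrow> 'v) \<Rightarrow> bool" where
  "scalar_action K sc \<longleftrightarrow> (K = \<real> \<or> K = UNIV) \<and>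
     (\<forall>a v. sc (of_real a) v = a *\<^sub>R v) \<and>
     (\<forall>a\<in>K. linear (sc a)) \<and>
     (\<forall>a\<in>K. \<forall>b\<in>K. \<forall>v. sc (a + b) v = sc a v + sc b v \<and> sc (a * b) v = sc a (sc b v))"

definition representation ::
  "'g::topological_space monoid \<Rightarrow> ('g, 'e::real_normed_vector) atlas \<Rightarrow>
   complex set \<Rightarrow> (complex \<Rightarrow> 'v::euclidean_space \<Rightarrow> 'v) \<Rightarrow> ('g \<Rightarrow> 'v \<Rightarrow> 'v) \<Rightarrow> bool" where
  "representation G A K sc \<rho> \<longleftrightarrow>
     scalar_action K sc \<and>
     (\<forall>g\<in>carrier G. linear (\<rho> g) \<and> (\<forall>a\<in>K. \<forall>v. \<rho> g (sc a v) = sc a (\<rho> g v))) \<and>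
     (\<forall>v. \<rho> \<one>\<^bsub>G\<^esub> v = v) \<and>
     (\<forall>g\<in>carrier G. \<forall>h\<in>carrier G. \<forall>v. \<rho> (g \<otimes>\<^bsub>G\<^esub> h) v = \<rho> g (\<rho> h v)) \<and>
     (\<forall>v. smooth_map A euclid (\<lambda>g. \<rho> g v))"

text \<open>The representation space is nonzero since it is a Euclidean space type.\<close>

definition irreducible_representation ::
  "'g::topological_space monoid \<Rightarrow> ('g, 'e::real_normed_vector) atlas \<Rightarrow>
   complex set \<Rightarrow> (complex \<Rightarrow> 'v::euclidean_space \<Rightarrow> 'v) \<Rightarrow> ('g \<Rightarrow> 'v \<Rightarrow> 'v) \<Rightarrow> bool" where
  "irreducible_representation G A K sc \<rho> \<longleftrightarrow>
     representation G A K sc \<rho> \<and>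
     (\<forall>S. subspace S \<and> (\<forall>a\<in>K. sc a ` S \<subseteq> S) \<and> (\<forall>g\<in>carrier G. \<rho> g ` S \<subseteq> S) \<longrightarrow> S = {0} \<or> S = UNIV)"

definition inf_action ::
  "'g monoid \<Rightarrow> ('g, 'e::real_normed_vector) atlas \<Rightarrow> ('g \<Rightarrow> 'v \<Rightarrow> 'v::real_normed_vector) \<Rightarrow>
   'e \<Rightarrow> 'v \<Rightarrow> 'v" where
  "inf_action G A \<rho> X v = differential A euclid (\<lambda>g. \<rho> g v) \<one>\<^bsub>G\<^esub> X"

definition casimir_operator ::
  "'g monoid \<Rightarrow> ('g, 'e::euclidean_space) atlas \<Rightarrow> ('g \<Rightarrow> 'v \<Rightarrow> 'v::real_normed_vector) \<Rightarrow>
   ('v \<Rightarrow> 'v) \<Rightarrow> bool" where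
  "casimir_operator G A \<rho> T \<longleftrightarrow>
     (\<exists>\<xi> \<eta>. dual_bases (killing_form (lie_bracket G A)) \<xi> \<eta> \<and>
       (\<forall>v. T v = (\<Sum>l<DIM('e). inf_action G A \<rho> (\<xi> l) (inf_action G A \<rho> (\<eta> l) v))))"


section \<open>Parabolic geometries\<close>

text \<open>\<open>r u h\<close> is the right action of \<open>h \<in> P\<close> on \<open>u\<close>, and \<open>AY\<close> is the atlas of the total space.\<close>

definition principal_bundle ::
  "'g::{second_countable_topology,t2_space} monoid \<Rightarrow> 'g set \<Rightarrow> ('g, 'f::real_normed_vector) atlas \<Rightarrow>
   ('y::{second_countable_topology,t2_space}, 'n::real_normed_vector) atlas \<Rightarrow>
   ('m::{second_countable_topology,t2_space}, 'k::real_normed_vector) atlas \<Rightarrow>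
   ('y \<Rightarrow> 'm) \<Rightarrow> ('y \<Rightarrow> 'g \<Rightarrow> 'y) \<Rightarrow> bool" where
  "principal_bundle G P AP AY AM \<pi> r \<longleftrightarrow>
     smooth_manifold AY \<and> smooth_manifold AM \<and> smooth_map AY AM \<pi> \<and>
     smooth_map (prod_atlas AY AP) AY (\<lambda>(u, h). r u h) \<and>
     (\<forall>u\<in>points AY. r u \<one>\<^bsub>G\<^esub> = u \<and>
        (\<forall>h\<in>P. \<pi> (r u h) = \<pi> u \<and> (\<forall>k\<in>P. r (r u h) k = r u (h \<otimes>\<^bsub>G\<^esub> k)))) \<and>
     (\<forall>x\<in>points AM. \<exists>U \<tau>. x \<in> U \<and> openin (top_of_set (points AM)) U \<and>
        diffeo (restrict_atlas AY (\<pi> -` U)) (prod_atlas (restrict_atlas AM U) AP) (\<lambda>u. (\<pi> u, \<tau> u)) \<and>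
        (\<forall>u\<in>points AY \<inter> \<pi> -` U. \<forall>h\<in>P. \<tau> (r u h) = \<tau> u \<otimes>\<^bsub>G\<^esub> h))"

text \<open>The fundamental vector field of an element of the Lie algebra of \<open>P\<close> is given by the tangent
  map at the unit of the orbit map \<open>h \<mapsto> r u h\<close>.\<close>

definition cartan_connection ::
  "'g monoid \<Rightarrow> ('g, 'e::real_normed_vector) atlas \<Rightarrow> 'g set \<Rightarrow> ('g, 'f::real_normed_vector) atlas \<Rightarrow>
   ('y, 'n::real_normed_vector) atlas \<Rightarrow> ('y \<Rightarrow> 'g \<Rightarrow> 'y) \<Rightarrow> ('y \<Rightarrow> 'n \<Rightarrow> 'e) \<Rightarrow> bool" where
  "cartan_connection G A P AP AY r \<omega> \<longleftrightarrow>
     smooth_one_form AY \<omega> \<and>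
     (\<forall>u\<in>points AY. linear (\<omega> u) \<and> bij (\<omega> u)) \<and>
     (\<forall>u\<in>points AY. \<forall>h\<in>P. \<forall>v.
        \<omega> (r u h) (differential AY AY (\<lambda>u. r u h) u v) = Ad G A (inv\<^bsub>G\<^esub> h) (\<omega> u v)) \<and>
     (\<forall>u\<in>points AY. \<forall>a.
        \<omega> u (differential AP AY (r u) \<one>\<^bsub>G\<^esub> a) = differential AP A (\<lambda>x. x) \<one>\<^bsub>G\<^esub> a)"

definition parabolic_geometry ::
  "'g::{second_countable_topology,t2_space} monoid \<Rightarrow> ('g, 'e::real_normed_vector) atlas \<Rightarrow>
   'g set \<Rightarrow> ('g, 'f::real_normed_vector) atlas \<Rightarrow>
   ('y::{second_countable_topology,t2_space}, 'n::real_normed_vector) atlas \<Rightarrow>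
   ('m::{second_countable_topology,t2_space}, 'k::real_normed_vector) atlas \<Rightarrow>
   ('y \<Rightarrow> 'm) \<Rightarrow> ('y \<Rightarrow> 'g \<Rightarrow> 'y) \<Rightarrow> ('y \<Rightarrow> 'n \<Rightarrow> 'e) \<Rightarrow> bool" where
  "parabolic_geometry G A P AP AY AM \<pi> r \<omega> \<longleftrightarrow>
     principal_bundle G P AP AY AM \<pi> r \<and> cartan_connection G A P AP AY r \<omega> \<and>
     dim (UNIV :: 'k set) + dim (UNIV :: 'f set) = dim (UNIV :: 'e set)"


section \<open>Natural bundles and operators\<close>

text \<open>Sections of an associated bundle are represented by the smooth equivariant functions on
  the total space.\<close>

definition bundle_sections ::
  "'g monoid \<Rightarrow> 'g set \<Rightarrow> ('y::topological_space, 'n::real_normed_vector) atlas \<Rightarrow> ('y \<Rightarrow> 'g \<Rightarrow> 'y) \<Rightarrow>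
   ('g \<Rightarrow> 'w \<Rightarrow> 'w::real_normed_vector) \<Rightarrow> ('y \<Rightarrow> 'w) set" where
  "bundle_sections G P AY r act = {f. smooth_map AY euclid f \<and>
     (\<forall>u\<in>points AY. \<forall>h\<in>P. f (r u h) = act (inv\<^bsub>G\<^esub> h) (f u))}"

text \<open>A point \<open>u\<close> of the total space identifies the fibre at \<open>\<pi> u\<close> of the adjoint tractor bundle
  with the Lie algebra. The vector field on the total space determined by a section \<open>s\<close> has the
  value \<open>(\<omega> u)\<inverse> (s u)\<close> at \<open>u\<close>, so the derivative of \<open>f\<close> along it is \<open>fund_deriv AY \<omega> f u (s u)\<close>.\<close>

definition fund_deriv ::
  "('y, 'n::real_normed_vector) atlas \<Rightarrow> ('y \<Rightarrow> 'n \<Rightarrow> 'e::euclidean_space) \<Rightarrow>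
   ('y \<Rightarrow> 'w::real_normed_vector) \<Rightarrow> 'y \<Rightarrow> 'e \<Rightarrow>\<^sub>L 'w" where
  "fund_deriv AY \<omega> f u = Blinfun (\<lambda>X. differential AY euclid f u (inv_into UNIV (\<omega> u) X))"

text \<open>The inverse of the isomorphism \<open>X \<mapsto> b X\<close> onto the dual space, and the pairing of a bilinear
  map \<open>T\<close> with \<open>b\<close> viewed as a bilinear form on the dual space. The functionals \<open>(\<bullet>) a\<close>,
  \<open>a \<in> Basis\<close>, are the basis dual to \<open>Basis\<close>, so \<open>T\<close> is the sum of the
  \<open>(\<bullet>) a \<otimes> (\<bullet>) c \<otimes> T a c\<close>.\<close>

definition sharp :: "('e \<Rightarrow> 'e \<Rightarrow> real) \<Rightarrow> ('e \<Rightarrow> real) \<Rightarrow> 'e" where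
  "sharp b \<alpha> = (THE X. \<forall>Y. b X Y = \<alpha> Y)"

definition contract ::
  "('e::euclidean_space \<Rightarrow> 'e \<Rightarrow> real) \<Rightarrow> ('e \<Rightarrow> 'e \<Rightarrow> 'w::real_vector) \<Rightarrow> 'w" where
  "contract b T =
     (\<Sum>a\<in>Basis. \<Sum>c\<in>Basis. b (sharp b (\<lambda>x. a \<bullet> x)) (sharp b (\<lambda>x. c \<bullet> x)) *\<^sub>R T a c)"

definition curved_casimir ::
  "'g monoid \<Rightarrow> ('g, 'e::euclidean_space) atlas \<Rightarrow> ('y, 'n::real_normed_vector) atlas \<Rightarrow>
   ('y \<Rightarrow> 'n \<Rightarrow> 'e) \<Rightarrow> ('y \<Rightarrow> 'w::real_normed_vector) \<Rightarrow> 'y \<Rightarrow> 'w" where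
  "curved_casimir G A AY \<omega> f u =
     contract (killing_form (lie_bracket G A))
       (\<lambda>X Y. blinfun_apply (blinfun_apply (fund_deriv AY \<omega> (fund_deriv AY \<omega> f) u) X) Y)"

text \<open>The projection from the adjoint tractor bundle to the tangent bundle, on the fibre at \<open>\<pi> u\<close>
  seen from \<open>u\<close>.\<close>

definition tangent_proj ::
  "('y, 'n::real_normed_vector) atlas \<Rightarrow> ('m, 'k::real_normed_vector) atlas \<Rightarrow> ('y \<Rightarrow> 'm) \<Rightarrow>
   ('y \<Rightarrow> 'n \<Rightarrow> 'e) \<Rightarrow> 'y \<Rightarrow> 'e \<Rightarrow> 'k" where
  "tangent_proj AY AM \<pi> \<omega> u X = differential AY AM \<pi> u (inv_into UNIV (\<omega> u) X)"

text \<open>The covariant derivative in the direction \<open>Y\<close>, a tangent vector of the base at \<open>\<pi> u\<close>. Since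
  \<open>D\<^sub>s \<sigma> + s \<bullet> \<sigma>\<close> depends on \<open>s\<close> only through its value at the point in question, the
  characterization of the tractor connection is imposed fibrewise.\<close>

definition tractor_connection ::
  "'g monoid \<Rightarrow> ('g, 'e::euclidean_space) atlas \<Rightarrow> ('y, 'n::real_normed_vector) atlas \<Rightarrow>
   ('m, 'k::real_normed_vector) atlas \<Rightarrow> ('y \<Rightarrow> 'm) \<Rightarrow> ('y \<Rightarrow> 'n \<Rightarrow> 'e) \<Rightarrow>
   ('g \<Rightarrow> 'v \<Rightarrow> 'v::real_normed_vector) \<Rightarrow> ('y \<Rightarrow> 'v) \<Rightarrow> 'y \<Rightarrow> 'k \<Rightarrow> 'v" where
  "tractor_connection G A AY AM \<pi> \<omega> \<rho> \<sigma> u Y =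
     (THE w. \<forall>X. tangent_proj AY AM \<pi> \<omega> u X = Y \<longrightarrow>
        w = blinfun_apply (fund_deriv AY \<omega> \<sigma> u) X + inf_action G A \<rho> X (\<sigma> u))"


section \<open>The Kostant codifferential\<close>

text \<open>A \<open>V\<close>-valued \<open>k\<close>-form is a function on lists of tangent vectors that vanishes on all lists
  whose length is not \<open>k\<close>. In particular, a form of degree zero is determined by its value at \<open>[]\<close>.
  The form \<open>wedge \<phi>s v\<close> is \<open>\<phi>\<^sub>1 \<and> \<dots> \<and> \<phi>\<^sub>k \<otimes> v\<close>.\<close>

definition wedge ::
  "('t \<Rightarrow> real) list \<Rightarrow> 'v::real_vector \<Rightarrow> 't list \<Rightarrow> 'v" where
  "wedge \<phi>s v Ys =
     (if length Ys = length \<phi>s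
      then (\<Sum>p | p permutes {..<length \<phi>s}.
              of_int (sign p) * (\<Prod>i<length \<phi>s. (\<phi>s ! i) (Ys ! p i))) *\<^sub>R v
      else 0)"

definition omit :: "nat \<Rightarrow> 'a list \<Rightarrow> 'a list" where
  "omit i xs = take i xs @ drop (Suc i) xs"

text \<open>The value of the codifferential on a decomposable form. Here \<open>ct\<close> is the map from the
  nilradical to cotangent vectors. Indices start at 0, whence the shifted sign in the first sum.\<close>

definition codiff_decomposable ::
  "('e \<Rightarrow> 'e \<Rightarrow> 'e) \<Rightarrow> ('e \<Rightarrow> 'v \<Rightarrow> 'v::real_vector) \<Rightarrow> ('e \<Rightarrow> 't \<Rightarrow> real) \<Rightarrow>
   'e list \<Rightarrow> 'v \<Rightarrow> 't list \<Rightarrow> 'v" where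
  "codiff_decomposable br act ct \<phi>s v Ys =
     (\<Sum>i<length \<phi>s. (-1) ^ Suc i *\<^sub>R wedge (map ct (omit i \<phi>s)) (act (\<phi>s ! i) v) Ys) +
     (\<Sum>j<length \<phi>s. \<Sum>i<j. (-1) ^ (i + j) *\<^sub>R
        wedge (map ct (br (\<phi>s ! i) (\<phi>s ! j) # omit i (omit j \<phi>s))) v Ys)"

text \<open>The linear extension to all \<open>k\<close>-forms, through an arbitrary representation of the given form as
  a finite sum of decomposable ones.\<close>

definition codiff ::
  "'e set \<Rightarrow> ('e \<Rightarrow> 'e \<Rightarrow> 'e) \<Rightarrow> ('e \<Rightarrow> 'v \<Rightarrow> 'v::real_vector) \<Rightarrow> ('e \<Rightarrow> 't \<Rightarrow> real) \<Rightarrow>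
   nat \<Rightarrow> ('t list \<Rightarrow> 'v) \<Rightarrow> 't list \<Rightarrow> 'v" where
  "codiff N br act ct k \<alpha> =
     (THE \<beta>. \<exists>ds. (\<forall>(\<phi>s, v)\<in>set ds. length \<phi>s = k \<and> set \<phi>s \<subseteq> N) \<and>
        \<alpha> = (\<lambda>Ys. \<Sum>(\<phi>s, v)\<leftarrow>ds. wedge (map ct \<phi>s) v Ys) \<and>
        \<beta> = (\<lambda>Ys. \<Sum>(\<phi>s, v)\<leftarrow>ds. codiff_decomposable br act ct \<phi>s v Ys))"

text \<open>The cotangent vector at \<open>\<pi> u\<close> corresponding to an element \<open>\<phi>\<close> of the nilradical under the
  isomorphism induced by the Killing form.\<close>

definition cotangent ::
  "('e \<Rightarrow> 'e \<Rightarrow> real) \<Rightarrow> ('y, 'n::real_normed_vector) atlas \<Rightarrow> ('m, 'k::real_normed_vector) atlas \<Rightarrow>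
   ('y \<Rightarrow> 'm) \<Rightarrow> ('y \<Rightarrow> 'n \<Rightarrow> 'e) \<Rightarrow> 'y \<Rightarrow> 'e \<Rightarrow> 'k \<Rightarrow> real" where
  "cotangent b AY AM \<pi> \<omega> u \<phi> Y =
     (THE c. \<forall>X. tangent_proj AY AM \<pi> \<omega> u X = Y \<longrightarrow> c = b \<phi> X)"

definition kostant_codifferential ::
  "'g monoid \<Rightarrow> ('g, 'e::euclidean_space) atlas \<Rightarrow> ('g, 'f::real_normed_vector) atlas \<Rightarrow>
   ('y, 'n::real_normed_vector) atlas \<Rightarrow> ('m, 'k::real_normed_vector) atlas \<Rightarrow>
   ('y \<Rightarrow> 'm) \<Rightarrow> ('y \<Rightarrow> 'n \<Rightarrow> 'e) \<Rightarrow> ('g \<Rightarrow> 'v \<Rightarrow> 'v::real_normed_vector) \<Rightarrow> nat \<Rightarrow> 'y \<Rightarrow>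
   ('k list \<Rightarrow> 'v) \<Rightarrow> 'k list \<Rightarrow> 'v" where
  "kostant_codifferential G A AP AY AM \<pi> \<omega> \<rho> k u =
     codiff (nilradical (lie_bracket G A) (subgroup_algebra G A AP)) (lie_bracket G A)
       (inf_action G A \<rho>) (cotangent (killing_form (lie_bracket G A)) AY AM \<pi> \<omega> u) k"

definition as_one_form :: "('t \<Rightarrow> 'v::zero) \<Rightarrow> 't list \<Rightarrow> 'v" where
  "as_one_form \<alpha> Ys = (if length Ys = 1 then \<alpha> (Ys ! 0) else 0)"

end

theory Submission
  imports Defs
begin

text \<open>The identity is a pointwise one. Fix \<open>u\<close> and write \<open>D X\<close> for the derivative of \<open>\<sigma>\<close> at \<open>u\<close> in
  the direction of the constant vector field of \<open>X\<close>, \<open>D\<^sup>2 X Y\<close> for the iterated derivative, and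
  \<open>X \<bullet> v\<close> for the infinitesimal action. Along \<open>\<pp>\<close> the derivatives are algebraic, because the fields
  of elements of \<open>\<pp>\<close> are fundamental and \<open>\<sigma>\<close> is equivariant:

  \<^item> \<open>D Y = - Y \<bullet> \<sigma>(u)\<close> and \<open>D\<^sup>2 X Y = - Y \<bullet> D X\<close> for \<open>Y \<in> \<pp>\<close> (lemmas \<open>Df_vertical\<close>,
    \<open>D2f_vertical_right\<close>);
  \<^item> \<open>D\<^sup>2 X Y = - X \<bullet> D Y + D [X, Y]\<close> for \<open>X \<in> \<pp>\<close>, by the equivariance of \<open>D\<sigma>\<close> itself (lemma
    \<open>D2f_vertical_left\<close>).

  The curved Casimir operator is the sum of \<open>D\<^sup>2 \<xi>\<^sub>l \<eta>\<^sub>l\<close> over \<open>B\<close>-dual bases. The grading that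
  defines \<open>\<pp>\<close> splits the tensor \<open>\<Sum> \<xi>\<^sub>l \<otimes> \<eta>\<^sub>l\<close> into parts in \<open>\<gg>\<^sub>- \<otimes> \<pp>\<^sub>+\<close>, \<open>\<gg>\<^sub>0 \<otimes> \<gg>\<^sub>0\<close> and
  \<open>\<pp>\<^sub>+ \<otimes> \<gg>\<^sub>-\<close>, since \<open>B\<close> pairs the degrees \<open>i\<close> and \<open>-i\<close> only. In each part one factor lies in \<open>\<pp>\<close>,
  so that the three facts apply; the brackets that appear have degree \<open>0\<close> when summed and are again
  algebraic. Splitting the Casimir operator of the representation in the same way, everything
  cancels except \<open>- 2 \<Sum> \<eta>\<^sub>l \<bullet> (D \<xi>\<^sub>l + \<xi>\<^sub>l \<bullet> \<sigma>(u))\<close> (lemma \<open>casimir_identity\<close>). The bracket in this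
  term is the tractor connection, and \<open>codiff_one_form\<close> identifies the sum with the codifferential.

  What remains is to see that the objects behave as the notation suggests. On the algebraic side,
  the nilradical of \<open>\<pp>\<close> has to be the positive part of the grading, which is the orthogonal
  complement of \<open>\<pp>\<close> (lemma \<open>nilradical_nonneg\<close>); nondegeneracy of \<open>B\<close> is implied by the existence of
  the dual bases in the Casimir operator. On the analytic side, the bracket defined through \<open>Ad\<close> has
  to satisfy the Jacobi identity and to act on representations (lemma \<open>dR_bracket\<close>), the fundamental
  derivative has to be differentiable again (lemma \<open>fund_deriv_has_chart_derivative\<close>), and the
  projection of \<open>\<gg>\<close> to the tangent space of the base has to be onto with kernel \<open>\<pp>\<close> (lemmas
  \<open>surj_tangent_proj\<close>, \<open>tangent_proj_eq_0_iff\<close>).\<close>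


section \<open>Traces of linear endomorphisms\<close>

definition lin_trace :: "('e::euclidean_space \<Rightarrow> 'e) \<Rightarrow> real" where
  "lin_trace T = (\<Sum>b\<in>Basis. T b \<bullet> b)"

lemma lin_trace_commute:
  fixes S T :: "'e::euclidean_space \<Rightarrow> 'e"
  assumes "linear S" "linear T"
  shows "lin_trace (S \<circ> T) = lin_trace (T \<circ> S)"
proof -
  have exp: "L (M b) \<bullet> b = (\<Sum>c\<in>Basis. (M b \<bullet> c) * (L c \<bullet> b))"
    if "linear L" for L M :: "'e \<Rightarrow> 'e" and b
  proof -
    have "L (M b) = L (\<Sum>c\<in>Basis. (M b \<bullet> c) *\<^sub>R c)"
      by (simp add: euclidean_representation)
    also have "\<dots> = (\<Sum>c\<in>Basis. (M b \<bullet> c) *\<^sub>R L c)"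
      by (simp add: linear_sum[OF that] linear_scale[OF that])
    finally show ?thesis by (simp add: inner_sum_left)
  qed
  have "lin_trace (S \<circ> T) = (\<Sum>b\<in>Basis. \<Sum>c\<in>Basis. (T b \<bullet> c) * (S c \<bullet> b))"
    unfolding lin_trace_def o_def by (intro sum.cong refl exp assms)
  also have "\<dots> = (\<Sum>c\<in>Basis. \<Sum>b\<in>Basis. (S c \<bullet> b) * (T b \<bullet> c))"
    by (subst sum.swap) (simp add: mult.commute)
  also have "\<dots> = lin_trace (T \<circ> S)"
    unfolding lin_trace_def o_def by (intro sum.cong refl exp[symmetric] assms)
  finally show ?thesis .
qed

text \<open>Induction on the order of nilpotency. If \<open>g\<close> is linear with \<open>T g T = T\<close>, then \<open>T = (T g) T\<close> has
  the trace of \<open>T (T g)\<close>. As \<open>T g\<close> is the identity on the range of \<open>T\<close>, the order of nilpotency of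
  \<open>T (T g)\<close> is smaller.\<close>

lemma lin_trace_nilpotent:
  fixes T :: "'e::euclidean_space \<Rightarrow> 'e"
  assumes "linear T" "\<And>x. (T ^^ Suc n) x = 0"
  shows "lin_trace T = 0"
  using assms
proof (induction n arbitrary: T)
  case 0
  then show ?case by (simp add: lin_trace_def)
next
  case (Suc n)
  obtain g where g: "linear g" "\<And>x. T (g (T x)) = T x"
    using linear_exists_right_inverse_on[OF Suc.prems(1) subspace_UNIV] by (metis UNIV_I image_eqI)
  define T' where "T' = T \<circ> (T \<circ> g)"
  have lin: "linear T'" "linear (T \<circ> g)"
    using g Suc.prems(1) by (auto simp: T'_def intro!: linear_compose)
  have pow: "(T' ^^ m) (T x) = (T ^^ Suc m) x" for m x
  proof (induction m)
    case (Suc m)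
    then show ?case by (simp add: T'_def g(2))
  qed simp
  have "(T' ^^ Suc n) x = 0" for x
  proof -
    have "(T' ^^ Suc n) x = (T' ^^ n) (T (T (g x)))"
      by (simp only: funpow_Suc_right o_apply T'_def)
    also have "\<dots> = (T ^^ Suc (Suc n)) (g x)"
      by (simp only: pow) (simp only: funpow_Suc_right o_apply)
    finally show ?thesis using Suc.prems(2) by simp
  qed
  then have "lin_trace T' = 0" by (intro Suc.IH lin)
  moreover have "lin_trace T' = lin_trace ((T \<circ> g) \<circ> T)"
    unfolding T'_def by (rule lin_trace_commute[OF Suc.prems(1) lin(2)])
  ultimately show ?case by (simp add: o_def g(2))
qed

section \<open>The Killing form and dual bases\<close>

text \<open>The functionals \<open>b _ (\<eta> j)\<close> show that the \<open>\<xi> i\<close> are independent. Since there are \<open>DIM('e)\<close> of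
  them they span, and both sides agree on them.\<close>

lemma dual_bases_expansion:
  fixes b :: "'e::euclidean_space \<Rightarrow> 'e \<Rightarrow> real"
  assumes lin: "\<And>y. linear (\<lambda>x. b x y)" and dual: "dual_bases b \<xi> \<eta>"
  shows "x = (\<Sum>l<DIM('e). b x (\<eta> l) *\<^sub>R \<xi> l)"
proof -
  have d: "b (\<xi> i) (\<eta> j) = (if i = j then 1 else 0)" if "i < DIM('e)" "j < DIM('e)" for i j
    using dual that unfolding dual_bases_def by blast
  have inj: "inj_on \<xi> {..<DIM('e)}"
    by (intro inj_onI) (metis d lessThan_iff zero_neq_one)
  have indep: "independent (\<xi> ` {..<DIM('e)})"
  proof (rule independent_if_scalars_zero)
    fix f y assume *: "(\<Sum>y\<in>\<xi> ` {..<DIM('e)}. f y *\<^sub>R y) = 0" and "y \<in> \<xi> ` {..<DIM('e)}"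
    then obtain j where j: "j < DIM('e)" "y = \<xi> j" by auto
    have "0 = b (\<Sum>i<DIM('e). f (\<xi> i) *\<^sub>R \<xi> i) (\<eta> j)"
      using * linear_0[OF lin] by (simp add: sum.reindex[OF inj])
    also have "\<dots> = (\<Sum>i<DIM('e). f (\<xi> i) * b (\<xi> i) (\<eta> j))"
      by (simp add: linear_sum[OF lin] linear_scale[OF lin])
    also have "\<dots> = (\<Sum>i<DIM('e). if i = j then f (\<xi> i) else 0)"
      by (intro sum.cong) (auto simp: d j)
    also have "\<dots> = f y" using j by simp
    finally show "f y = 0" by simp
  qed simp
  have "UNIV \<subseteq> span (\<xi> ` {..<DIM('e)})"
    by (intro card_ge_dim_independent indep) (auto simp: card_image[OF inj])
  moreover have "linear (\<lambda>x. \<Sum>l<DIM('e). b x (\<eta> l) *\<^sub>R \<xi> l)"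
    by (intro linearI)
       (simp_all add: linear_add[OF lin] linear_scale[OF lin] sum.distrib scaleR_left_distrib scaleR_sum_right)
  moreover have "y = (\<Sum>l<DIM('e). b y (\<eta> l) *\<^sub>R \<xi> l)" if y: "y \<in> \<xi> ` {..<DIM('e)}" for y
  proof -
    obtain j where j: "j < DIM('e)" "y = \<xi> j" using y by auto
    have "(\<Sum>l<DIM('e). b y (\<eta> l) *\<^sub>R \<xi> l) = (\<Sum>l<DIM('e). if l = j then \<xi> l else 0)"
      by (intro sum.cong) (auto simp: d j)
    then show ?thesis using j by simp
  qed
  ultimately show ?thesis
    using linear_eq_on_span[of "\<lambda>x. x" "\<lambda>x. \<Sum>l<DIM('e). b x (\<eta> l) *\<^sub>R \<xi> l" "\<xi> ` {..<DIM('e)}" x]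
      linear_id[unfolded id_def] by blast
qed

text \<open>The Jacobi identity is stated as \<open>ad\<close> being a homomorphism, which is the form in which it comes
  out of differentiating \<open>Ad\<close>. Antisymmetry of the bracket is then a consequence, see
  \<open>br_antisym\<close>.\<close>

locale killing_dual =
  fixes br :: "'e::euclidean_space \<Rightarrow> 'e \<Rightarrow> 'e" and \<xi> \<eta> :: "nat \<Rightarrow> 'e"
  assumes linear_left: "\<And>y. linear (\<lambda>x. br x y)" and linear_right: "\<And>x. linear (br x)"
    and ad_hom: "\<And>x y z. br (br x y) z = br x (br y z) - br y (br x z)"
    and dual: "dual_bases (killing_form br) \<xi> \<eta>"
begin

abbreviation B :: "'e \<Rightarrow> 'e \<Rightarrow> real" where "B \<equiv> killing_form br"

lemmas br_simps = linear_add[OF linear_left] linear_add[OF linear_right]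
  linear_scale[OF linear_left] linear_scale[OF linear_right]
  linear_diff[OF linear_left] linear_diff[OF linear_right]
  linear_0[OF linear_left] linear_0[OF linear_right]

lemma B_trace: "B x y = lin_trace (br x \<circ> br y)"
  by (simp add: killing_form_def lin_trace_def)

lemma B_sym: "B x y = B y x"
  unfolding B_trace by (rule lin_trace_commute[OF linear_right linear_right])

lemma linear_B_left: "linear (\<lambda>x. B x y)"
  by (intro linearI) (simp_all add: killing_form_def br_simps inner_add_left sum.distrib sum_distrib_left)

lemma linear_B: "linear (B x)"
proof -
  have "B x = (\<lambda>y. B y x)" by (rule ext) (rule B_sym)
  then show ?thesis using linear_B_left[of x] by simp
qed

lemma B_invariant: "B (br x y) z = B x (br y z)"
proof -
  have comp: "br (br x y) \<circ> br z = (\<lambda>w. br x (br y (br z w)) - br y (br x (br z w)))" for x y z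
    by (simp add: fun_eq_iff ad_hom)
  have comp': "br x \<circ> br (br y z) = (\<lambda>w. br x (br y (br z w)) - br x (br z (br y w)))" for x y z
    by (simp add: fun_eq_iff ad_hom br_simps)
  have *: "lin_trace (\<lambda>w. S w - T w) = lin_trace S - lin_trace T" for S T :: "'e \<Rightarrow> 'e"
    by (simp add: lin_trace_def inner_diff_left sum_subtractf)
  have "lin_trace (\<lambda>w. br y (br x (br z w))) = lin_trace (\<lambda>w. br x (br z (br y w)))"
    using lin_trace_commute[OF linear_right linear_compose[OF linear_right[of z] linear_right[of x]], of y]
    by (simp add: o_def)
  then show ?thesis unfolding B_trace comp comp' * by simp
qed

lemma dual': "dual_bases B \<eta> \<xi>"
  using dual by (simp add: dual_bases_def B_sym)

lemma expand_\<xi>: "(\<Sum>l<DIM('e). B x (\<eta> l) *\<^sub>R \<xi> l) = x"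
  using dual_bases_expansion[OF linear_B_left dual] by metis

lemma expand_\<eta>: "(\<Sum>l<DIM('e). B x (\<xi> l) *\<^sub>R \<eta> l) = x"
  using dual_bases_expansion[OF linear_B_left dual'] by metis

lemma B_nondegenerate: "(\<And>y. B x y = 0) \<Longrightarrow> x = 0"
  using expand_\<xi>[of x] by simp

text \<open>By \<open>ad_hom\<close>, \<open>[x, y] + [y, x]\<close> acts trivially, hence is orthogonal to everything with respect to
  the trace form \<open>B\<close>.\<close>

lemma br_antisym: "br y x = - br x y"
proof -
  have "br (br x y + br y x) z = 0" for z
    by (simp add: br_simps ad_hom)
  then have "br x y + br y x = 0"
    by (intro B_nondegenerate) (simp add: killing_form_def)
  then show ?thesis by (simp add: eq_neg_iff_add_eq_0 add.commute)
qed

lemma B_skew: "B (br x y) z = - B y (br x z)"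
  by (subst br_antisym) (simp add: linear_neg[OF linear_B_left] B_invariant)

text \<open>The tensor \<open>\<Sum> \<xi>\<^sub>l \<otimes> \<eta>\<^sub>l\<close> is the inverse of \<open>B\<close>. Hence an endomorphism can be moved from one factor
  to the other by passing to its \<open>B\<close>-adjoint, and the tensor is symmetric as \<open>B\<close> is. All
  manipulations of sums over the dual bases below are instances of these two facts.\<close>

lemma dual_sum_adjoint:
  fixes T :: "'e \<Rightarrow> 'e \<Rightarrow> 'w::real_vector"
  assumes "\<And>y. linear (\<lambda>x. T x y)" and "\<And>x. linear (T x)"
    and adj: "\<And>x y. B (L x) y = B x (L' y)"
  shows "(\<Sum>l<DIM('e). T (L (\<xi> l)) (\<eta> l)) = (\<Sum>l<DIM('e). T (\<xi> l) (L' (\<eta> l)))"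
proof -
  have "(\<Sum>l<DIM('e). T (L (\<xi> l)) (\<eta> l))
      = (\<Sum>l<DIM('e). T (\<Sum>m<DIM('e). B (L (\<xi> l)) (\<eta> m) *\<^sub>R \<xi> m) (\<eta> l))"
    by (simp add: expand_\<xi>)
  also have "\<dots> = (\<Sum>l<DIM('e). \<Sum>m<DIM('e). B (L (\<xi> l)) (\<eta> m) *\<^sub>R T (\<xi> m) (\<eta> l))"
    by (simp add: linear_sum[OF assms(1)] linear_scale[OF assms(1)])
  also have "\<dots> = (\<Sum>m<DIM('e). \<Sum>l<DIM('e). B (L' (\<eta> m)) (\<xi> l) *\<^sub>R T (\<xi> m) (\<eta> l))"
    by (subst sum.swap) (simp add: adj B_sym[of "L' _"])
  also have "\<dots> = (\<Sum>m<DIM('e). T (\<xi> m) (\<Sum>l<DIM('e). B (L' (\<eta> m)) (\<xi> l) *\<^sub>R \<eta> l))"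
    by (simp add: linear_sum[OF assms(2)] linear_scale[OF assms(2)])
  finally show ?thesis by (simp add: expand_\<eta>)
qed

lemma dual_sum_swap:
  fixes T :: "'e \<Rightarrow> 'e \<Rightarrow> 'w::real_vector"
  assumes "\<And>y. linear (\<lambda>x. T x y)" and "\<And>x. linear (T x)"
  shows "(\<Sum>l<DIM('e). T (\<xi> l) (\<eta> l)) = (\<Sum>l<DIM('e). T (\<eta> l) (\<xi> l))"
proof -
  have "(\<Sum>l<DIM('e). T (\<xi> l) (\<eta> l))
      = (\<Sum>l<DIM('e). T (\<Sum>m<DIM('e). B (\<xi> l) (\<xi> m) *\<^sub>R \<eta> m) (\<eta> l))"
    by (simp add: expand_\<eta>)
  also have "\<dots> = (\<Sum>l<DIM('e). \<Sum>m<DIM('e). B (\<xi> l) (\<xi> m) *\<^sub>R T (\<eta> m) (\<eta> l))"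
    by (simp add: linear_sum[OF assms(1)] linear_scale[OF assms(1)])
  also have "\<dots> = (\<Sum>m<DIM('e). \<Sum>l<DIM('e). B (\<xi> m) (\<xi> l) *\<^sub>R T (\<eta> m) (\<eta> l))"
    by (subst sum.swap) (simp add: B_sym)
  also have "\<dots> = (\<Sum>m<DIM('e). T (\<eta> m) (\<Sum>l<DIM('e). B (\<xi> m) (\<xi> l) *\<^sub>R \<eta> l))"
    by (simp add: linear_sum[OF assms(2)] linear_scale[OF assms(2)])
  finally show ?thesis by (simp add: expand_\<eta>)
qed

lemma contract_eq_dual_sum:
  fixes T :: "'e \<Rightarrow> 'e \<Rightarrow> 'w::real_vector"
  assumes "\<And>y. linear (\<lambda>x. T x y)" and "\<And>x. linear (T x)"
  shows "contract B T = (\<Sum>l<DIM('e). T (\<xi> l) (\<eta> l))"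
proof -
  have sharp: "sharp B (\<lambda>y. a \<bullet> y) = (\<Sum>l<DIM('e). (a \<bullet> \<eta> l) *\<^sub>R \<xi> l)" for a
    unfolding sharp_def
  proof (rule the_equality)
    show "\<forall>Y. B (\<Sum>l<DIM('e). (a \<bullet> \<eta> l) *\<^sub>R \<xi> l) Y = a \<bullet> Y"
    proof
      fix Y
      have "B (\<Sum>l<DIM('e). (a \<bullet> \<eta> l) *\<^sub>R \<xi> l) Y = a \<bullet> (\<Sum>l<DIM('e). B Y (\<xi> l) *\<^sub>R \<eta> l)"
        by (simp add: linear_sum[OF linear_B_left] linear_scale[OF linear_B_left] inner_sum_right B_sym[of Y] mult.commute)
      then show "B (\<Sum>l<DIM('e). (a \<bullet> \<eta> l) *\<^sub>R \<xi> l) Y = a \<bullet> Y" by (simp add: expand_\<eta>)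
    qed
    fix X assume "\<forall>Y. B X Y = a \<bullet> Y"
    then show "X = (\<Sum>l<DIM('e). (a \<bullet> \<eta> l) *\<^sub>R \<xi> l)"
      using expand_\<xi>[of X] by simp
  qed
  have B_sharp: "B (sharp B (\<lambda>x. a \<bullet> x)) y = a \<bullet> y" for a y
  proof -
    have "B (sharp B (\<lambda>x. a \<bullet> x)) y = a \<bullet> (\<Sum>l<DIM('e). B y (\<xi> l) *\<^sub>R \<eta> l)"
      unfolding sharp
      by (simp add: linear_sum[OF linear_B_left] linear_scale[OF linear_B_left] inner_sum_right B_sym[of y] mult.commute)
    then show ?thesis by (simp add: expand_\<eta>)
  qed
  have basis: "(\<Sum>a\<in>Basis. \<Sum>c\<in>Basis. ((a \<bullet> x) * (c \<bullet> y)) *\<^sub>R T a c) = T x y" for x y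
  proof -
    have "T x y = T (\<Sum>a\<in>Basis. (x \<bullet> a) *\<^sub>R a) (\<Sum>c\<in>Basis. (y \<bullet> c) *\<^sub>R c)"
      by (simp add: euclidean_representation)
    also have "\<dots> = (\<Sum>c\<in>Basis. \<Sum>a\<in>Basis. ((a \<bullet> x) * (c \<bullet> y)) *\<^sub>R T a c)"
      by (simp add: linear_sum[OF assms(1)] linear_scale[OF assms(1)] linear_sum[OF assms(2)]
          linear_scale[OF assms(2)] scaleR_sum_right inner_commute mult.commute)
    also have "\<dots> = (\<Sum>a\<in>Basis. \<Sum>c\<in>Basis. ((a \<bullet> x) * (c \<bullet> y)) *\<^sub>R T a c)"
      by (rule sum.swap)
    finally show ?thesis by simp
  qed
  have "contract B T = (\<Sum>a\<in>Basis. \<Sum>c\<in>Basis. \<Sum>l<DIM('e). ((a \<bullet> \<xi> l) * (c \<bullet> \<eta> l)) *\<^sub>R T a c)"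
    unfolding contract_def B_sharp
    by (simp add: sharp inner_sum_right scaleR_sum_left mult.commute)
  also have "\<dots> = (\<Sum>a\<in>Basis. \<Sum>l<DIM('e). \<Sum>c\<in>Basis. ((a \<bullet> \<xi> l) * (c \<bullet> \<eta> l)) *\<^sub>R T a c)"
    by (intro sum.cong refl sum.swap)
  also have "\<dots> = (\<Sum>l<DIM('e). \<Sum>a\<in>Basis. \<Sum>c\<in>Basis. ((a \<bullet> \<xi> l) * (c \<bullet> \<eta> l)) *\<^sub>R T a c)"
    by (rule sum.swap)
  finally show ?thesis by (simp add: basis)
qed

end

section \<open>Gradings and the nilradical of a parabolic subalgebra\<close>

locale graded_killing_dual = killing_dual br \<xi> \<eta>
  for br :: "'e::euclidean_space \<Rightarrow> 'e \<Rightarrow> 'e" and \<xi> \<eta> :: "nat \<Rightarrow> 'e" +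
  fixes k :: nat and gr :: "int \<Rightarrow> 'e set"
  assumes grading: "grading br k gr"
begin

definition component :: "int \<Rightarrow> 'e \<Rightarrow> 'e" where
  "component i x = (THE f. (\<forall>i. f i \<in> gr i) \<and> x = (\<Sum>i\<in>{- int k..int k}. f i)) i"

lemma subspace_gr: "subspace (gr i)"
  and gr_large: "\<bar>i\<bar> > int k \<Longrightarrow> gr i = {0}"
  and ex1_components: "\<exists>!f. (\<forall>i. f i \<in> gr i) \<and> x = (\<Sum>i\<in>{- int k..int k}. f i)"
  and br_gr: "x \<in> gr i \<Longrightarrow> y \<in> gr j \<Longrightarrow> br x y \<in> gr (i + j)"
  using grading unfolding grading_def by blast+

lemma component_in: "component i x \<in> gr i"
  and sum_component: "(\<Sum>i\<in>{- int k..int k}. component i x) = x"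
  using theI'[OF ex1_components[of x]] unfolding component_def by metis+

lemma component_unique:
  assumes "\<And>i. f i \<in> gr i" "x = (\<Sum>i\<in>{- int k..int k}. f i)"
  shows "component i x = f i"
proof -
  have "(THE f. (\<forall>i. f i \<in> gr i) \<and> x = (\<Sum>i\<in>{- int k..int k}. f i)) = f"
    by (rule the1_equality[OF ex1_components]) (use assms in auto)
  then show ?thesis by (simp add: component_def)
qed

lemma component_large: "\<bar>i\<bar> > int k \<Longrightarrow> component i x = 0"
  using component_in[of i x] gr_large by blast

lemma linear_component: "linear (component i)"
proof (rule linearI)
  show "component i (x + y) = component i x + component i y" for x y
    by (rule component_unique) (auto intro!: subspace_add subspace_gr component_in simp: sum.distrib sum_component)
  show "component i (c *\<^sub>R x) = c *\<^sub>R component i x" for c x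
    by (rule component_unique) (auto intro!: subspace_scale subspace_gr component_in simp: scaleR_sum_right[symmetric] sum_component)
qed

lemma component_gr:
  assumes "x \<in> gr j" shows "component i x = (if i = j then x else 0)"
proof (cases "\<bar>j\<bar> > int k")
  case True
  then have "x = 0" using assms gr_large by blast
  then show ?thesis by (simp add: linear_0[OF linear_component])
next
  case False
  show ?thesis
    by (rule component_unique) (use False assms in \<open>auto simp: subspace_0[OF subspace_gr]\<close>)
qed

lemmas component_simps = linear_add[OF linear_component] linear_scale[OF linear_component] linear_0[OF linear_component]

lemma grading_eqI: "(\<And>i. component i x = component i y) \<Longrightarrow> x = y"
  by (metis sum_component sum.cong)

text \<open>The map \<open>ad x ad y\<close> shifts degrees by \<open>i + j \<noteq> 0\<close>, so \<open>2 k + 1\<close> applications lead from degrees in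
  \<open>{-k..k}\<close> to degrees outside.\<close>

lemma B_gr:
  assumes x: "x \<in> gr i" and y: "y \<in> gr j" and ij: "i + j \<noteq> 0"
  shows "B x y = 0"
proof -
  define T where "T = br x \<circ> br y"
  have lin: "linear T" unfolding T_def by (intro linear_compose linear_right)
  have T_apply: "T z = br x (br y z)" for z by (simp add: T_def)
  have linn: "linear (T ^^ n)" for n
  proof (induction n)
    case (Suc n)
    then show ?case using linear_compose[OF Suc lin] by (simp add: o_def)
  qed (simp add: linear_id[unfolded id_def] id_def)
  have shift: "(T ^^ n) z \<in> gr (m + int n * (i + j))" if "z \<in> gr m" for m z n
  proof (induction n)
    case (Suc n)
    have "br x (br y ((T ^^ n) z)) \<in> gr (i + (j + (m + int n * (i + j))))"
      by (intro br_gr x y Suc)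
    moreover have "(T ^^ Suc n) z = br x (br y ((T ^^ n) z))"
      by (simp add: T_apply[of "(T ^^ n) z"])
    moreover have "i + (j + (m + int n * (i + j))) = m + int (Suc n) * (i + j)"
      by (simp add: algebra_simps)
    ultimately show ?case by simp
  qed (use that in simp)
  have large: "int k < \<bar>m + int (Suc (2 * k)) * (i + j)\<bar>" if "\<bar>m\<bar> \<le> int k" for m
  proof -
    define d where "d = \<bar>i + j\<bar>"
    have "1 \<le> d" using ij by (simp add: d_def)
    then have "int (Suc (2 * k)) * 1 \<le> int (Suc (2 * k)) * d"
      by (intro mult_left_mono) simp_all
    moreover have "\<bar>int (Suc (2 * k)) * (i + j)\<bar> = int (Suc (2 * k)) * d"
      by (simp only: abs_mult abs_of_nat d_def)
    ultimately have "int (Suc (2 * k)) \<le> \<bar>int (Suc (2 * k)) * (i + j)\<bar>"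
      by (simp only: mult_1_right)
    moreover have "int (Suc (2 * k)) = 2 * int k + 1" by simp
    ultimately show ?thesis
      using that abs_triangle_ineq4[of "m + int (Suc (2 * k)) * (i + j)" m] by linarith
  qed
  have "(T ^^ Suc (2 * k)) z = 0" for z
  proof -
    have "(T ^^ Suc (2 * k)) (component m z) = 0" if "m \<in> {- int k..int k}" for m
      using shift[OF component_in, of "Suc (2*k)" m z] gr_large[OF large[of m]] that by auto
    then have "(\<Sum>m\<in>{- int k..int k}. (T ^^ Suc (2 * k)) (component m z)) = 0" by simp
    then have "(T ^^ Suc (2 * k)) (\<Sum>m\<in>{- int k..int k}. component m z) = 0"
      unfolding linear_sum[OF linn] .
    then show ?thesis by (simp only: sum_component)
  qed
  then show ?thesis
    unfolding B_trace T_def[symmetric] by (rule lin_trace_nilpotent[OF lin])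
qed

lemma B_component: "B (component i x) y = B x (component (- i) y)"
proof (cases "\<bar>i\<bar> > int k")
  case True
  then show ?thesis by (simp add: component_large linear_0[OF linear_B] linear_0[OF linear_B_left])
next
  case False
  have left: "B (component i x) y = B (component i x) (component (- i) y)" for x y i
  proof (cases "\<bar>i\<bar> > int k")
    case True
    then show ?thesis by (simp add: component_large linear_0[OF linear_B] linear_0[OF linear_B_left])
  next
    case False
    have "B (component i x) y = (\<Sum>j\<in>{- int k..int k}. B (component i x) (component j y))"
      by (subst (1) sum_component[of y, symmetric]) (rule linear_sum[OF linear_B])
    also have "\<dots> = (\<Sum>j\<in>{- int k..int k}. if j = - i then B (component i x) (component j y) else 0)"
      by (intro sum.cong refl) (auto intro!: B_gr component_in)
    moreover have "- i \<in> {- int k..int k}" using False by auto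
    ultimately show ?thesis by simp
  qed
  show ?thesis
    using left[of i x y] left[of "- i" y x] by (simp add: B_sym[of "component (- i) y"])
qed

definition nonneg :: "'e set" where "nonneg = span (\<Union>i\<in>{i. i \<ge> 0}. gr i)"
text \<open>The parabolic subalgebra \<open>\<pp>\<close> is \<open>nonneg\<close>, and \<open>positive\<close> is the ideal \<open>\<pp>\<^sub>+\<close> of elements of positive
  degree.\<close>

definition positive :: "'e set" where "positive = {x. \<forall>i\<le>0. component i x = 0}"
definition neg_part :: "'e \<Rightarrow> 'e" where "neg_part x = (\<Sum>i\<in>{- int k..-1}. component i x)"
definition pos_part :: "'e \<Rightarrow> 'e" where "pos_part x = (\<Sum>i\<in>{1..int k}. component i x)"

lemma gr_nonneg: "i \<ge> 0 \<Longrightarrow> x \<in> gr i \<Longrightarrow> x \<in> nonneg"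
  unfolding nonneg_def by (intro span_base) auto

lemma subspace_nonneg: "subspace nonneg"
  by (simp add: nonneg_def)

lemma nonneg_iff: "x \<in> nonneg \<longleftrightarrow> (\<forall>i<0. component i x = 0)"
proof
  assume "x \<in> nonneg"
  then have "x \<in> span (\<Union>i\<in>{i. i \<ge> 0}. gr i)" by (simp add: nonneg_def)
  then show "\<forall>i<0. component i x = 0"
    by (induction rule: span_induct_alt) (auto simp: component_simps component_gr)
next
  assume *: "\<forall>i<0. component i x = 0"
  have "component i x \<in> nonneg" for i
    by (cases "i < 0") (use * subspace_0[OF subspace_nonneg] gr_nonneg[OF _ component_in] in auto)
  then have "(\<Sum>i\<in>{- int k..int k}. component i x) \<in> nonneg"
    by (intro subspace_sum[OF subspace_nonneg])
  then show "x \<in> nonneg" by (simp add: sum_component)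
qed

lemma decomposition: "neg_part x + component 0 x + pos_part x = x"
proof -
  have "{- int k..int k} = {- int k..-1} \<union> ({0} \<union> {1..int k})" by auto
  then have "(\<Sum>i\<in>{- int k..int k}. component i x) = neg_part x + (component 0 x + pos_part x)"
    unfolding neg_part_def pos_part_def by (simp only:) (subst sum.union_disjoint; force)+
  then show ?thesis by (simp add: sum_component algebra_simps)
qed

lemma linear_neg_part: "linear neg_part" and linear_pos_part: "linear pos_part"
  unfolding neg_part_def[abs_def] pos_part_def[abs_def]
  by (auto intro!: linear_compose_sum linear_component)

lemma B_neg_part: "B (neg_part x) y = B x (pos_part y)"
proof -
  have "B (neg_part x) y = (\<Sum>i\<in>{- int k..-1}. B x (component (- i) y))"
    unfolding neg_part_def by (simp add: linear_sum[OF linear_B_left] B_component)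
  also have "\<dots> = (\<Sum>i\<in>{1..int k}. B x (component i y))"
    by (rule sum.reindex_bij_witness[of _ uminus uminus]) auto
  finally show ?thesis
    unfolding pos_part_def by (simp add: linear_sum[OF linear_B])
qed

lemma B_pos_part: "B (pos_part x) y = B x (neg_part y)"
  by (subst B_sym, subst B_neg_part[symmetric], rule B_sym)

lemma positive_subset_nonneg: "positive \<subseteq> nonneg"
  by (auto simp: positive_def nonneg_iff)

lemma subspace_positive: "subspace positive"
  by (auto simp: positive_def subspace_def component_simps)

lemma component_component: "component i (component j x) = (if i = j then component j x else 0)"
  by (rule component_gr[OF component_in])

lemma pos_part_in_positive: "pos_part x \<in> positive"
  unfolding pos_part_def by (intro subspace_sum subspace_positive) (auto simp: positive_def component_component)

lemma component_0_in_nonneg: "component 0 x \<in> nonneg"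
  by (rule gr_nonneg[OF _ component_in]) simp

lemma pos_part_positive: "x \<in> positive \<Longrightarrow> pos_part x = x"
proof -
  assume x: "x \<in> positive"
  then have "neg_part x = 0" "component 0 x = 0" by (auto simp: positive_def neg_part_def)
  then show ?thesis using decomposition[of x] by simp
qed

text \<open>The component of degree \<open>i\<close> pairs with the component of degree \<open>-i\<close> only. So orthogonality to the
  non-negative degrees makes every component of degree \<open>i \<le> 0\<close> orthogonal to the whole algebra.\<close>

lemma positive_iff_perp: "x \<in> positive \<longleftrightarrow> (\<forall>y\<in>nonneg. B x y = 0)"
proof
  assume "x \<in> positive"
  then have x: "x = pos_part x" by (simp add: pos_part_positive)
  show "\<forall>y\<in>nonneg. B x y = 0"
  proof
    fix y assume "y \<in> nonneg"
    then have "neg_part y = 0" by (simp add: nonneg_iff neg_part_def)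
    then show "B x y = 0" by (subst x) (simp add: B_pos_part linear_0[OF linear_B])
  qed
next
  assume *: "\<forall>y\<in>nonneg. B x y = 0"
  have "component i x = 0" if "i \<le> 0" for i
    by (rule B_nondegenerate) (use that * gr_nonneg[OF _ component_in, of "- i"] in \<open>simp add: B_component\<close>)
  then show "x \<in> positive" by (simp add: positive_def)
qed

text \<open>Brackets add the indices of this filtration, which gives at once that \<open>\<pp>\<close> (index \<open>0\<close>) is a
  subalgebra and that \<open>\<pp>\<^sub>+\<close> (index \<open>1\<close>) is a nilpotent ideal of it.\<close>

definition filtration :: "int \<Rightarrow> 'e set" where "filtration n = {x. \<forall>i<n. component i x = 0}"

lemma subspace_filtration: "subspace (filtration n)"
  by (auto simp: filtration_def subspace_def component_simps)

lemma br_filtration: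
  assumes "x \<in> filtration m" "y \<in> filtration n" shows "br x y \<in> filtration (m + n)"
proof -
  have "br (component i x) (component j y) \<in> filtration (m + n)" for i j
  proof (cases "i < m \<or> j < n")
    case True
    then have "component i x = 0 \<or> component j y = 0" using assms by (auto simp: filtration_def)
    then show ?thesis using subspace_0[OF subspace_filtration] by (auto simp: br_simps)
  next
    case False
    then show ?thesis using br_gr[OF component_in component_in, of i x j y] by (auto simp: filtration_def component_gr)
  qed
  then have "(\<Sum>i\<in>{- int k..int k}. \<Sum>j\<in>{- int k..int k}. br (component i x) (component j y)) \<in> filtration (m + n)"
    by (intro subspace_sum subspace_filtration)
  also have "(\<Sum>i\<in>{- int k..int k}. \<Sum>j\<in>{- int k..int k}. br (component i x) (component j y)) = br x y"
    by (simp add: linear_sum[OF linear_right, symmetric] linear_sum[OF linear_left, symmetric] sum_component)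
  finally show ?thesis .
qed

lemma nonneg_filtration: "nonneg = filtration 0" and positive_filtration: "positive = filtration 1"
  by (auto simp: filtration_def nonneg_iff positive_def)

lemma br_nonneg: "x \<in> nonneg \<Longrightarrow> y \<in> nonneg \<Longrightarrow> br x y \<in> nonneg"
  using br_filtration[of x 0 y 0] by (simp add: nonneg_filtration)

lemma nilpotent_positive: "nilpotent br positive"
proof -
  have sub: "(bracket_span br positive ^^ n) positive \<subseteq> filtration (int n + 1)" for n
  proof (induction n)
    case 0
    then show ?case by (simp add: positive_filtration)
  next
    case (Suc n)
    have "{br x y |x y. x \<in> positive \<and> y \<in> (bracket_span br positive ^^ n) positive} \<subseteq> filtration (int (Suc n) + 1)"
      using br_filtration[of _ 1 _ "int n + 1"] Suc by (force simp: positive_filtration algebra_simps)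
    moreover have "(bracket_span br positive ^^ Suc n) positive
        = span {br x y |x y. x \<in> positive \<and> y \<in> (bracket_span br positive ^^ n) positive}"
      by (simp only: funpow.simps o_apply bracket_span_def[of br positive "(bracket_span br positive ^^ n) positive"])
    ultimately show ?case by (simp only: span_minimal subspace_filtration)
  qed
  have "x = 0" if "x \<in> filtration (int k + 1)" for x
  proof (rule grading_eqI)
    fix i show "component i x = component i 0"
      using that component_large[of i x] by (cases "i < int k + 1") (simp_all add: filtration_def component_simps)
  qed
  then have "(bracket_span br positive ^^ k) positive \<subseteq> {0}" using sub[of k] by auto
  moreover have "0 \<in> (bracket_span br positive ^^ n) positive" for n
  proof (cases n)
    case (Suc m)
    then show ?thesis
      by (simp only: funpow.simps o_apply bracket_span_def[of br positive "(bracket_span br positive ^^ m) positive"] span_0)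
  qed (simp add: subspace_0[OF subspace_positive])
  ultimately show ?thesis unfolding nilpotent_def by blast
qed

lemma lie_ideal_positive: "lie_ideal br nonneg positive"
  unfolding lie_ideal_def using br_filtration[of _ 0 _ 1] subspace_positive positive_subset_nonneg
  by (auto simp: nonneg_filtration positive_filtration)

text \<open>It suffices that \<open>ad x ad y\<close> is nilpotent for \<open>x \<in> I\<close> and \<open>y \<in> \<pp>\<close>, since then \<open>B x y = 0\<close> and
  \<open>x \<in> \<pp>\<^sup>\<bottom> = \<pp>\<^sub>+\<close>. On \<open>\<pp>\<close> this map descends the chain \<open>\<pp> \<supseteq> I \<supseteq> [I, I] \<supseteq> \<dots>\<close> of ideals of \<open>\<pp>\<close>, as \<open>ad y\<close>
  preserves every term and \<open>ad x\<close> moves it into the next one. Outside \<open>\<pp>\<close> the chain of orthogonal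
  complements does the same: by invariance of \<open>B\<close>, the map sends the complement of a term to the
  complement of the preceding term. It starts with the whole algebra, the complement of \<open>0\<close>,
  and ends with \<open>\<pp>\<^sup>\<bottom> \<subseteq> \<pp>\<close>.\<close>

lemma nilpotent_ideal_subset:
  assumes I: "lie_ideal br nonneg I" and "nilpotent br I"
  shows "I \<subseteq> positive"
proof -
  \<comment> \<open>the chain: \<open>\<pp>\<close> itself, followed by the lower central series of \<open>I\<close>\<close>
  define C where "C n = (case n of 0 \<Rightarrow> nonneg | Suc n \<Rightarrow> (bracket_span br I ^^ n) I)" for n
  have C0: "C 0 = nonneg" and C1: "C (Suc 0) = I" by (simp_all add: C_def)
  have CS: "C (Suc (Suc l)) = span {br v w |v w. v \<in> I \<and> w \<in> C (Suc l)}" for l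
    by (simp only: C_def nat.case funpow.simps o_apply bracket_span_def[of br I "(bracket_span br I ^^ l) I"])
  obtain n where n: "(bracket_span br I ^^ n) I = {0}" using assms(2) nilpotent_def by blast
  have sI: "subspace I" "I \<subseteq> nonneg" and II: "\<And>x y. x \<in> nonneg \<Longrightarrow> y \<in> I \<Longrightarrow> br x y \<in> I"
    using I by (auto simp: lie_ideal_def)
  have IC: "br x y \<in> C (Suc m)" if "x \<in> I" "y \<in> C m" for x y m
  proof (cases m)
    case 0
    then have "br y x \<in> I" using that II by (auto simp: C0)
    then have "- br y x \<in> I" by (rule subspace_neg[OF sI(1)])
    then show ?thesis using 0 by (simp add: C1 br_antisym[of x y])
  next
    case (Suc l)
    then show ?thesis using that unfolding Suc CS by (intro span_base) auto
  qed
  have PC: "br x y \<in> C m" if "x \<in> nonneg" "y \<in> C m" for x y m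
    using that(2)
  proof (induction m arbitrary: y)
    case 0
    then show ?case using that br_nonneg by (simp add: C0)
  next
    case (Suc m)
    show ?case
    proof (cases m)
      case 0
      then show ?thesis using Suc that II by (simp add: C1)
    next
      case (Suc l)
      have CS: "C (Suc m) = span {br v w |v w. v \<in> I \<and> w \<in> C m}"
        unfolding Suc by (rule CS)
      have "y \<in> span {br v w |v w. v \<in> I \<and> w \<in> C m}"
        using Suc.prems CS by blast
      then show ?thesis
      proof (induction rule: span_induct_alt)
        case base
        then show ?case by (simp add: br_simps CS span_0)
      next
        case (step c z y)
        then obtain v w where vw: "z = br v w" "v \<in> I" "w \<in> C m" by auto
        have "br x z = br v (br x w) + br (br x v) w"
          by (simp add: vw ad_hom)
        also have "\<dots> \<in> C (Suc m)"
          using IC[OF vw(2) Suc.IH[OF vw(3)]] IC[OF II[OF that(1) vw(2)] vw(3)]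
          by (simp add: CS span_add)
        finally show ?case
          using step by (simp add: br_simps CS span_add span_scale)
      qed
    qed
  qed
  have "B x y = 0" if x: "x \<in> I" and y: "y \<in> nonneg" for x y
  proof -
    define T where "T = br x \<circ> br y"
    have lin: "linear T" unfolding T_def by (intro linear_compose linear_right)
    have TC: "T z \<in> C (Suc m)" if "z \<in> C m" for z m
      unfolding T_def o_apply by (intro IC x PC y that)
    have powC: "(T ^^ m) z \<in> C m" if "z \<in> nonneg" for z m
      by (induction m) (use that TC in \<open>simp_all add: C0\<close>)
    \<comment> \<open>the orthogonal complements of the terms of the chain\<close>
    define D where "D m = {z. \<forall>c\<in>C m. B z c = 0}" for m
    have TD: "T z \<in> D m" if z: "z \<in> D (Suc m)" for z m
      unfolding D_def
    proof safe
      fix c assume c: "c \<in> C m"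
      have "B (T z) c = B z (br y (br x c))"
        by (simp add: T_def B_skew)
      moreover have "br y (br x c) \<in> C (Suc m)" by (intro PC y IC x c)
      ultimately show "B (T z) c = 0" using z by (simp add: D_def)
    qed
    have powD: "(T ^^ m) z \<in> D (Suc n - m)" if "m \<le> Suc n" for z m
      using that
    proof (induction m)
      case 0
      then show ?case using n by (simp add: C_def D_def linear_0[OF linear_B])
    next
      case (Suc m)
      then show ?case using TD[of "(T ^^ m) z" "Suc n - Suc m"] by (simp add: Suc_diff_le)
    qed
    have "(T ^^ Suc (n + Suc n)) z = 0" for z
    proof -
      have "(T ^^ Suc n) z \<in> positive" using powD[of "Suc n" z] by (simp add: D_def C0 positive_iff_perp)
      then have "(T ^^ Suc n) ((T ^^ Suc n) z) \<in> C (Suc n)" using powC positive_subset_nonneg by blast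
      moreover have "C (Suc n) = {0}" using n by (simp add: C_def)
      moreover have "(T ^^ Suc (n + Suc n)) z = (T ^^ Suc n) ((T ^^ Suc n) z)"
        by (metis add_Suc comp_apply funpow_add)
      ultimately show ?thesis by (metis singletonD)
    qed
    then show ?thesis
      unfolding B_trace T_def[symmetric] by (rule lin_trace_nilpotent[OF lin])
  qed
  then show ?thesis by (auto simp: positive_iff_perp)
qed

lemma nilradical_nonneg: "nilradical br nonneg = positive"
proof
  show "nilradical br nonneg \<subseteq> positive"
    unfolding nilradical_def
    by (intro span_minimal subspace_positive Union_least) (auto dest: nilpotent_ideal_subset)
  show "positive \<subseteq> nilradical br nonneg"
    unfolding nilradical_def using lie_ideal_positive nilpotent_positive by (auto intro: span_base)
qed

end

section \<open>The Casimir identity at a point\<close>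

context graded_killing_dual
begin

text \<open>Here \<open>D\<close>, \<open>D2\<close> and \<open>w\<close> stand for the first derivative, the second derivative and the value of an
  equivariant function at a point. Both Casimir sums are split according to whether the left
  factor has negative, zero or positive degree. With

    \<open>a = \<Sum> \<eta>\<^sub>+ \<bullet> D \<xi>\<close>, \<open>a' = \<Sum> \<eta>\<^sub>+ \<bullet> \<xi> \<bullet> w\<close>, \<open>z = \<Sum> \<xi>\<^sub>0 \<bullet> \<eta>\<^sub>0 \<bullet> w\<close>, \<open>b = \<Sum> [\<xi>\<^sub>+, \<eta>] \<bullet> w\<close>

  the parts of the sum of \<open>D2\<close> are \<open>- a\<close>, \<open>z\<close> and \<open>- a - b\<close>, and those of the algebraic sum are
  \<open>a' - b\<close>, \<open>z\<close> and \<open>a'\<close>. The difference is \<open>- 2 (a + a')\<close>.\<close>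

lemma casimir_identity:
  fixes act :: "'e \<Rightarrow> 'v::real_vector \<Rightarrow> 'v" and D :: "'e \<Rightarrow> 'v" and D2 :: "'e \<Rightarrow> 'e \<Rightarrow> 'v"
  assumes act_left: "\<And>v. linear (\<lambda>X. act X v)" and act_right: "\<And>X. linear (act X)"
    and act_hom: "\<And>X Y v. act (br X Y) v = act X (act Y v) - act Y (act X v)"
    and D: "linear D" and D2_left: "\<And>Y. linear (\<lambda>X. D2 X Y)" and D2_right: "\<And>X. linear (D2 X)"
    and D_nonneg: "\<And>Y. Y \<in> nonneg \<Longrightarrow> D Y = - act Y w"
    and D2_nonneg_right: "\<And>X Y. Y \<in> nonneg \<Longrightarrow> D2 X Y = - act Y (D X)"
    and D2_nonneg_left: "\<And>X Y. X \<in> nonneg \<Longrightarrow> D2 X Y = - act X (D Y) + D (br X Y)"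
  shows "(\<Sum>l<DIM('e). D2 (\<xi> l) (\<eta> l)) =
    (\<Sum>l<DIM('e). act (\<xi> l) (act (\<eta> l) w)) - 2 *\<^sub>R (\<Sum>l<DIM('e). act (\<eta> l) (D (\<xi> l) + act (\<xi> l) w))"
proof -
  define S where "S T = (\<Sum>l<DIM('e). T (\<xi> l) (\<eta> l))" for T :: "'e \<Rightarrow> 'e \<Rightarrow> 'v"
  have S_add: "S (\<lambda>X Y. T X Y + U X Y) = S T + S U" for T U by (simp add: S_def sum.distrib)
  have S_diff: "S (\<lambda>X Y. T X Y - U X Y) = S T - S U" for T U by (simp add: S_def sum_subtractf)
  have S_neg: "S (\<lambda>X Y. - T X Y) = - S T" for T by (simp add: S_def sum_negf)
  have S_adj: "S (\<lambda>X Y. T (L X) Y) = S (\<lambda>X Y. T X (L' Y))"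
    if "\<And>Y. linear (\<lambda>X. T X Y)" "\<And>X. linear (T X)" "\<And>x y. B (L x) y = B x (L' y)" for T L L'
    unfolding S_def by (rule dual_sum_adjoint) (use that in auto)
  have S_swap: "S T = S (\<lambda>X Y. T Y X)" if "\<And>Y. linear (\<lambda>X. T X Y)" "\<And>X. linear (T X)" for T
    unfolding S_def by (rule dual_sum_swap) (use that in auto)
  have pos_idem: "pos_part (pos_part X) = pos_part X" for X by (rule pos_part_positive[OF pos_part_in_positive])
  have pos_nonneg: "pos_part X \<in> nonneg" for X using pos_part_in_positive positive_subset_nonneg by blast
  define N where "N X = D X + act X w" for X
  have N: "linear N" unfolding N_def by (intro linear_compose_add D act_left)
  have N_nonneg: "N X = 0" if "X \<in> nonneg" for X using D_nonneg[OF that] by (simp add: N_def)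
  have N_neg: "N (neg_part X) = N X" for X
    by (subst (2) decomposition[of X, symmetric])
       (simp add: linear_add[OF N] N_nonneg pos_nonneg component_0_in_nonneg)
  have D_N: "D X = N X - act X w" for X by (simp add: N_def)
  note simps = linear_add[OF act_left] linear_scale[OF act_left] linear_add[OF act_right]
    linear_scale[OF act_right] linear_add[OF D] linear_scale[OF D] linear_add[OF N] linear_scale[OF N]
    linear_add[OF D2_left] linear_scale[OF D2_left] linear_add[OF D2_right] linear_scale[OF D2_right]
    br_simps component_simps linear_add[OF linear_pos_part] linear_scale[OF linear_pos_part]
    linear_add[OF linear_neg_part] linear_scale[OF linear_neg_part]
  have dec: "S T = S (\<lambda>X Y. T (neg_part X) Y) + S (\<lambda>X Y. T (component 0 X) Y) + S (\<lambda>X Y. T (pos_part X) Y)"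
    if lin: "\<And>Y. linear (\<lambda>X. T X Y)" for T
  proof -
    have "S T = S (\<lambda>X Y. T (neg_part X + component 0 X + pos_part X) Y)"
      by (simp add: decomposition)
    then show ?thesis by (simp add: linear_add[OF lin] S_add)
  qed
  have B_component_0: "B (component 0 x) y = B x (component 0 y)" for x y using B_component[of 0] by simp
  have S_component_0: "S (\<lambda>X Y. T (component 0 X) Y) = S (\<lambda>X Y. T (component 0 X) (component 0 Y))"
    if lin: "\<And>Y. linear (\<lambda>X. T X Y)" "\<And>X. linear (T X)" for T
    using S_adj[of "\<lambda>X Y. T (component 0 X) Y" "component 0" "component 0"] B_component_0
      linear_compose[OF linear_component[of 0] lin(1)] lin(2) by (simp add: component_component o_def)
  define a where "a = S (\<lambda>X Y. act (pos_part Y) (D X))"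
  define a' where "a' = S (\<lambda>X Y. act (pos_part Y) (act X w))"
  define z where "z = S (\<lambda>X Y. act (component 0 X) (act (component 0 Y) w))"
  define b where "b = S (\<lambda>X Y. act (br (pos_part X) Y) w)"
  have a_swap: "S (\<lambda>X Y. act (pos_part X) (D Y)) = a"
    unfolding a_def by (rule S_swap) (auto intro!: linearI simp: simps)
  have a'_swap: "S (\<lambda>X Y. act (pos_part X) (act Y w)) = a'"
    unfolding a'_def by (rule S_swap) (auto intro!: linearI simp: simps)
  \<comment> \<open>the summed bracket of degrees \<open>i\<close> and \<open>-i\<close> has degree \<open>0\<close>, where \<open>N\<close> vanishes\<close>
  have bracket_0: "S (\<lambda>X Y. N (br (component i X) Y)) = 0" for i
  proof -
    have "S (\<lambda>X Y. N (br (component i (component i X)) Y)) = S (\<lambda>X Y. N (br (component i X) (component (- i) Y)))"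
      by (rule S_adj) (auto intro!: linearI simp: simps B_component)
    moreover have "N (br (component i X) (component (- i) Y)) = 0" for X Y
      using br_gr[OF component_in component_in, of i X "- i" Y] by (intro N_nonneg gr_nonneg[of 0]) auto
    ultimately show ?thesis by (simp add: component_component S_def)
  qed
  have bracket_pos: "S (\<lambda>X Y. N (br (pos_part X) Y)) = 0"
  proof -
    have "S (\<lambda>X Y. N (br (pos_part X) Y)) = (\<Sum>i\<in>{1..int k}. S (\<lambda>X Y. N (br (component i X) Y)))"
      unfolding pos_part_def S_def by (subst sum.swap) (simp add: linear_sum[OF linear_left] linear_sum[OF N])
    then show ?thesis by (simp add: bracket_0)
  qed
  \<comment> \<open>an antisymmetric expression, summed over the symmetric tensor \<open>\<Sum> \<xi>\<^sub>l \<otimes> \<eta>\<^sub>l\<close>\<close>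
  have antisym_0: "S (\<lambda>X Y. act (br (component 0 X) Y) w) = 0"
  proof -
    have "S (\<lambda>X Y. act (br (component 0 X) Y) w) = S (\<lambda>X Y. act (br (component 0 X) (component 0 Y)) w)"
      by (rule S_component_0) (auto intro!: linearI simp: simps)
    moreover have "S (\<lambda>X Y. act (br (component 0 X) (component 0 Y)) w) = S (\<lambda>X Y. act (br (component 0 Y) (component 0 X)) w)"
      by (rule S_swap) (auto intro!: linearI simp: simps)
    moreover have "(\<lambda>X Y. act (br (component 0 Y) (component 0 X)) w) = (\<lambda>X Y. - act (br (component 0 X) (component 0 Y)) w)"
      by (intro ext, subst br_antisym) (rule linear_neg[OF act_left])
    ultimately have "S (\<lambda>X Y. act (br (component 0 X) Y) w) = - S (\<lambda>X Y. act (br (component 0 X) Y) w)"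
      by (metis S_neg)
    then have "2 *\<^sub>R S (\<lambda>X Y. act (br (component 0 X) Y) w) = 0"
      by (simp only: scaleR_2 eq_neg_iff_add_eq_0)
    then show ?thesis by simp
  qed
  have D_br: "S (\<lambda>X Y. D (br (L X) Y)) = - S (\<lambda>X Y. act (br (L X) Y) w)"
    if "S (\<lambda>X Y. N (br (L X) Y)) = 0" for L
    using that by (simp add: N_def S_add add_eq_0_iff2)
  have neg: "S (\<lambda>X Y. D2 (neg_part X) Y) = - a"
  proof -
    have "S (\<lambda>X Y. D2 (neg_part X) Y) = S (\<lambda>X Y. D2 X (pos_part Y))"
      by (rule S_adj) (auto simp: D2_left D2_right B_neg_part)
    then show ?thesis by (simp add: D2_nonneg_right pos_nonneg S_neg a_def)
  qed
  have "S (\<lambda>X Y. act (component 0 X) (D Y)) = - z"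
  proof -
    have "S (\<lambda>X Y. act (component 0 X) (D Y)) = S (\<lambda>X Y. act (component 0 X) (D (component 0 Y)))"
      by (rule S_component_0) (auto intro!: linearI simp: simps)
    then show ?thesis
      by (simp add: D_nonneg component_0_in_nonneg linear_neg[OF act_right] S_neg z_def)
  qed
  then have zero: "S (\<lambda>X Y. D2 (component 0 X) Y) = z"
    by (simp add: D2_nonneg_left component_0_in_nonneg S_add S_diff S_neg D_br[OF bracket_0] antisym_0)
  have pos: "S (\<lambda>X Y. D2 (pos_part X) Y) = - a - b"
    by (simp add: D2_nonneg_left pos_nonneg S_add S_diff S_neg D_br[OF bracket_pos] a_swap b_def)
  have "S (\<lambda>X Y. act (neg_part X) (act Y w)) = S (\<lambda>X Y. act X (act (pos_part Y) w))"
    by (rule S_adj) (auto intro!: linearI simp: simps B_neg_part)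
  also have "\<dots> = S (\<lambda>X Y. act Y (act (pos_part X) w))"
    by (rule S_swap) (auto intro!: linearI simp: simps)
  also have "\<dots> = S (\<lambda>X Y. act (pos_part X) (act Y w) - act (br (pos_part X) Y) w)"
    by (simp add: act_hom)
  finally have "S (\<lambda>X Y. act (neg_part X) (act Y w)) = a' - b"
    by (simp add: S_diff a'_swap b_def)
  moreover have "S (\<lambda>X Y. act (component 0 X) (act Y w)) = z"
    unfolding z_def by (rule S_component_0) (auto intro!: linearI simp: simps)
  moreover have "S (\<lambda>X Y. act X (act Y w)) = S (\<lambda>X Y. act (neg_part X) (act Y w)) +
      S (\<lambda>X Y. act (component 0 X) (act Y w)) + S (\<lambda>X Y. act (pos_part X) (act Y w))"
    by (rule dec) (rule act_left)
  ultimately have casimir: "S (\<lambda>X Y. act X (act Y w)) = a' - b + z + a'"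
    by (simp add: a'_swap)
  have "S (\<lambda>X Y. act Y (N X)) = S (\<lambda>X Y. act Y (N (neg_part X)))"
    by (simp add: N_neg)
  also have "\<dots> = S (\<lambda>X Y. act (pos_part Y) (N X))"
    by (rule S_adj[of "\<lambda>X Y. act Y (N X)"]) (auto intro!: linearI simp: simps B_neg_part)
  also have "\<dots> = a + a'"
    by (simp add: N_def linear_add[OF act_right] S_add a_def a'_def)
  finally have connection: "S (\<lambda>X Y. act Y (N X)) = a + a'" .
  have "S D2 = - a + z + (- a - b)"
    by (subst dec[OF D2_left]) (simp add: neg zero pos)
  then have "S D2 = S (\<lambda>X Y. act X (act Y w)) - 2 *\<^sub>R S (\<lambda>X Y. act Y (N X))"
    by (simp add: casimir connection scaleR_2)
  then show ?thesis by (simp add: S_def N_def)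
qed

end

section \<open>Derivatives in charts\<close>

definition chart_inv :: "'a set \<times> ('a \<Rightarrow> 'e) \<Rightarrow> 'e \<Rightarrow> 'a" where
  "chart_inv c = inv_into (fst c) (snd c)"

definition good_chart :: "'a set \<times> ('a \<Rightarrow> 'e::real_normed_vector) \<Rightarrow> bool" where
  "good_chart c \<longleftrightarrow> inj_on (snd c) (fst c) \<and> open (snd c ` fst c)"

text \<open>The derivative of the coordinate expression of \<open>f\<close> in the charts \<open>c\<close> and \<open>d\<close>. The charts are
  explicit because the chart chosen at a point is rarely the one in which a composition can be
  differentiated. The eventuality is the part of continuity needed for the chain rule.\<close>

definition has_chart_derivative ::
  "('a \<Rightarrow> 'b) \<Rightarrow> ('e \<Rightarrow> 'f) \<Rightarrow> 'a set \<times> ('a \<Rightarrow> 'e::real_normed_vector) \<Rightarrow>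
   'b set \<times> ('b \<Rightarrow> 'f::real_normed_vector) \<Rightarrow> 'a \<Rightarrow> bool" where
  "has_chart_derivative f D c d x \<longleftrightarrow> x \<in> fst c \<and> f x \<in> fst d \<and>
     (\<forall>\<^sub>F y in at (snd c x). f (chart_inv c y) \<in> fst d) \<and>
     ((\<lambda>y. snd d (f (chart_inv c y))) has_derivative D) (at (snd c x))"

lemma chart_inv_chart: "good_chart c \<Longrightarrow> x \<in> fst c \<Longrightarrow> chart_inv c (snd c x) = x"
  by (simp add: good_chart_def chart_inv_def)

lemma chart_chart_inv: "y \<in> snd c ` fst c \<Longrightarrow> snd c (chart_inv c y) = y"
  by (simp add: chart_inv_def f_inv_into_f)

lemma chart_inv_in: "y \<in> snd c ` fst c \<Longrightarrow> chart_inv c y \<in> fst c"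
  by (simp add: chart_inv_def inv_into_into)

lemma eventually_chart:
  assumes "good_chart c" "x \<in> fst c"
  shows "\<forall>\<^sub>F y in at (snd c x). y \<in> snd c ` fst c"
  using assms by (intro eventually_at_in_open') (auto simp: good_chart_def)

lemma has_chart_derivative_chain:
  assumes c: "good_chart c" and d: "good_chart d"
    and f: "has_chart_derivative f D c d x" and g: "has_chart_derivative g D' d e (f x)"
  shows "has_chart_derivative (\<lambda>x. g (f x)) (\<lambda>v. D' (D v)) c e x"
proof -
  define h where "h y = snd d (f (chart_inv c y))" for y
  have x: "x \<in> fst c" "f x \<in> fst d" "g (f x) \<in> fst e"
    using f g by (auto simp: has_chart_derivative_def)
  have hx: "h (snd c x) = snd d (f x)" using x c by (simp add: h_def chart_inv_chart)
  have dh: "(h has_derivative D) (at (snd c x))"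
    using f by (simp add: has_chart_derivative_def h_def[abs_def])
  have lim: "filterlim h (nhds (snd d (f x))) (at (snd c x))"
    using has_derivative_continuous[OF dh] hx by (simp add: continuous_at tendsto_def[symmetric] isCont_def)
  have "\<forall>\<^sub>F z in nhds (snd d (f x)). g (chart_inv d z) \<in> fst e"
    using g x(2,3) by (simp add: has_chart_derivative_def eventually_nhds_conv_at chart_inv_chart d)
  then have ev_g: "\<forall>\<^sub>F y in at (snd c x). g (chart_inv d (h y)) \<in> fst e"
    using lim by (rule eventually_compose_filterlim)
  have ev_f: "\<forall>\<^sub>F y in at (snd c x). f (chart_inv c y) \<in> fst d"
    using f by (simp add: has_chart_derivative_def)
  have ev: "\<forall>\<^sub>F y in at (snd c x). g (f (chart_inv c y)) \<in> fst e"
    using ev_g ev_f by eventually_elim (simp add: h_def chart_inv_chart d)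
  have "((\<lambda>y. snd e (g (chart_inv d (h y)))) has_derivative (\<lambda>v. D' (D v))) (at (snd c x))"
    by (rule has_derivative_compose[OF dh]) (use g in \<open>simp add: has_chart_derivative_def hx\<close>)
  then have "((\<lambda>y. snd e (g (f (chart_inv c y)))) has_derivative (\<lambda>v. D' (D v))) (at (snd c x))"
  proof (rule has_derivative_transform_eventually)
    show "\<forall>\<^sub>F y in at (snd c x). snd e (g (chart_inv d (h y))) = snd e (g (f (chart_inv c y)))"
      using ev_f by eventually_elim (simp add: h_def chart_inv_chart d)
  qed (use x c d in \<open>simp_all add: hx chart_inv_chart\<close>)
  then show ?thesis
    using ev x by (simp add: has_chart_derivative_def)
qed

lemma has_chart_derivative_unique:
  "has_chart_derivative f D c d x \<Longrightarrow> has_chart_derivative f D' c d x \<Longrightarrow> D = D'"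
  unfolding has_chart_derivative_def by (blast intro: has_derivative_unique)

lemma has_chart_derivative_cong:
  assumes c: "good_chart c" and eq: "\<And>y. y \<in> fst c \<Longrightarrow> f y = g y"
    and f: "has_chart_derivative f D c d x"
  shows "has_chart_derivative g D c d x"
proof -
  have x: "x \<in> fst c" using f by (simp add: has_chart_derivative_def)
  have ev: "\<forall>\<^sub>F y in at (snd c x). f (chart_inv c y) = g (chart_inv c y)"
    using eventually_chart[OF c x] by eventually_elim (simp add: eq chart_inv_in)
  have "\<forall>\<^sub>F y in at (snd c x). f (chart_inv c y) \<in> fst d"
    using f by (simp add: has_chart_derivative_def)
  then have "\<forall>\<^sub>F y in at (snd c x). g (chart_inv c y) \<in> fst d"
    using ev by eventually_elim simp
  moreover have "((\<lambda>y. snd d (g (chart_inv c y))) has_derivative D) (at (snd c x))"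
  proof (rule has_derivative_transform_eventually)
    show "((\<lambda>y. snd d (f (chart_inv c y))) has_derivative D) (at (snd c x))"
      using f by (simp add: has_chart_derivative_def)
    show "\<forall>\<^sub>F y in at (snd c x). snd d (f (chart_inv c y)) = snd d (g (chart_inv c y))"
      using ev by eventually_elim simp
  qed (use x c eq in \<open>simp_all add: chart_inv_chart\<close>)
  ultimately show ?thesis
    using f eq[OF x] by (simp add: has_chart_derivative_def)
qed

lemma has_chart_derivative_linear: "has_chart_derivative f D c d x \<Longrightarrow> linear D"
  unfolding has_chart_derivative_def using has_derivative_linear by blast

lemma has_chart_derivative_id:
  assumes c: "good_chart c" "x \<in> fst c"
  shows "has_chart_derivative (\<lambda>x. x) (\<lambda>v. v) c c x"
proof -
  have "((\<lambda>y. snd c (chart_inv c y)) has_derivative (\<lambda>v. v)) (at (snd c x))"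
    by (rule has_derivative_transform_eventually[OF has_derivative_ident])
       (use eventually_chart[OF c] in \<open>auto elim: eventually_mono simp: chart_chart_inv c\<close>)
  moreover have "\<forall>\<^sub>F y in at (snd c x). chart_inv c y \<in> fst c"
    using eventually_chart[OF c] by eventually_elim (rule chart_inv_in)
  ultimately show ?thesis using c by (simp add: has_chart_derivative_def)
qed

lemma has_chart_derivative_const:
  assumes "x \<in> fst c" "y \<in> fst d"
  shows "has_chart_derivative (\<lambda>_. y) (\<lambda>_. 0) c d x"
  using assms by (simp add: has_chart_derivative_def)

abbreviation id_chart :: "'e set \<times> ('e \<Rightarrow> 'e)" where "id_chart \<equiv> (UNIV, id)"

lemma chart_inv_id_chart [simp]: "chart_inv id_chart y = y"
  by (simp add: chart_inv_def)

lemma good_id_chart: "good_chart id_chart"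
  by (simp add: good_chart_def)

lemma has_chart_derivative_id_chart:
  "has_chart_derivative f D c id_chart x \<longleftrightarrow>
    x \<in> fst c \<and> ((\<lambda>y. f (chart_inv c y)) has_derivative D) (at (snd c x))"
  by (simp add: has_chart_derivative_def)

lemma chart_at_euclid [simp]: "chart_at euclid x = id_chart"
  unfolding chart_at_def euclid_def by (rule some_equality) auto

lemma chart_at:
  assumes "x \<in> points A"
  shows "chart_at A x \<in> A" "x \<in> fst (chart_at A x)"
proof -
  have "\<exists>c. c \<in> A \<and> x \<in> fst c" using assms by (auto simp: points_def)
  then show "chart_at A x \<in> A" "x \<in> fst (chart_at A x)"
    unfolding chart_at_def by (metis (mono_tags, lifting) someI_ex)+
qed

lemma differential_eqI:
  "has_chart_derivative f D (chart_at A x) (chart_at B (f x)) x \<Longrightarrow> differential A B f x = D"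
  unfolding differential_def has_chart_derivative_def chart_inv_def o_def
  by (elim conjE) (rule frechet_derivative_at[symmetric])

text \<open>The topological part of being a manifold. Unlike smoothness it passes to products and open
  subsets without any calculus, and together with the smoothness of a map it suffices for the map
  to have derivatives in charts.\<close>

definition charted :: "('a::topological_space, 'e::real_normed_vector) atlas \<Rightarrow> bool" where
  "charted A \<longleftrightarrow> (\<forall>c\<in>A. openin (top_of_set (points A)) (fst c) \<and> open (snd c ` fst c) \<and>
     (\<exists>\<psi>. homeomorphism (fst c) (snd c ` fst c) (snd c) \<psi>))"

lemma smooth_manifold_charted: "smooth_manifold A \<Longrightarrow> charted A"
  by (force simp: smooth_manifold_def charted_def)

lemma charted_good: "charted A \<Longrightarrow> c \<in> A \<Longrightarrow> good_chart c"
  unfolding charted_def good_chart_def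
  by (metis (no_types, lifting) homeomorphism_def inj_on_inverseI)

lemma charted_subset: "charted A \<Longrightarrow> c \<in> A \<Longrightarrow> fst c \<subseteq> points A"
  by (auto simp: points_def)

lemma points_euclid [simp]: "points euclid = UNIV"
  by (simp add: points_def euclid_def)

lemma charted_euclid: "charted euclid"
proof -
  have "homeomorphism UNIV UNIV (id :: 'a \<Rightarrow> 'a) id"
    by (auto simp: homeomorphism_def)
  then show ?thesis
    unfolding charted_def points_euclid by (auto simp: euclid_def)
qed

lemma charted_open_image:
  assumes A: "charted A" and c: "c \<in> A" and S: "openin (top_of_set (points A)) S" "S \<subseteq> fst c"
  shows "open (snd c ` S)"
proof -
  obtain \<psi> where \<psi>: "homeomorphism (fst c) (snd c ` fst c) (snd c) \<psi>" and o: "open (snd c ` fst c)"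
    using A c unfolding charted_def by blast
  have "openin (top_of_set (fst c)) S"
    by (rule openin_subset_trans[OF S]) (use c in \<open>auto simp: points_def\<close>)
  then show ?thesis
    using homeomorphism_imp_open_map[OF \<psi>] o openin_open_trans by blast
qed

lemma open_chart_preimage:
  assumes A: "charted A" and B: "charted B" and f: "smooth_map A B f" and c: "c \<in> A" and d: "d \<in> B"
  shows "open (snd c ` (fst c \<inter> f -` fst d))"
proof (rule charted_open_image[OF A c])
  have "openin (top_of_set (points A)) (points A \<inter> f -` fst d)"
    using f B d by (intro continuous_openin_preimage[of _ _ "points B"]) (auto simp: smooth_map_def charted_def)
  moreover have "openin (top_of_set (points A)) (fst c)" using A c by (simp add: charted_def)
  ultimately have "openin (top_of_set (points A)) (fst c \<inter> (points A \<inter> f -` fst d))" by blast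
  moreover have "fst c \<inter> (points A \<inter> f -` fst d) = fst c \<inter> f -` fst d"
    using c by (auto simp: points_def)
  ultimately show "openin (top_of_set (points A)) (fst c \<inter> f -` fst d)" by simp
qed auto

lemma smooth_on_differentiable: "smooth_on S f \<Longrightarrow> x \<in> S \<Longrightarrow> f differentiable (at x)"
  unfolding smooth_on_def by (drule spec[of _ "Suc 0"]) simp

lemma smooth_on_frechet_derivative:
  "smooth_on S f \<Longrightarrow> smooth_on S (\<lambda>x. frechet_derivative f (at x) v)"
  unfolding smooth_on_def
proof
  fix k assume "\<forall>k. Ck_on k S f"
  then have "Ck_on (Suc k) S f" ..
  then show "Ck_on k S (\<lambda>x. frechet_derivative f (at x) v)" by simp
qed

lemma smooth_map_has_chart_derivative:
  assumes A: "charted A" and B: "charted B" and f: "smooth_map A B f" and c: "c \<in> A" and d: "d \<in> B"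
    and x: "x \<in> fst c" "f x \<in> fst d"
  shows "has_chart_derivative f (frechet_derivative (\<lambda>y. snd d (f (chart_inv c y))) (at (snd c x))) c d x"
proof -
  have "smooth_on (snd c ` (fst c \<inter> f -` fst d)) (\<lambda>y. snd d (f (chart_inv c y)))"
    using f c d unfolding smooth_map_def chart_inv_def o_def case_prod_beta by blast
  then have "(\<lambda>y. snd d (f (chart_inv c y))) differentiable (at (snd c x))"
    by (rule smooth_on_differentiable) (use x in auto)
  moreover have "\<forall>\<^sub>F y in at (snd c x). y \<in> snd c ` (fst c \<inter> f -` fst d)"
    by (rule eventually_at_in_open'[OF open_chart_preimage[OF A B f c d]]) (use x in auto)
  then have "\<forall>\<^sub>F y in at (snd c x). f (chart_inv c y) \<in> fst d"
    by eventually_elim (auto simp: chart_inv_chart charted_good[OF A c])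
  ultimately show ?thesis
    using x by (simp add: has_chart_derivative_def frechet_derivative_works)
qed

lemma smooth_map_differential:
  assumes A: "charted A" and B: "charted B" and f: "smooth_map A B f" and x: "x \<in> points A"
  shows "has_chart_derivative f (differential A B f x) (chart_at A x) (chart_at B (f x)) x"
proof -
  have "f x \<in> points B" using f x by (meson image_subset_iff smooth_map_def)
  from smooth_map_has_chart_derivative[OF A B f chart_at(1)[OF x] chart_at(1)[OF this]
      chart_at(2)[OF x] chart_at(2)[OF this]]
  show ?thesis using differential_eqI by metis
qed

lemma smooth_map_ident: "smooth_manifold A \<Longrightarrow> smooth_map A A (\<lambda>x. x)"
  unfolding smooth_manifold_def smooth_map_def o_def by (simp add: vimage_def)

definition prod_chart ::
  "'a set \<times> ('a \<Rightarrow> 'e) \<Rightarrow> 'b set \<times> ('b \<Rightarrow> 'f) \<Rightarrow> ('a \<times> 'b) set \<times> ('a \<times> 'b \<Rightarrow> 'e \<times> 'f)" where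
  "prod_chart c d = (fst c \<times> fst d, map_prod (snd c) (snd d))"

lemma fst_prod_chart [simp]: "fst (prod_chart c d) = fst c \<times> fst d"
  and snd_prod_chart [simp]: "snd (prod_chart c d) (x, y) = (snd c x, snd d y)"
  and image_prod_chart: "snd (prod_chart c d) ` (fst c \<times> fst d) = (snd c ` fst c) \<times> (snd d ` fst d)"
  by (auto simp: prod_chart_def)

lemma prod_atlas_eq: "prod_atlas A B = {prod_chart c d | c d. c \<in> A \<and> d \<in> B}"
  by (force simp: prod_atlas_def prod_chart_def)

lemma points_prod_atlas: "points (prod_atlas A B) = points A \<times> points B"
  by (force simp: prod_atlas_eq points_def)

lemma charted_prod:
  assumes A: "charted A" and B: "charted B"
  shows "charted (prod_atlas A B)"
  unfolding charted_def
proof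
  fix e assume "e \<in> prod_atlas A B"
  then obtain c d where e: "e = prod_chart c d" and c: "c \<in> A" and d: "d \<in> B"
    by (auto simp: prod_atlas_eq)
  obtain \<phi> \<psi> where \<phi>: "homeomorphism (fst c) (snd c ` fst c) (snd c) \<phi>"
    and \<psi>: "homeomorphism (fst d) (snd d ` fst d) (snd d) \<psi>"
    using A B c d unfolding charted_def by blast
  have "openin (top_of_set (points (prod_atlas A B))) (fst e)"
    unfolding e points_prod_atlas fst_prod_chart
    by (rule openin_Times) (use A B c d in \<open>auto simp: charted_def\<close>)
  moreover have "open (snd e ` fst e)"
    unfolding e fst_prod_chart image_prod_chart
    by (rule open_Times) (use A B c d in \<open>auto simp: charted_def\<close>)
  moreover have "homeomorphism (fst e) (snd e ` fst e) (snd e) (map_prod \<phi> \<psi>)"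
    unfolding e fst_prod_chart image_prod_chart
    using homeomorphism_apply1[OF \<phi>] homeomorphism_apply2[OF \<phi>] homeomorphism_cont1[OF \<phi>]
      homeomorphism_cont2[OF \<phi>] homeomorphism_image2[OF \<phi>] homeomorphism_apply1[OF \<psi>]
      homeomorphism_apply2[OF \<psi>] homeomorphism_cont1[OF \<psi>] homeomorphism_cont2[OF \<psi>]
      homeomorphism_image2[OF \<psi>]
    by (intro homeomorphismI)
       (auto simp: prod_chart_def map_prod_def case_prod_beta
         intro!: continuous_on_Pair continuous_on_compose2[of _ _ _ fst, OF _ continuous_on_fst]
          continuous_on_compose2[of _ _ _ snd, OF _ continuous_on_snd] continuous_on_id)
  ultimately show "openin (top_of_set (points (prod_atlas A B))) (fst e) \<and> open (snd e ` fst e) \<and>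
      (\<exists>\<psi>. homeomorphism (fst e) (snd e ` fst e) (snd e) \<psi>)" by blast
qed

lemma good_prod_chart: "good_chart c \<Longrightarrow> good_chart d \<Longrightarrow> good_chart (prod_chart c d)"
  unfolding good_chart_def fst_prod_chart image_prod_chart
  by (auto simp: open_Times inj_on_def)

lemma has_chart_derivative_slice_right:
  assumes c: "good_chart c" "x \<in> fst c" and d: "good_chart d" "y \<in> fst d"
  shows "has_chart_derivative (\<lambda>y. (x, y)) (\<lambda>v. (0, v)) d (prod_chart c d) y"
proof -
  have ev: "\<forall>\<^sub>F z in at (snd d y). z \<in> snd d ` fst d" by (rule eventually_chart[OF d])
  have "((\<lambda>z. snd (prod_chart c d) (x, chart_inv d z)) has_derivative (\<lambda>v. (0, v))) (at (snd d y))"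
  proof (rule has_derivative_transform_eventually)
    show "((\<lambda>z. (snd c x, z)) has_derivative (\<lambda>v. (0, v))) (at (snd d y))"
      by (auto intro!: derivative_eq_intros)
    show "\<forall>\<^sub>F z in at (snd d y). (snd c x, z) = snd (prod_chart c d) (x, chart_inv d z)"
      using ev by eventually_elim (simp add: chart_chart_inv)
  qed (use d in \<open>simp_all add: chart_inv_chart\<close>)
  moreover have "\<forall>\<^sub>F z in at (snd d y). chart_inv d z \<in> fst d"
    using ev by eventually_elim (rule chart_inv_in)
  ultimately show ?thesis using c d by (simp add: has_chart_derivative_def)
qed

lemma has_chart_derivative_slice_left:
  assumes c: "good_chart c" "x \<in> fst c" and d: "good_chart d" "y \<in> fst d"
  shows "has_chart_derivative (\<lambda>x. (x, y)) (\<lambda>v. (v, 0)) c (prod_chart c d) x"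
proof -
  have ev: "\<forall>\<^sub>F z in at (snd c x). z \<in> snd c ` fst c" by (rule eventually_chart[OF c])
  have "((\<lambda>z. snd (prod_chart c d) (chart_inv c z, y)) has_derivative (\<lambda>v. (v, 0))) (at (snd c x))"
  proof (rule has_derivative_transform_eventually)
    show "((\<lambda>z. (z, snd d y)) has_derivative (\<lambda>v. (v, 0))) (at (snd c x))"
      by (auto intro!: derivative_eq_intros)
    show "\<forall>\<^sub>F z in at (snd c x). (z, snd d y) = snd (prod_chart c d) (chart_inv c z, y)"
      using ev by eventually_elim (simp add: chart_chart_inv)
  qed (use c in \<open>simp_all add: chart_inv_chart\<close>)
  moreover have "\<forall>\<^sub>F z in at (snd c x). chart_inv c z \<in> fst c"
    using ev by eventually_elim (rule chart_inv_in)
  ultimately show ?thesis using c d by (simp add: has_chart_derivative_def)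
qed

lemma smooth_map_partials:
  assumes A: "charted A" and B: "charted B" and C: "charted C" and F: "smooth_map (prod_atlas A B) C F"
    and c: "c \<in> A" "x \<in> fst c" and d: "d \<in> B" "y \<in> fst d" and e: "e \<in> C" "F (x, y) \<in> fst e"
  defines "D \<equiv> frechet_derivative (\<lambda>p. snd e (F (chart_inv (prod_chart c d) p))) (at (snd c x, snd d y))"
  shows "has_chart_derivative (\<lambda>y. F (x, y)) (\<lambda>v. D (0, v)) d e y"
    and "has_chart_derivative (\<lambda>x. F (x, y)) (\<lambda>v. D (v, 0)) c e x"
proof -
  have gc: "good_chart c" and gd: "good_chart d" using charted_good[OF A c(1)] charted_good[OF B d(1)] .
  have cd: "prod_chart c d \<in> prod_atlas A B" using c d unfolding prod_atlas_eq by blast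
  have "has_chart_derivative F D (prod_chart c d) e (x, y)"
    using smooth_map_has_chart_derivative[OF charted_prod[OF A B] C F cd e(1), of "(x, y)"] c d e
    by (simp add: D_def)
  note D = this
  show "has_chart_derivative (\<lambda>y. F (x, y)) (\<lambda>v. D (0, v)) d e y"
    by (rule has_chart_derivative_chain[OF gd good_prod_chart[OF gc gd]
        has_chart_derivative_slice_right[OF gc c(2) gd d(2)] D])
  show "has_chart_derivative (\<lambda>x. F (x, y)) (\<lambda>v. D (v, 0)) c e x"
    by (rule has_chart_derivative_chain[OF gc good_prod_chart[OF gc gd]
        has_chart_derivative_slice_left[OF gc c(2) gd d(2)] D])
qed

lemma points_restrict: "points (restrict_atlas A S) = points A \<inter> S"
  by (auto simp: points_def restrict_atlas_def split_beta)

lemma charted_restrict: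
  assumes A: "charted A" and S: "openin (top_of_set (points A)) (points A \<inter> S)"
  shows "charted (restrict_atlas A S)"
  unfolding charted_def
proof
  fix e assume "e \<in> restrict_atlas A S"
  then obtain c where e: "fst e = fst c \<inter> S" "snd e = snd c" and c: "c \<in> A"
    by (auto simp: restrict_atlas_def split_beta)
  obtain \<phi> where \<phi>: "homeomorphism (fst c) (snd c ` fst c) (snd c) \<phi>"
    and o: "openin (top_of_set (points A)) (fst c)"
    using A c unfolding charted_def by blast
  have "openin (top_of_set (points A)) (fst c \<inter> (points A \<inter> S))" using o S by blast
  moreover have "fst c \<inter> (points A \<inter> S) = fst e" using c by (auto simp: points_def e)
  ultimately have *: "openin (top_of_set (points A)) (fst e)" by simp
  then have "openin (top_of_set (points (restrict_atlas A S))) (fst e)"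
    by (rule openin_subset_trans) (use charted_subset[OF A c] in \<open>auto simp: points_restrict e\<close>)
  moreover have "open (snd e ` fst e)"
    using charted_open_image[OF A c *] by (simp add: e)
  moreover have "homeomorphism (fst e) (snd e ` fst e) (snd e) \<phi>"
    unfolding e by (rule homeomorphism_of_subsets[OF \<phi>]) auto
  ultimately show "openin (top_of_set (points (restrict_atlas A S))) (fst e) \<and> open (snd e ` fst e) \<and>
      (\<exists>\<psi>. homeomorphism (fst e) (snd e ` fst e) (snd e) \<psi>)" by blast
qed

lemma has_chart_derivative_linear_compose:
  fixes T :: "'b::euclidean_space \<Rightarrow> 'c::real_normed_vector"
  assumes f: "has_chart_derivative f D c id_chart x" and T: "linear T"
  shows "has_chart_derivative (\<lambda>x. T (f x)) (\<lambda>v. T (D v)) c id_chart x"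
  using f bounded_linear.has_derivative[OF linear_conv_bounded_linear[THEN iffD1, OF T]]
  by (auto simp: has_chart_derivative_id_chart)

section \<open>Lie groups and their actions\<close>

text \<open>The product rule for the evaluation \<open>R h (g h)\<close> of an operator depending on \<open>h\<close>. Expanding \<open>g h\<close> in
  the basis reduces it to products of scalar functions with the functions \<open>R h b\<close>.\<close>

lemma has_chart_derivative_apply:
  fixes R :: "'a \<Rightarrow> 'w::euclidean_space \<Rightarrow> 'v::real_normed_vector"
  assumes c: "good_chart c"
    and lin: "\<And>h. h \<in> fst c \<Longrightarrow> linear (R h)"
    and R: "\<And>w. has_chart_derivative (\<lambda>h. R h w) (\<lambda>X. dR X w) c id_chart x"
    and g: "has_chart_derivative g D c id_chart x"
  shows "has_chart_derivative (\<lambda>h. R h (g h)) (\<lambda>X. R x (D X) + dR X (g x)) c id_chart x"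
proof (rule has_chart_derivative_cong[OF c])
  have x: "x \<in> fst c" using g by (simp add: has_chart_derivative_def)
  have expand: "(\<Sum>b\<in>Basis. (w \<bullet> b) *\<^sub>R R h b) = R h w" if "h \<in> fst c" for h w
    using linear_sum[OF lin[OF that], of "\<lambda>b. (w \<bullet> b) *\<^sub>R b" Basis]
    by (simp add: linear_scale[OF lin[OF that]] euclidean_representation)
  have expand': "(\<Sum>b\<in>Basis. (w \<bullet> b) *\<^sub>R dR X b) = dR X w" for X w
  proof -
    have "has_chart_derivative (\<lambda>h. \<Sum>b\<in>Basis. (w \<bullet> b) *\<^sub>R R h b)
        (\<lambda>X. \<Sum>b\<in>Basis. (w \<bullet> b) *\<^sub>R dR X b) c id_chart x"
      using R by (auto simp: has_chart_derivative_id_chart intro!: derivative_eq_intros)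
    then have "has_chart_derivative (\<lambda>h. R h w) (\<lambda>X. \<Sum>b\<in>Basis. (w \<bullet> b) *\<^sub>R dR X b) c id_chart x"
      by (rule has_chart_derivative_cong[OF c, rotated]) (rule expand)
    then show ?thesis
      using has_chart_derivative_unique[OF _ R] by meson
  qed
  have "has_chart_derivative (\<lambda>h. \<Sum>b\<in>Basis. (g h \<bullet> b) *\<^sub>R R h b)
      (\<lambda>X. \<Sum>b\<in>Basis. (g x \<bullet> b) *\<^sub>R dR X b + (D X \<bullet> b) *\<^sub>R R x b) c id_chart x"
    unfolding has_chart_derivative_id_chart
  proof (intro conjI x has_derivative_sum)
    fix b
    have "((\<lambda>y. R (chart_inv c y) b) has_derivative (\<lambda>X. dR X b)) (at (snd c x))"
      and "((\<lambda>y. g (chart_inv c y)) has_derivative D) (at (snd c x))"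
      using R g by (simp_all add: has_chart_derivative_id_chart)
    from has_derivative_scaleR[OF has_derivative_inner_left[OF this(2), of b] this(1)]
    show "((\<lambda>y. (g (chart_inv c y) \<bullet> b) *\<^sub>R R (chart_inv c y) b) has_derivative
        (\<lambda>X. (g x \<bullet> b) *\<^sub>R dR X b + (D X \<bullet> b) *\<^sub>R R x b)) (at (snd c x))"
      by (simp add: chart_inv_chart[OF c x])
  qed
  then show "has_chart_derivative (\<lambda>h. \<Sum>b\<in>Basis. (g h \<bullet> b) *\<^sub>R R h b)
      (\<lambda>X. R x (D X) + dR X (g x)) c id_chart x"
    by (simp add: sum.distrib expand[OF x] expand' add.commute)
  show "\<And>h. h \<in> fst c \<Longrightarrow> (\<Sum>b\<in>Basis. (g h \<bullet> b) *\<^sub>R R h b) = R h (g h)"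
    by (rule expand)
qed

locale lie_group_atlas =
  fixes G :: "'g::{second_countable_topology,t2_space} monoid" (structure)
    and A :: "('g, 'e::euclidean_space) atlas"
  assumes lie_group: "lie_group G A"
begin

sublocale group G
  using lie_group by (simp add: lie_group_def)

lemma charted_A: "charted A"
  by (rule smooth_manifold_charted) (use lie_group in \<open>simp add: lie_group_def\<close>)

lemma points_A: "points A = carrier G"
  using lie_group by (simp add: lie_group_def)

lemma smooth_mult: "smooth_map (prod_atlas A A) A (\<lambda>(x, y). x \<otimes> y)"
  and smooth_inv: "smooth_map A A (\<lambda>x. inv x)"
  using lie_group by (simp_all add: lie_group_def)

abbreviation chart1 :: "'g set \<times> ('g \<Rightarrow> 'e)" where "chart1 \<equiv> chart_at A \<one>"

lemma chart1: "chart1 \<in> A" "\<one> \<in> fst chart1"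
  using chart_at[of \<one> A] by (simp_all add: points_A)

lemma good_chart1: "good_chart chart1"
  by (rule charted_good[OF charted_A chart1(1)])

lemma chart1_carrier: "h \<in> fst chart1 \<Longrightarrow> h \<in> carrier G"
  using charted_subset[OF charted_A chart1(1)] points_A by auto

lemma conj_has_chart_derivative:
  assumes h: "h \<in> carrier G"
  shows "has_chart_derivative (\<lambda>x. h \<otimes> x \<otimes> inv h) (Ad G A h) chart1 chart1 \<one>"
proof -
  let ?c = "chart_at A h"
  have c: "?c \<in> A" "h \<in> fst ?c" using chart_at[of h A] h by (simp_all add: points_A)
  note gc = charted_good[OF charted_A c(1)]
  have inv: "chart_at A (inv h) \<in> A" "inv h \<in> fst (chart_at A (inv h))"
    using chart_at[of "inv h" A] h by (simp_all add: points_A)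
  obtain D where D: "has_chart_derivative (\<lambda>x. h \<otimes> x) D chart1 ?c \<one>"
    using smooth_map_partials(1)[OF charted_A charted_A charted_A smooth_mult c chart1 c(1)] h c by auto
  obtain D' where D': "has_chart_derivative (\<lambda>x. x \<otimes> inv h) D' ?c chart1 h"
    using smooth_map_partials(2)[OF charted_A charted_A charted_A smooth_mult c inv chart1(1)] h chart1 by auto
  have "has_chart_derivative (\<lambda>x. h \<otimes> x \<otimes> inv h) (\<lambda>v. D' (D v)) chart1 chart1 \<one>"
    using has_chart_derivative_chain[OF good_chart1 gc D, of "\<lambda>x. x \<otimes> inv h"] D' h by simp
  moreover from this have "Ad G A h = (\<lambda>v. D' (D v))"
    unfolding Ad_def by (intro differential_eqI) (use h in simp)
  ultimately show ?thesis by simp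
qed

lemma linear_Ad: "h \<in> carrier G \<Longrightarrow> linear (Ad G A h)"
  by (rule has_chart_derivative_linear[OF conj_has_chart_derivative])

lemma Ad_one: "Ad G A \<one> Y = Y"
proof -
  have "has_chart_derivative (\<lambda>x. x) (Ad G A \<one>) chart1 chart1 \<one>"
    by (rule has_chart_derivative_cong[OF good_chart1 _ conj_has_chart_derivative])
       (auto dest: chart1_carrier)
  from has_chart_derivative_unique[OF this has_chart_derivative_id[OF good_chart1 chart1(2)]]
  show ?thesis by simp
qed

lemma Ad_mult:
  assumes h: "h \<in> carrier G" and k: "k \<in> carrier G"
  shows "Ad G A (h \<otimes> k) Y = Ad G A h (Ad G A k Y)"
proof -
  have "has_chart_derivative (\<lambda>x. h \<otimes> (k \<otimes> x \<otimes> inv k) \<otimes> inv h) (\<lambda>v. Ad G A h (Ad G A k v))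
      chart1 chart1 \<one>"
    using has_chart_derivative_chain[OF good_chart1 good_chart1 conj_has_chart_derivative[OF k],
        of "\<lambda>x. h \<otimes> x \<otimes> inv h"] conj_has_chart_derivative[OF h] k by simp
  then have "has_chart_derivative (\<lambda>x. (h \<otimes> k) \<otimes> x \<otimes> inv (h \<otimes> k)) (\<lambda>v. Ad G A h (Ad G A k v))
      chart1 chart1 \<one>"
    by (rule has_chart_derivative_cong[OF good_chart1, rotated])
       (use h k in \<open>simp add: chart1_carrier m_assoc inv_mult_group\<close>)
  from has_chart_derivative_unique[OF this conj_has_chart_derivative] h k
  show ?thesis by (metis m_closed)
qed

text \<open>That \<open>Ad h Y\<close> is differentiable in \<open>h\<close> is the one place where second derivatives of the
  multiplication enter. Conjugation by \<open>h\<close> is the left translation by \<open>h\<close> followed by the right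
  translation by the inverse. In the chart at the unit, with \<open>\<mu>\<close> the multiplication, \<open>\<iota>\<close> the inversion,
  \<open>e\<close> the unit and \<open>a\<close> the coordinates of \<open>h\<close>, this expresses \<open>Ad h Y\<close> as

    \<open>d\<mu>(a, \<iota> a) (d\<mu>(a, e) (0, Y), 0)\<close>,

  and expanding the inner vector in the basis makes it a combination of differentiable functions
  of \<open>a\<close>.\<close>

lemma Ad_has_chart_derivative:
  "has_chart_derivative (\<lambda>h. Ad G A h Y) (\<lambda>X. lie_bracket G A X Y) chart1 id_chart \<one>"
proof -
  define e where "e = snd chart1 \<one>"
  define E where "E = prod_chart chart1 chart1"
  define \<mu> where "\<mu> p = snd chart1 (case chart_inv E p of (x, y) \<Rightarrow> x \<otimes> y)" for p
  define d\<mu> where "d\<mu> p = frechet_derivative \<mu> (at p)" for p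
  \<comment> \<open>the domain of the coordinate expression \<open>\<mu>\<close> of the multiplication\<close>
  define W where "W = snd E ` (fst E \<inter> (\<lambda>(x, y). x \<otimes> y) -` fst chart1)"
  define \<iota> where "\<iota> a = snd chart1 (inv (chart_inv chart1 a))" for a
  have E: "E \<in> prod_atlas A A" unfolding E_def prod_atlas_eq using chart1 by blast
  have smooth: "smooth_on W \<mu>"
    using smooth_mult E chart1(1)
    unfolding smooth_map_def W_def \<mu>_def[abs_def] chart_inv_def o_def case_prod_beta by blast
  have in_W: "(snd chart1 h, snd chart1 k) \<in> W"
    if "h \<in> fst chart1" "k \<in> fst chart1" "h \<otimes> k \<in> fst chart1" for h k
    unfolding W_def E_def by (rule image_eqI[of _ _ "(h, k)"]) (use that in simp_all)
  have diff: "(\<lambda>p. d\<mu> p v) differentiable (at p)" if "p \<in> W" for p v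
    unfolding d\<mu>_def
    by (rule smooth_on_differentiable[OF smooth_on_frechet_derivative[OF smooth] that])
  have lin: "linear (d\<mu> p)" if "p \<in> W" for p
    unfolding d\<mu>_def by (rule linear_frechet_derivative[OF smooth_on_differentiable[OF smooth that]])
  have Ad_eq: "Ad G A h Y = d\<mu> (snd chart1 h, snd chart1 (inv h)) (d\<mu> (snd chart1 h, e) (0, Y), 0)"
    if h: "h \<in> fst chart1" "inv h \<in> fst chart1" for h
  proof -
    have hG: "h \<in> carrier G" using h chart1_carrier by auto
    have "has_chart_derivative (\<lambda>x. h \<otimes> x) (\<lambda>v. d\<mu> (snd chart1 h, e) (0, v)) chart1 chart1 \<one>"
      using smooth_map_partials(1)[OF charted_A charted_A charted_A smooth_mult chart1(1) h(1) chart1 chart1(1)] h hG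
      by (simp add: d\<mu>_def e_def \<mu>_def[abs_def] E_def)
    moreover have "has_chart_derivative (\<lambda>x. x \<otimes> inv h)
        (\<lambda>v. d\<mu> (snd chart1 h, snd chart1 (inv h)) (v, 0)) chart1 chart1 (h \<otimes> \<one>)"
      using smooth_map_partials(2)[OF charted_A charted_A charted_A smooth_mult chart1(1) h(1)
          chart1(1) h(2) chart1(1)] hG chart1
      by (simp add: d\<mu>_def e_def \<mu>_def[abs_def] E_def)
    ultimately have "has_chart_derivative (\<lambda>x. h \<otimes> x \<otimes> inv h)
        (\<lambda>v. d\<mu> (snd chart1 h, snd chart1 (inv h)) (d\<mu> (snd chart1 h, e) (0, v), 0)) chart1 chart1 \<one>"
      by (rule has_chart_derivative_chain[OF good_chart1 good_chart1])
    from has_chart_derivative_unique[OF conj_has_chart_derivative[OF hG] this] show ?thesis by simp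
  qed
  obtain J where "has_chart_derivative (\<lambda>x. inv x) J chart1 chart1 \<one>"
    using smooth_map_has_chart_derivative[OF charted_A charted_A smooth_inv chart1(1) chart1(1) chart1(2)] chart1
    by auto
  then have inv_ev: "\<forall>\<^sub>F a in at e. inv (chart_inv chart1 a) \<in> fst chart1"
    and \<iota>: "(\<iota> has_derivative J) (at e)"
    by (simp_all add: has_chart_derivative_def \<iota>_def[abs_def] e_def)
  have chart_ev: "\<forall>\<^sub>F a in at e. a \<in> snd chart1 ` fst chart1"
    unfolding e_def by (rule eventually_chart[OF good_chart1 chart1(2)])
  have \<iota>e: "\<iota> e = e" by (simp add: \<iota>_def e_def chart_inv_chart[OF good_chart1 chart1(2)])
  have eW: "(e, e) \<in> W" unfolding e_def by (rule in_W) (simp_all add: chart1)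
  have d1: "(\<lambda>a. d\<mu> (a, \<iota> a) v) differentiable (at e)" for v
  proof -
    have "(\<lambda>p. d\<mu> p v) \<circ> (\<lambda>a. (a, \<iota> a)) differentiable (at e)"
    proof (rule differentiable_chain_at)
      show "(\<lambda>a. (a, \<iota> a)) differentiable (at e)"
        using \<iota> unfolding differentiable_def by (auto intro!: exI has_derivative_Pair derivative_intros)
      show "(\<lambda>p. d\<mu> p v) differentiable (at (e, \<iota> e))" by (simp add: \<iota>e diff eW)
    qed
    then show ?thesis by (simp add: o_def)
  qed
  have d2: "(\<lambda>a. d\<mu> (a, e) (0, Y)) differentiable (at e)"
  proof -
    have "(\<lambda>p. d\<mu> p (0, Y)) \<circ> (\<lambda>a. (a, e)) differentiable (at e)"
    proof (rule differentiable_chain_at)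
      show "(\<lambda>a. (a, e)) differentiable (at e)"
        unfolding differentiable_def by (auto intro!: exI has_derivative_Pair derivative_intros)
      show "(\<lambda>p. d\<mu> p (0, Y)) differentiable (at (e, e))" by (rule diff[OF eW])
    qed
    then show ?thesis by (simp add: o_def)
  qed
  have "(\<lambda>a. \<Sum>b\<in>Basis. (d\<mu> (a, e) (0, Y) \<bullet> b) *\<^sub>R d\<mu> (a, \<iota> a) (b, 0)) differentiable (at e)"
    by (intro differentiable_sum ballI finite_Basis differentiable_scaleR differentiable_inner d1 d2
        differentiable_const)
  then obtain D where D:
    "((\<lambda>a. \<Sum>b\<in>Basis. (d\<mu> (a, e) (0, Y) \<bullet> b) *\<^sub>R d\<mu> (a, \<iota> a) (b, 0)) has_derivative D) (at e)"
    unfolding differentiable_def by blast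
  have expand: "(\<Sum>b\<in>Basis. (d\<mu> (a, e) (0, Y) \<bullet> b) *\<^sub>R d\<mu> (a, \<iota> a) (b, 0)) = Ad G A (chart_inv chart1 a) Y"
    if a: "a \<in> snd chart1 ` fst chart1" "inv (chart_inv chart1 a) \<in> fst chart1" for a
  proof -
    note h = chart_inv_in[OF a(1)]
    have hG: "chart_inv chart1 a \<in> carrier G" using h chart1_carrier by auto
    have "(a, \<iota> a) \<in> W"
      using in_W[OF h a(2)] hG chart1 chart_chart_inv[OF a(1)] by (simp add: \<iota>_def)
    note l = lin[OF this]
    have "d\<mu> (a, \<iota> a) (\<Sum>b\<in>Basis. (Z \<bullet> b) *\<^sub>R (b, 0)) = (\<Sum>b\<in>Basis. (Z \<bullet> b) *\<^sub>R d\<mu> (a, \<iota> a) (b, 0))" for Z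
      by (simp add: linear_sum[OF l] linear_scale[OF l, symmetric])
    moreover have "(\<Sum>b\<in>Basis. (Z \<bullet> b) *\<^sub>R (b, 0::'e)) = (Z, 0)" for Z :: 'e
      by (simp add: prod_eq_iff fst_sum snd_sum euclidean_representation)
    ultimately have "(\<Sum>b\<in>Basis. (Z \<bullet> b) *\<^sub>R d\<mu> (a, \<iota> a) (b, 0)) = d\<mu> (a, \<iota> a) (Z, 0)" for Z
      by metis
    then show ?thesis
      using Ad_eq[OF h a(2), unfolded chart_chart_inv[OF a(1)]] by (simp only: \<iota>_def)
  qed
  have "((\<lambda>a. Ad G A (chart_inv chart1 a) Y) has_derivative D) (at e)"
  proof (rule has_derivative_transform_eventually[OF D])
    show "\<forall>\<^sub>F a in at e. (\<Sum>b\<in>Basis. (d\<mu> (a, e) (0, Y) \<bullet> b) *\<^sub>R d\<mu> (a, \<iota> a) (b, 0)) = Ad G A (chart_inv chart1 a) Y"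
      using chart_ev inv_ev by eventually_elim (rule expand)
    show "(\<Sum>b\<in>Basis. (d\<mu> (e, e) (0, Y) \<bullet> b) *\<^sub>R d\<mu> (e, \<iota> e) (b, 0)) = Ad G A (chart_inv chart1 e) Y"
      by (rule expand) (use chart1 in \<open>simp_all add: e_def chart_inv_chart[OF good_chart1 chart1(2)]\<close>)
  qed simp
  then have "has_chart_derivative (\<lambda>h. Ad G A h Y) D chart1 id_chart \<one>"
    by (simp add: has_chart_derivative_id_chart chart1 e_def)
  moreover from this have "lie_bracket G A X Y = D X" for X
    unfolding lie_bracket_def using differential_eqI[of "\<lambda>h. Ad G A h Y" D A \<one> euclid] by simp
  ultimately show ?thesis by simp
qed

end

text \<open>A linear action that is differentiable at the unit. The adjoint action is one as well, so its
  infinitesimal version and that of a representation are treated together.\<close>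

locale lie_group_action = lie_group_atlas G A
  for G :: "'g::{second_countable_topology,t2_space} monoid" (structure)
    and A :: "('g, 'e::euclidean_space) atlas" +
  fixes R :: "'g \<Rightarrow> 'w::euclidean_space \<Rightarrow> 'w" and dR :: "'e \<Rightarrow> 'w \<Rightarrow> 'w"
  assumes linear_R: "h \<in> carrier G \<Longrightarrow> linear (R h)"
    and R_one: "R \<one> w = w"
    and R_mult: "h \<in> carrier G \<Longrightarrow> k \<in> carrier G \<Longrightarrow> R (h \<otimes> k) w = R h (R k w)"
    and dR: "has_chart_derivative (\<lambda>h. R h w) (\<lambda>X. dR X w) chart1 id_chart \<one>"
begin

lemma linear_dR_left: "linear (\<lambda>X. dR X w)"
  using has_chart_derivative_linear[OF dR] .

lemma linear_dR_right: "linear (dR X)"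
proof (rule linearI)
  fix v w c
  have "has_chart_derivative (\<lambda>h. R h v + R h w) (\<lambda>X. dR X v + dR X w) chart1 id_chart \<one>"
    using dR unfolding has_chart_derivative_id_chart by (auto intro!: has_derivative_add)
  then have "has_chart_derivative (\<lambda>h. R h (v + w)) (\<lambda>X. dR X v + dR X w) chart1 id_chart \<one>"
    by (rule has_chart_derivative_cong[OF good_chart1, rotated])
       (simp add: linear_add[OF linear_R] chart1_carrier)
  from has_chart_derivative_unique[OF dR this] show "dR X (v + w) = dR X v + dR X w" by meson
  have "has_chart_derivative (\<lambda>h. c *\<^sub>R R h v) (\<lambda>X. c *\<^sub>R dR X v) chart1 id_chart \<one>"
    using dR unfolding has_chart_derivative_id_chart by (auto intro!: has_derivative_scaleR_right)
  then have "has_chart_derivative (\<lambda>h. R h (c *\<^sub>R v)) (\<lambda>X. c *\<^sub>R dR X v) chart1 id_chart \<one>"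
    by (rule has_chart_derivative_cong[OF good_chart1, rotated])
       (simp add: linear_scale[OF linear_R] chart1_carrier)
  from has_chart_derivative_unique[OF dR this] show "dR X (c *\<^sub>R v) = c *\<^sub>R dR X v" by meson
qed

lemma R_has_chart_derivative:
  assumes "has_chart_derivative g D chart1 id_chart \<one>"
  shows "has_chart_derivative (\<lambda>h. R h (g h)) (\<lambda>X. D X + dR X (g \<one>)) chart1 id_chart \<one>"
proof -
  have "has_chart_derivative (\<lambda>h. R h (g h)) (\<lambda>X. R \<one> (D X) + dR X (g \<one>)) chart1 id_chart \<one>"
    by (rule has_chart_derivative_apply[OF good_chart1 _ dR assms]) (rule linear_R[OF chart1_carrier])
  then show ?thesis by (simp only: R_one)
qed

text \<open>If \<open>J\<close> is the derivative of inversion at the unit, the product rule applied to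
  \<open>R h (R (inv h) w) = w\<close> gives \<open>dR (J X) w = - dR X w\<close>.\<close>

lemma R_inv_has_chart_derivative:
  "has_chart_derivative (\<lambda>h. R (inv h) w) (\<lambda>X. - dR X w) chart1 id_chart \<one>"
proof -
  obtain J where J: "has_chart_derivative (\<lambda>x. inv x) J chart1 chart1 \<one>"
    using smooth_map_has_chart_derivative[OF charted_A charted_A smooth_inv chart1(1) chart1(1) chart1(2)] chart1
    by auto
  have *: "has_chart_derivative (\<lambda>h. R (inv h) w) (\<lambda>X. dR (J X) w) chart1 id_chart \<one>"
    using has_chart_derivative_chain[OF good_chart1 good_chart1 J, of "\<lambda>h. R h w" "\<lambda>X. dR X w" id_chart] dR by simp
  have "has_chart_derivative (\<lambda>h. R h (R (inv h) w)) (\<lambda>X. dR (J X) w + dR X w) chart1 id_chart \<one>"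
    using R_has_chart_derivative[OF *] by (simp add: R_one)
  then have "has_chart_derivative (\<lambda>h. w) (\<lambda>X. dR (J X) w + dR X w) chart1 id_chart \<one>"
    by (rule has_chart_derivative_cong[OF good_chart1, rotated])
       (simp add: chart1_carrier R_mult[symmetric] R_one)
  moreover have "has_chart_derivative (\<lambda>h. w) (\<lambda>X. 0) chart1 id_chart \<one>"
    by (rule has_chart_derivative_const) (simp_all add: chart1)
  ultimately have "(\<lambda>X. dR (J X) w + dR X w) = (\<lambda>X. 0)"
    by (rule has_chart_derivative_unique)
  then have "dR (J X) w = - dR X w" for X by (simp add: fun_eq_iff eq_neg_iff_add_eq_0)
  with * show ?thesis by simp
qed

lemma dR_Ad:
  assumes h: "h \<in> carrier G"
  shows "dR (Ad G A h Y) w = R h (dR Y (R (inv h) w))"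
proof -
  have "has_chart_derivative (\<lambda>x. R (h \<otimes> x \<otimes> inv h) w) (\<lambda>Y. dR (Ad G A h Y) w) chart1 id_chart \<one>"
    using has_chart_derivative_chain[OF good_chart1 good_chart1 conj_has_chart_derivative[OF h],
        of "\<lambda>h. R h w" "\<lambda>X. dR X w" id_chart] dR h by simp
  moreover have "has_chart_derivative (\<lambda>x. R (h \<otimes> x \<otimes> inv h) w)
      (\<lambda>Y. R h (dR Y (R (inv h) w))) chart1 id_chart \<one>"
    by (rule has_chart_derivative_cong[OF good_chart1 _
          has_chart_derivative_linear_compose[OF dR linear_R[OF h]]])
       (use h in \<open>simp add: R_mult chart1_carrier\<close>)
  ultimately have "(\<lambda>Y. dR (Ad G A h Y) w) = (\<lambda>Y. R h (dR Y (R (inv h) w)))"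
    by (rule has_chart_derivative_unique)
  then show ?thesis by meson
qed

text \<open>Both sides are the derivative at the unit of \<open>h \<mapsto> dR (Ad h Y) w = R h (dR Y (R (inv h) w))\<close> in the
  direction \<open>X\<close>.\<close>

lemma dR_bracket: "dR (lie_bracket G A X Y) w = dR X (dR Y w) - dR Y (dR X w)"
proof -
  have "has_chart_derivative (\<lambda>h. dR (Ad G A h Y) w) (\<lambda>X. dR (lie_bracket G A X Y) w) chart1 id_chart \<one>"
    by (rule has_chart_derivative_linear_compose[OF Ad_has_chart_derivative linear_dR_left])
  moreover have "has_chart_derivative (\<lambda>h. R h (dR Y (R (inv h) w)))
      (\<lambda>X. dR Y (- dR X w) + dR X (dR Y w)) chart1 id_chart \<one>"
    using R_has_chart_derivative[OF
        has_chart_derivative_linear_compose[OF R_inv_has_chart_derivative linear_dR_right]]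
    by (simp add: R_one)
  then have "has_chart_derivative (\<lambda>h. dR (Ad G A h Y) w)
      (\<lambda>X. dR Y (- dR X w) + dR X (dR Y w)) chart1 id_chart \<one>"
    by (rule has_chart_derivative_cong[OF good_chart1, rotated]) (simp add: dR_Ad chart1_carrier)
  ultimately have "(\<lambda>X. dR (lie_bracket G A X Y) w) = (\<lambda>X. dR Y (- dR X w) + dR X (dR Y w))"
    by (rule has_chart_derivative_unique)
  then show ?thesis by (simp add: fun_eq_iff linear_neg[OF linear_dR_right])
qed

end

context lie_group_atlas
begin

text \<open>For this action, \<open>dR_bracket\<close> is the Jacobi identity.\<close>

lemma adjoint_action: "lie_group_action G A (Ad G A) (lie_bracket G A)"
  by (intro lie_group_action.intro lie_group_action_axioms.intro lie_group_atlas_axioms)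
    (simp_all add: linear_Ad Ad_one Ad_mult Ad_has_chart_derivative)

lemma representation_action:
  assumes "representation G A K sc \<rho>"
  shows "lie_group_action G A \<rho> (inf_action G A \<rho>)"
proof (intro lie_group_action.intro lie_group_action_axioms.intro lie_group_atlas_axioms)
  show "has_chart_derivative (\<lambda>h. \<rho> h w) (\<lambda>X. inf_action G A \<rho> X w) chart1 id_chart \<one>" for w
  proof -
    have "smooth_map A euclid (\<lambda>h. \<rho> h w)" using assms unfolding representation_def by blast
    from smooth_map_differential[OF charted_A charted_euclid this, of \<one>] show ?thesis
      by (simp add: inf_action_def[abs_def] points_A)
  qed
qed (use assms in \<open>unfold representation_def, blast+\<close>)

end

section \<open>Differentiability of families of linear maps\<close>

text \<open>A sum over the basis instead of the abstraction \<open>Blinfun F\<close>, because it depends differentiably on a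
  parameter as soon as the values of \<open>F\<close> on the basis do.\<close>

definition linear_blinfun :: "('e::euclidean_space \<Rightarrow> 'v::real_normed_vector) \<Rightarrow> 'e \<Rightarrow>\<^sub>L 'v" where
  "linear_blinfun F = (\<Sum>b\<in>Basis. blinfun_scaleR_left (F b) o\<^sub>L blinfun_inner_left b)"

lemma linear_blinfun_apply:
  assumes "linear F" shows "blinfun_apply (linear_blinfun F) X = F X"
proof -
  have "blinfun_apply (linear_blinfun F) X = (\<Sum>b\<in>Basis. (X \<bullet> b) *\<^sub>R F b)"
    by (simp add: linear_blinfun_def blinfun.sum_left)
  also have "\<dots> = F (\<Sum>b\<in>Basis. (X \<bullet> b) *\<^sub>R b)"
    by (simp add: linear_sum[OF assms] linear_scale[OF assms])
  finally show ?thesis by (simp add: euclidean_representation)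
qed

lemma differentiable_linear_blinfun:
  assumes "\<And>b. (\<lambda>y. F y b) differentiable (at y0)"
  shows "(\<lambda>y. linear_blinfun (F y)) differentiable (at y0)"
proof -
  have "bounded_linear (\<lambda>v. blinfun_scaleR_left v o\<^sub>L blinfun_inner_left b)" for b
    by (intro bounded_linear_compose[OF bounded_bilinear.bounded_linear_left[OF
            bounded_bilinear_blinfun_compose] bounded_linear_blinfun_scaleR_left])
  then have "(\<lambda>y. blinfun_scaleR_left (F y b) o\<^sub>L blinfun_inner_left b) differentiable (at y0)" for b
    using assms[of b] bounded_linear.has_derivative unfolding differentiable_def by blast
  then show ?thesis
    unfolding linear_blinfun_def by (intro differentiable_sum ballI finite_Basis)
qed

text \<open>If \<open>g \<circ> \<Omega> = k\<close> with \<open>\<Omega>\<close> invertible at \<open>y0\<close>, then \<open>g\<close> inherits differentiability from \<open>\<Omega>\<close> and \<open>k\<close>.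
  Normalize \<open>\<Omega>\<close> to \<open>M = \<Omega> \<circ> (\<Omega> y0)\<inverse>\<close>, which is the
  identity at \<open>y0\<close>, and let \<open>h = (g - g y0) \<circ> M\<close>, which is a differentiable function of \<open>y\<close> as it equals
  the normalized \<open>k\<close> minus \<open>g y0 \<circ> M\<close>. Then \<open>g - g y0 - h = - (g - g y0) \<circ> (M - 1)\<close>. Near \<open>y0\<close> this
  bounds \<open>g - g y0\<close> by \<open>2 \<bar>h\<bar>\<close>, and then the difference by \<open>2 \<bar>h\<bar> \<bar>M - 1\<bar>\<close>, which is of smaller order
  than the distance to \<open>y0\<close>. So \<open>g\<close> has the derivative of \<open>h\<close>.\<close>

lemma differentiable_quotient:
  fixes g :: "'n::euclidean_space \<Rightarrow> 'e::euclidean_space \<Rightarrow>\<^sub>L 'v::real_normed_vector"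
  assumes \<Omega>: "\<And>w. (\<lambda>y. \<Omega> y w) differentiable (at y0)"
    and k: "\<And>w. (\<lambda>y. k y w) differentiable (at y0)"
    and bij: "bij (\<Omega> y0)"
    and ev: "\<forall>\<^sub>F y in nhds y0. linear (\<Omega> y) \<and> linear (k y) \<and> (\<forall>w. blinfun_apply (g y) (\<Omega> y w) = k y w)"
  shows "g differentiable (at y0)"
proof -
  have at_y0: "linear (\<Omega> y0)" "linear (k y0)" "blinfun_apply (g y0) (\<Omega> y0 w) = k y0 w" for w
    using eventually_nhds_x_imp_x[OF ev] by auto
  define L where "L = inv_into UNIV (\<Omega> y0)"
  have \<Omega>L: "\<Omega> y0 (L X) = X" for X
    unfolding L_def using bij by (simp add: bij_is_surj surj_f_inv_f)
  have L\<Omega>: "L (\<Omega> y0 w) = w" for w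
    unfolding L_def using bij by (simp add: bij_is_inj inv_f_f)
  have L: "linear L"
    using linear_add[OF at_y0(1)] linear_scale[OF at_y0(1)] \<Omega>L L\<Omega> by (metis linearI)
  define M where "M y = linear_blinfun (\<lambda>X. \<Omega> y (L X))" for y
  define h where "h y = linear_blinfun (\<lambda>X. k y (L X)) - (g y0 o\<^sub>L M y)" for y
  have M: "M differentiable (at y0)"
    unfolding M_def by (rule differentiable_linear_blinfun) (rule \<Omega>)
  have "(\<lambda>y. g y0 o\<^sub>L M y) differentiable (at y0)"
    using M bounded_linear.has_derivative[OF bounded_bilinear.bounded_linear_right[OF
          bounded_bilinear_blinfun_compose]]
    unfolding differentiable_def by blast
  then have "h differentiable (at y0)"
    unfolding h_def by (intro differentiable_diff differentiable_linear_blinfun k)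
  then obtain h' where h': "(h has_derivative h') (at y0)" by (auto simp: differentiable_def)
  have M_apply: "blinfun_apply (M y) X = \<Omega> y (L X)" if "linear (\<Omega> y)" for y X
    unfolding M_def by (rule linear_blinfun_apply) (use linear_compose[OF L that] in \<open>simp add: o_def\<close>)
  have k_apply: "blinfun_apply (linear_blinfun (\<lambda>X. k y (L X))) X = k y (L X)" if "linear (k y)" for y X
    by (rule linear_blinfun_apply) (use linear_compose[OF L that] in \<open>simp add: o_def\<close>)
  have M0: "M y0 = id_blinfun"
    by (rule blinfun_eqI) (simp add: M_apply at_y0 \<Omega>L)
  have h0: "h y0 = 0"
  proof (rule blinfun_eqI)
    fix X
    have "k y0 (L X) = blinfun_apply (g y0) X" using at_y0(3)[of "L X"] by (simp add: \<Omega>L)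
    then show "blinfun_apply (h y0) X = blinfun_apply 0 X"
      by (simp add: h_def M0 blinfun.diff_left k_apply[OF at_y0(2)])
  qed
  define N where "N = (\<lambda>y. norm (M y - id_blinfun))"
  have N: "(N \<longlongrightarrow> 0) (at y0)"
  proof -
    have "(M \<longlongrightarrow> M y0) (at y0)"
      using differentiable_imp_continuous_within[OF M] by (simp add: continuous_within)
    then have "((\<lambda>y. norm (M y - id_blinfun)) \<longlongrightarrow> norm (M y0 - id_blinfun)) (at y0)"
      by (intro tendsto_intros)
    then show ?thesis unfolding N_def M0 by simp
  qed
  have rem: "norm (g y - g y0 - h y) \<le> 2 * norm (h y) * N y"
    if y: "linear (\<Omega> y)" "linear (k y)" "\<And>w. blinfun_apply (g y) (\<Omega> y w) = k y w" and Ny: "N y < 1/2" for y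
  proof -
    have h: "h y = (g y - g y0) o\<^sub>L M y"
      by (rule blinfun_eqI) (simp add: h_def blinfun.diff_left M_apply k_apply y)
    \<comment> \<open>\<open>g - g y0\<close> is bounded by half of itself plus \<open>h\<close>, whence the factor \<open>2\<close>\<close>
    have eq: "g y - g y0 - h y = - ((g y - g y0) o\<^sub>L (M y - id_blinfun))"
      by (rule blinfun_eqI) (simp add: h blinfun.diff_left blinfun.diff_right blinfun.minus_left)
    have le: "norm (g y - g y0 - h y) \<le> norm (g y - g y0) * N y"
      unfolding eq N_def norm_minus_cancel by (rule norm_blinfun_compose)
    have "norm (g y - g y0) \<le> norm (g y - g y0 - h y) + norm (h y)"
      using norm_triangle_ineq[of "g y - g y0 - h y" "h y"] by simp
    also have "\<dots> \<le> norm (g y - g y0) * (1/2) + norm (h y)"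
      using le mult_left_mono[of "N y" "1/2" "norm (g y - g y0)"] Ny by simp
    finally have "norm (g y - g y0) \<le> 2 * norm (h y)" by simp
    then show ?thesis
      using le mult_right_mono[of "norm (g y - g y0)" "2 * norm (h y)" "N y"] by (simp add: N_def)
  qed
  have bh': "bounded_linear h'" using h' by (rule has_derivative_bounded_linear)
  define q where "q = (\<lambda>y. norm (h y - h y0 - h' (y - y0)) / norm (y - y0))"
  have q: "(q \<longlongrightarrow> 0) (at y0)"
    using h' unfolding has_derivative_iff_norm q_def by blast
  have bound: "norm (g y - g y0 - h' (y - y0)) / norm (y - y0) \<le> q y + 2 * (q y + onorm h') * N y"
    if y: "y \<noteq> y0" and r: "norm (g y - g y0 - h y) \<le> 2 * norm (h y) * N y" for y
  proof -
    have p: "norm (y - y0) > 0" using y by simp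
    have hq: "norm (h y - h' (y - y0)) = q y * norm (y - y0)" using p by (simp add: q_def h0)
    have "norm (h y) \<le> norm (h y - h' (y - y0)) + norm (h' (y - y0))"
      using norm_triangle_ineq[of "h y - h' (y - y0)" "h' (y - y0)"] by simp
    also have "\<dots> \<le> (q y + onorm h') * norm (y - y0)"
      using onorm[OF bh', of "y - y0"] by (simp add: hq algebra_simps)
    finally have nh: "norm (h y) \<le> (q y + onorm h') * norm (y - y0)" .
    have "norm (g y - g y0 - h' (y - y0)) \<le> norm (g y - g y0 - h y) + norm (h y - h' (y - y0))"
      using norm_triangle_ineq[of "g y - g y0 - h y" "h y - h' (y - y0)"] by simp
    also have "\<dots> \<le> 2 * ((q y + onorm h') * norm (y - y0)) * N y + q y * norm (y - y0)"
      using r mult_right_mono[OF nh, of "2 * N y"] by (simp add: hq N_def mult_ac)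
    also have "\<dots> = (q y + 2 * (q y + onorm h') * N y) * norm (y - y0)"
      by (simp add: algebra_simps)
    finally show ?thesis using p by (simp add: pos_divide_le_eq)
  qed
  have "(g has_derivative h') (at y0)"
    unfolding has_derivative_iff_norm
  proof (intro conjI bh')
    have "((\<lambda>y. q y + 2 * (q y + onorm h') * N y) \<longlongrightarrow> 0 + 2 * (0 + onorm h') * 0) (at y0)"
      by (intro tendsto_intros q N)
    then have upper: "((\<lambda>y. q y + 2 * (q y + onorm h') * N y) \<longlongrightarrow> 0) (at y0)" by simp
    have "\<forall>\<^sub>F y in at y0. N y < 1/2"
      using order_tendstoD(2)[OF N, of "1/2"] by simp
    moreover have "\<forall>\<^sub>F y in at y0. y \<noteq> y0" by (simp add: eventually_at_filter)
    moreover have "\<forall>\<^sub>F y in at y0. linear (\<Omega> y) \<and> linear (k y) \<and> (\<forall>w. blinfun_apply (g y) (\<Omega> y w) = k y w)"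
      using ev by (simp add: eventually_nhds_conv_at)
    ultimately have "\<forall>\<^sub>F y in at y0.
        norm (g y - g y0 - h' (y - y0)) / norm (y - y0) \<le> q y + 2 * (q y + onorm h') * N y"
      by eventually_elim (intro bound rem; simp)
    then show "((\<lambda>y. norm (g y - g y0 - h' (y - y0)) / norm (y - y0)) \<longlongrightarrow> 0) (at y0)"
      by (rule tendsto_sandwich[OF _ _ tendsto_const upper, rotated]) simp
  qed
  then show ?thesis by (auto simp: differentiable_def)
qed

section \<open>The codifferential on one-forms\<close>

lemma wedge_Nil: "wedge [] v Ys = (if Ys = [] then v else 0)"
  by (simp add: wedge_def)

lemma wedge_single: "wedge [\<phi>] v Ys = (if length Ys = 1 then \<phi> (Ys ! 0) *\<^sub>R v else 0)"
proof -
  have "{p. p permutes {..<Suc 0}} = {id}" by (simp add: lessThan_Suc permutes_sing)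
  then show ?thesis by (simp add: wedge_def)
qed

lemma codiff_decomposable_single:
  "codiff_decomposable br act ct [\<phi>] v Ys = (if Ys = [] then - act \<phi> v else 0)"
  by (simp add: codiff_decomposable_def omit_def wedge_Nil)

lemma linear_sum_list: "linear T \<Longrightarrow> T (\<Sum>x\<leftarrow>xs. f x) = (\<Sum>x\<leftarrow>xs. T (f x))"
  by (induction xs) (simp_all add: linear_0 linear_add)

lemma sum_sum_list_swap:
  fixes f :: "'a \<Rightarrow> 'b \<Rightarrow> 'c::comm_monoid_add"
  shows "(\<Sum>i\<in>I. \<Sum>x\<leftarrow>xs. f i x) = (\<Sum>x\<leftarrow>xs. \<Sum>i\<in>I. f i x)"
  by (induction xs) (simp_all add: sum.distrib)

text \<open>If the one-form is the sum of \<open>\<phi>\<^sub>j \<otimes> v\<^sub>j\<close>, its codifferential is \<open>- \<Sum> \<phi>\<^sub>j \<bullet> v\<^sub>j\<close>. Expanding every \<open>\<phi>\<^sub>j\<close>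
  in the \<open>\<eta>\<^sub>l\<close>, with coefficients \<open>B \<phi>\<^sub>j \<xi>\<^sub>l\<close>, turns this into \<open>- \<Sum> \<eta>\<^sub>l \<bullet> N \<xi>\<^sub>l\<close>, in which the \<open>\<phi>\<^sub>j\<close> and
  \<open>v\<^sub>j\<close> enter only through the form itself. So the value does not depend on the representation of
  the form. One representation is given by the positive parts of the \<open>\<eta>\<^sub>l\<close> with the values
  \<open>N \<xi>\<^sub>l\<close>, because \<open>N\<close> sees only negative parts.\<close>

lemma (in graded_killing_dual) codiff_one_form:
  fixes act :: "'e \<Rightarrow> 'v::real_vector \<Rightarrow> 'v" and N :: "'e \<Rightarrow> 'v" and tp :: "'e \<Rightarrow> 't"
  assumes act_left: "\<And>v. linear (\<lambda>X. act X v)" and act_right: "\<And>X. linear (act X)"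
    and N: "linear N" "\<And>X. X \<in> nonneg \<Longrightarrow> N X = 0"
    and tp: "surj tp" and ct: "\<And>\<phi> X. \<phi> \<in> positive \<Longrightarrow> ct \<phi> (tp X) = B \<phi> X"
    and \<alpha>: "\<And>X. \<alpha> (tp X) = N X"
  shows "codiff positive br act ct 1 (as_one_form \<alpha>) [] = - (\<Sum>l<DIM('e). act (\<eta> l) (N (\<xi> l)))"
proof -
  define \<beta>\<^sub>0 where "\<beta>\<^sub>0 = (\<lambda>Ys :: 't list. if Ys = [] then - (\<Sum>l<DIM('e). act (\<eta> l) (N (\<xi> l))) else 0)"
  define repr where "repr \<beta> ds \<longleftrightarrow> (\<forall>(\<phi>s, v)\<in>set ds. length \<phi>s = 1 \<and> set \<phi>s \<subseteq> positive) \<and>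
    as_one_form \<alpha> = (\<lambda>Ys. \<Sum>(\<phi>s, v)\<leftarrow>ds. wedge (map ct \<phi>s) v Ys) \<and>
    \<beta> = (\<lambda>Ys. \<Sum>(\<phi>s, v)\<leftarrow>ds. codiff_decomposable br act ct \<phi>s v Ys)" for \<beta> :: "'t list \<Rightarrow> 'v" and ds
  have unique: "\<beta> = \<beta>\<^sub>0" if "repr \<beta> ds" for \<beta> ds
  proof -
    have ds: "\<forall>(\<phi>s, v)\<in>set ds. length \<phi>s = 1 \<and> set \<phi>s \<subseteq> positive"
      and \<alpha>_ds: "as_one_form \<alpha> = (\<lambda>Ys. \<Sum>(\<phi>s, v)\<leftarrow>ds. wedge (map ct \<phi>s) v Ys)"
      and \<beta>: "\<beta> = (\<lambda>Ys. \<Sum>(\<phi>s, v)\<leftarrow>ds. codiff_decomposable br act ct \<phi>s v Ys)"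
      using that by (auto simp: repr_def)
    have N_ds: "N X = (\<Sum>(\<phi>s, v)\<leftarrow>ds. B (hd \<phi>s) X *\<^sub>R v)" for X
    proof -
      have "N X = (\<Sum>(\<phi>s, v)\<leftarrow>ds. wedge (map ct \<phi>s) v [tp X])"
        using fun_cong[OF \<alpha>_ds, of "[tp X]"] by (simp add: as_one_form_def \<alpha>)
      also have "\<dots> = (\<Sum>(\<phi>s, v)\<leftarrow>ds. B (hd \<phi>s) X *\<^sub>R v)"
        using ds by (intro arg_cong[of _ _ sum_list] map_cong refl)
          (auto simp: length_Suc_conv wedge_single ct)
      finally show ?thesis .
    qed
    have "(\<Sum>l<DIM('e). act (\<eta> l) (N (\<xi> l)))
        = (\<Sum>l<DIM('e). \<Sum>(\<phi>s, v)\<leftarrow>ds. B (hd \<phi>s) (\<xi> l) *\<^sub>R act (\<eta> l) v)"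
      by (simp add: N_ds linear_sum_list[OF act_right] case_prod_unfold linear_scale[OF act_right])
    also have "\<dots> = (\<Sum>(\<phi>s, v)\<leftarrow>ds. \<Sum>l<DIM('e). B (hd \<phi>s) (\<xi> l) *\<^sub>R act (\<eta> l) v)"
      by (simp add: sum_sum_list_swap case_prod_unfold)
    also have "\<dots> = (\<Sum>(\<phi>s, v)\<leftarrow>ds. act (\<Sum>l<DIM('e). B (hd \<phi>s) (\<xi> l) *\<^sub>R \<eta> l) v)"
      by (simp add: linear_sum[OF act_left] linear_scale[OF act_left])
    also have "\<dots> = (\<Sum>(\<phi>s, v)\<leftarrow>ds. act (hd \<phi>s) v)"
      by (simp add: expand_\<eta>)
    finally have sum: "(\<Sum>l<DIM('e). act (\<eta> l) (N (\<xi> l))) = (\<Sum>(\<phi>s, v)\<leftarrow>ds. act (hd \<phi>s) v)" .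
    show ?thesis
    proof
      fix Ys :: "'t list"
      have "\<beta> Ys = (\<Sum>(\<phi>s, v)\<leftarrow>ds. if Ys = [] then - act (hd \<phi>s) v else 0)"
        unfolding \<beta> using ds by (intro arg_cong[of _ _ sum_list] map_cong refl)
          (auto simp: length_Suc_conv codiff_decomposable_single)
      also have "\<dots> = \<beta>\<^sub>0 Ys"
        by (cases "Ys = []")
          (simp_all add: \<beta>\<^sub>0_def sum case_prod_unfold uminus_sum_list_map o_def sum_list_0)
      finally show "\<beta> Ys = \<beta>\<^sub>0 Ys" .
    qed
  qed
  define ds where "ds = map (\<lambda>l. ([pos_part (\<eta> l)], N (\<xi> l))) [0..<DIM('e)]"
  have N_expand: "N X = (\<Sum>l<DIM('e). B (pos_part (\<eta> l)) X *\<^sub>R N (\<xi> l))" for X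
  proof -
    have "N X = N (neg_part X)"
    proof -
      have "N (pos_part X) = 0" "N (component 0 X) = 0"
        using N(2) pos_part_in_positive positive_subset_nonneg component_0_in_nonneg by blast+
      then show ?thesis
        using decomposition[of X] linear_add[OF N(1)] by (metis add.right_neutral)
    qed
    also have "\<dots> = N (\<Sum>l<DIM('e). B (neg_part X) (\<eta> l) *\<^sub>R \<xi> l)"
      by (simp add: expand_\<xi>)
    also have "\<dots> = (\<Sum>l<DIM('e). B (pos_part (\<eta> l)) X *\<^sub>R N (\<xi> l))"
      by (simp add: linear_sum[OF N(1)] linear_scale[OF N(1)] B_neg_part B_sym[of X])
    finally show ?thesis .
  qed
  have "as_one_form \<alpha> Ys = (\<Sum>(\<phi>s, v)\<leftarrow>ds. wedge (map ct \<phi>s) v Ys)" for Ys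
  proof (cases "length Ys = 1")
    case True
    then obtain Y where Ys: "Ys = [Y]" by (auto simp: length_Suc_conv)
    obtain X where X: "Y = tp X" using tp by (metis surjD)
    show ?thesis
      by (simp add: as_one_form_def Ys X \<alpha> ds_def wedge_single ct[OF pos_part_in_positive] o_def
          N_expand[of X] interv_sum_list_conv_sum_set_nat lessThan_atLeast0)
  next
    case False
    then show ?thesis
      by (simp add: as_one_form_def ds_def wedge_single o_def)
  qed
  then have "repr (\<lambda>Ys. \<Sum>(\<phi>s, v)\<leftarrow>ds. codiff_decomposable br act ct \<phi>s v Ys) ds"
    unfolding repr_def by (auto simp: ds_def pos_part_in_positive)
  with unique have "repr \<beta>\<^sub>0 ds" by metis
  then have "(THE \<beta>. \<exists>ds. repr \<beta> ds) = \<beta>\<^sub>0"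
    using unique by (intro the_equality) blast+
  then show ?thesis
    unfolding codiff_def repr_def by (simp add: \<beta>\<^sub>0_def)
qed

section \<open>Parabolic geometries\<close>

lemma has_chart_derivative_widen:
  assumes "has_chart_derivative f D c d' x" "fst d' \<subseteq> fst d" "snd d' = snd d"
  shows "has_chart_derivative f D c d x"
proof -
  have "\<forall>\<^sub>F y in at (snd c x). f (chart_inv c y) \<in> fst d'"
    using assms(1) by (simp add: has_chart_derivative_def)
  then have "\<forall>\<^sub>F y in at (snd c x). f (chart_inv c y) \<in> fst d"
    by eventually_elim (use assms(2) in blast)
  then show ?thesis using assms unfolding has_chart_derivative_def by auto
qed

lemma has_chart_derivative_chart_inv:
  assumes c: "good_chart c" and y: "y \<in> snd c ` fst c"
  shows "has_chart_derivative (chart_inv c) (\<lambda>v. v) id_chart c y"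
proof -
  have ev: "\<forall>\<^sub>F z in at y. z \<in> snd c ` fst c"
    using eventually_chart[OF c chart_inv_in[OF y]] by (simp add: chart_chart_inv[OF y])
  have "((\<lambda>z. snd c (chart_inv c z)) has_derivative (\<lambda>v. v)) (at y)"
  proof (rule has_derivative_transform_eventually[OF has_derivative_ident])
    show "\<forall>\<^sub>F z in at y. z = snd c (chart_inv c z)"
      using ev by eventually_elim (simp add: chart_chart_inv)
  qed (simp_all add: chart_chart_inv[OF y])
  moreover have "\<forall>\<^sub>F z in at y. chart_inv c z \<in> fst c"
    using ev by eventually_elim (rule chart_inv_in)
  ultimately show ?thesis by (simp add: has_chart_derivative_def chart_inv_in[OF y])
qed

locale parabolic_geometry_atlas = lie_group_atlas G A
  for G :: "'g::{second_countable_topology,t2_space} monoid" (structure)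
    and A :: "('g, 'e::euclidean_space) atlas" +
  fixes P :: "'g set" and AP :: "('g, 'f::euclidean_space) atlas"
    and AY :: "('y::{second_countable_topology,t2_space}, 'n::euclidean_space) atlas"
    and AM :: "('m::{second_countable_topology,t2_space}, 'k::real_normed_vector) atlas"
    and \<pi> :: "'y \<Rightarrow> 'm" and r :: "'y \<Rightarrow> 'g \<Rightarrow> 'y" and \<omega> :: "'y \<Rightarrow> 'n \<Rightarrow> 'e"
  assumes closed_subgroup: "closed_lie_subgroup G A P AP"
    and geometry: "parabolic_geometry G A P AP AY AM \<pi> r \<omega>"
begin

lemma subgroup_P: "subgroup P G" and manifold_AP: "smooth_manifold AP" and points_AP: "points AP = P"
  and smooth_incl: "smooth_map AP A (\<lambda>x. x)"
  and inj_incl: "h \<in> P \<Longrightarrow> inj (differential AP A (\<lambda>x. x) h)"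
  using closed_subgroup by (simp_all add: closed_lie_subgroup_def)

lemma charted_AP: "charted AP"
  by (rule smooth_manifold_charted[OF manifold_AP])

lemma P_carrier: "h \<in> P \<Longrightarrow> h \<in> carrier G"
  by (rule subgroup.mem_carrier[OF subgroup_P])

lemma one_P: "\<one> \<in> P"
  by (rule subgroup.one_closed[OF subgroup_P])

lemma principal: "principal_bundle G P AP AY AM \<pi> r"
  and cartan: "cartan_connection G A P AP AY r \<omega>"
  and dims: "dim (UNIV :: 'k set) + dim (UNIV :: 'f set) = dim (UNIV :: 'e set)"
  using geometry by (simp_all add: parabolic_geometry_def)

lemma manifold_AY: "smooth_manifold AY" and manifold_AM: "smooth_manifold AM"
  and smooth_\<pi>: "smooth_map AY AM \<pi>" and smooth_r: "smooth_map (prod_atlas AY AP) AY (\<lambda>(u, h). r u h)"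
  and r_one: "u \<in> points AY \<Longrightarrow> r u \<one> = u"
  and \<pi>_r: "u \<in> points AY \<Longrightarrow> h \<in> P \<Longrightarrow> \<pi> (r u h) = \<pi> u"
  using principal by (simp_all add: principal_bundle_def)

lemma charted_AY: "charted AY" and charted_AM: "charted AM"
  by (rule smooth_manifold_charted[OF manifold_AY], rule smooth_manifold_charted[OF manifold_AM])

lemma r_points: "u \<in> points AY \<Longrightarrow> h \<in> P \<Longrightarrow> r u h \<in> points AY"
proof -
  assume "u \<in> points AY" "h \<in> P"
  moreover have "(\<lambda>(u, h). r u h) ` (points AY \<times> P) \<subseteq> points AY"
    using smooth_r by (simp add: smooth_map_def points_prod_atlas points_AP)
  ultimately show "r u h \<in> points AY" by blast
qed

lemma smooth_\<omega>: "smooth_one_form AY \<omega>"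
  and linear_\<omega>: "u \<in> points AY \<Longrightarrow> linear (\<omega> u)"
  and bij_\<omega>: "u \<in> points AY \<Longrightarrow> bij (\<omega> u)"
  and \<omega>_equivariant: "u \<in> points AY \<Longrightarrow> h \<in> P \<Longrightarrow>
    \<omega> (r u h) (differential AY AY (\<lambda>u. r u h) u v) = Ad G A (inv h) (\<omega> u v)"
  and \<omega>_fundamental: "u \<in> points AY \<Longrightarrow>
    \<omega> u (differential AP AY (r u) \<one> a) = differential AP A (\<lambda>x. x) \<one> a"
  using cartan by (simp_all add: cartan_connection_def)

abbreviation incl :: "'f \<Rightarrow> 'e" where "incl \<equiv> differential AP A (\<lambda>x. x) \<one>"
abbreviation chartP :: "'g set \<times> ('g \<Rightarrow> 'f)" where "chartP \<equiv> chart_at AP \<one>"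
abbreviation chartY :: "'y \<Rightarrow> 'y set \<times> ('y \<Rightarrow> 'n)" where "chartY \<equiv> chart_at AY"

lemma chartP: "chartP \<in> AP" "\<one> \<in> fst chartP"
  using chart_at[of \<one> AP] by (simp_all add: points_AP one_P)

lemma good_chartP: "good_chart chartP"
  by (rule charted_good[OF charted_AP chartP(1)])

lemma chartP_P: "h \<in> fst chartP \<Longrightarrow> h \<in> P"
  using charted_subset[OF charted_AP chartP(1)] points_AP by auto

lemma chartY: "u \<in> points AY \<Longrightarrow> chartY u \<in> AY" "u \<in> points AY \<Longrightarrow> u \<in> fst (chartY u)"
  by (rule chart_at; assumption)+

lemma good_chartY: "u \<in> points AY \<Longrightarrow> good_chart (chartY u)"
  by (rule charted_good[OF charted_AY chartY(1)])

lemma chartY_points: "u \<in> points AY \<Longrightarrow> v \<in> fst (chartY u) \<Longrightarrow> v \<in> points AY"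
  using charted_subset[OF charted_AY chartY(1)] by blast

lemma incl_has_chart_derivative: "has_chart_derivative (\<lambda>x. x) incl chartP chart1 \<one>"
  using smooth_map_differential[OF charted_AP charted_A smooth_incl, of \<one>] by (simp add: points_AP one_P)

lemma orbit_has_chart_derivative:
  assumes u: "u \<in> points AY"
  shows "has_chart_derivative (r u) (differential AP AY (r u) \<one>) chartP (chartY u) \<one>"
proof -
  have ru: "r u \<one> = u" by (rule r_one[OF u])
  obtain D where D: "has_chart_derivative (r u) D chartP (chartY u) \<one>"
    using smooth_map_partials(1)[OF charted_AY charted_AP charted_AY smooth_r chartY[OF u] chartP chartY(1)[OF u]]
      chartY(2)[OF u] by (simp add: ru)
  then have "differential AP AY (r u) \<one> = D"
    by (intro differential_eqI) (simp add: ru)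
  with D show ?thesis by simp
qed

lemma translation_has_chart_derivative:
  assumes u: "u \<in> points AY" and h: "h \<in> P"
  shows "has_chart_derivative (\<lambda>u. r u h) (differential AY AY (\<lambda>u. r u h) u) (chartY u) (chartY (r u h)) u"
proof -
  have hP: "chart_at AP h \<in> AP" "h \<in> fst (chart_at AP h)" using chart_at[of h AP] h by (simp_all add: points_AP)
  have v: "r u h \<in> points AY" by (rule r_points[OF u h])
  obtain D where D: "has_chart_derivative (\<lambda>u. r u h) D (chartY u) (chartY (r u h)) u"
    using smooth_map_partials(2)[OF charted_AY charted_AP charted_AY smooth_r chartY[OF u] hP chartY(1)[OF v]]
      chartY(2)[OF v] by simp
  then have "differential AY AY (\<lambda>u. r u h) u = D"
    by (intro differential_eqI) simp
  with D show ?thesis by simp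
qed

lemma \<pi>_has_chart_derivative:
  "u \<in> points AY \<Longrightarrow> has_chart_derivative \<pi> (differential AY AM \<pi> u) (chartY u) (chart_at AM (\<pi> u)) u"
  by (rule smooth_map_differential[OF charted_AY charted_AM smooth_\<pi>])

abbreviation tangent :: "'y \<Rightarrow> 'e \<Rightarrow> 'n" where "tangent u \<equiv> inv_into UNIV (\<omega> u)"

lemma \<omega>_tangent: "u \<in> points AY \<Longrightarrow> \<omega> u (tangent u X) = X"
  by (simp add: bij_\<omega> bij_is_surj surj_f_inv_f)

lemma tangent_\<omega>: "u \<in> points AY \<Longrightarrow> tangent u (\<omega> u v) = v"
  by (simp add: bij_\<omega> bij_is_inj inv_f_f)

lemma linear_tangent:
  assumes u: "u \<in> points AY" shows "linear (tangent u)"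
proof (rule linearI)
  show "tangent u (X + Y) = tangent u X + tangent u Y" for X Y
    by (rule injD[OF bij_is_inj[OF bij_\<omega>[OF u]]])
      (simp add: \<omega>_tangent[OF u] linear_add[OF linear_\<omega>[OF u]])
  show "tangent u (c *\<^sub>R X) = c *\<^sub>R tangent u X" for c X
    by (rule injD[OF bij_is_inj[OF bij_\<omega>[OF u]]])
      (simp add: \<omega>_tangent[OF u] linear_scale[OF linear_\<omega>[OF u]])
qed

lemma tangent_incl: "u \<in> points AY \<Longrightarrow> tangent u (incl a) = differential AP AY (r u) \<one> a"
  by (metis \<omega>_fundamental tangent_\<omega>)

text \<open>Equivariance of the Cartan connection, read as a transformation rule for the constant vector
  fields.\<close>

lemma tangent_r:
  assumes u: "u \<in> points AY" and h: "h \<in> P"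
  shows "tangent (r u h) Y = differential AY AY (\<lambda>u. r u h) u (tangent u (Ad G A h Y))"
proof -
  have hG: "h \<in> carrier G" using h by (rule P_carrier)
  have "\<omega> (r u h) (differential AY AY (\<lambda>u. r u h) u (tangent u (Ad G A h Y)))
      = Ad G A (inv h) (Ad G A h Y)"
    by (simp add: \<omega>_equivariant u h \<omega>_tangent)
  also have "\<dots> = Y"
    using hG by (simp add: Ad_mult[symmetric] Ad_one)
  finally show ?thesis by (metis tangent_\<omega> r_points u h)
qed

lemma tangent_proj_eq: "tangent_proj AY AM \<pi> \<omega> u X = differential AY AM \<pi> u (tangent u X)"
  by (simp add: tangent_proj_def)

lemma linear_tangent_proj:
  assumes u: "u \<in> points AY" shows "linear (tangent_proj AY AM \<pi> \<omega> u)"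
  using linear_compose[OF linear_tangent[OF u] has_chart_derivative_linear[OF \<pi>_has_chart_derivative[OF u]]]
  by (simp add: o_def tangent_proj_eq[abs_def])

lemma tangent_proj_incl:
  assumes u: "u \<in> points AY" shows "tangent_proj AY AM \<pi> \<omega> u (incl a) = 0"
proof -
  let ?c = "chart_at AM (\<pi> u)"
  have "has_chart_derivative (\<lambda>h. \<pi> (r u h))
      (\<lambda>a. differential AY AM \<pi> u (differential AP AY (r u) \<one> a)) chartP ?c \<one>"
    by (rule has_chart_derivative_chain[OF good_chartP good_chartY[OF u] orbit_has_chart_derivative[OF u]])
       (simp add: r_one[OF u] \<pi>_has_chart_derivative[OF u])
  then have "has_chart_derivative (\<lambda>h. \<pi> u)
      (\<lambda>a. differential AY AM \<pi> u (differential AP AY (r u) \<one> a)) chartP ?c \<one>"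
    by (rule has_chart_derivative_cong[OF good_chartP, rotated]) (simp add: \<pi>_r[OF u] chartP_P)
  moreover have "has_chart_derivative (\<lambda>h. \<pi> u) (\<lambda>a. 0) chartP ?c \<one>"
    using \<pi>_has_chart_derivative[OF u]
    by (intro has_chart_derivative_const chartP) (simp add: has_chart_derivative_def)
  ultimately have "(\<lambda>a. differential AY AM \<pi> u (differential AP AY (r u) \<one> a)) = (\<lambda>a. 0)"
    by (rule has_chart_derivative_unique)
  then show ?thesis by (simp add: tangent_proj_eq tangent_incl[OF u] fun_eq_iff)
qed

text \<open>A local trivialization gives a section of \<open>\<pi>\<close> through \<open>u\<close>, namely \<open>x \<mapsto> \<Psi> (x, \<tau> u)\<close> for the inverse
  \<open>\<Psi>\<close> of the trivialization. Its derivative is a right inverse of the derivative of \<open>\<pi>\<close>.\<close>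

lemma surj_tangent_proj:
  assumes u: "u \<in> points AY" shows "surj (tangent_proj AY AM \<pi> \<omega> u)"
proof -
  define x where "x = \<pi> u"
  have x: "x \<in> points AM" using smooth_\<pi> u unfolding smooth_map_def x_def by blast
  obtain U \<tau> where xU: "x \<in> U" and U: "openin (top_of_set (points AM)) U"
    and diffeo: "diffeo (restrict_atlas AY (\<pi> -` U)) (prod_atlas (restrict_atlas AM U) AP) (\<lambda>u. (\<pi> u, \<tau> u))"
    using principal x unfolding principal_bundle_def by blast
  define S where "S = \<pi> -` U"
  define \<Psi> where "\<Psi> = inv_into (points AY \<inter> S) (\<lambda>u. (\<pi> u, \<tau> u))"
  have bij: "bij_betw (\<lambda>u. (\<pi> u, \<tau> u)) (points AY \<inter> S) ((points AM \<inter> U) \<times> P)"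
    and smooth_\<Psi>: "smooth_map (prod_atlas (restrict_atlas AM U) AP) (restrict_atlas AY S) \<Psi>"
    using diffeo unfolding diffeo_def S_def \<Psi>_def points_prod_atlas points_restrict points_AP by auto
  have uS: "u \<in> points AY \<inter> S" using u xU by (simp add: S_def x_def)
  have \<Psi>u: "\<Psi> (x, \<tau> u) = u"
    unfolding \<Psi>_def x_def using bij_betw_inv_into_left[OF bij uS] by simp
  have \<tau>u: "\<tau> u \<in> P" using bij_betwE[OF bij] uS by blast
  have \<pi>\<Psi>: "\<pi> (\<Psi> (x', \<tau> u)) = x'" if "x' \<in> points AM \<inter> U" for x'
    using bij_betw_inv_into_right[OF bij, of "(x', \<tau> u)"] that \<tau>u unfolding \<Psi>_def by auto
  have "openin (top_of_set (points AM)) (points AM \<inter> U)" using U by (simp add: openin_Int)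
  then have chM: "charted (restrict_atlas AM U)" by (rule charted_restrict[OF charted_AM])
  have "openin (top_of_set (points AY)) (points AY \<inter> S)"
    unfolding S_def using smooth_\<pi> U
    by (intro continuous_openin_preimage[of _ _ "points AM"]) (auto simp: smooth_map_def)
  then have chY: "charted (restrict_atlas AY S)" by (rule charted_restrict[OF charted_AY])
  define c where "c = chart_at AM x"
  \<comment> \<open>restricted to the trivializing sets, these are charts for the trivialization\<close>
  define c' where "c' = (fst c \<inter> U, snd c)"
  define e where "e = chartY u"
  define e' where "e' = (fst e \<inter> S, snd e)"
  have c: "c \<in> AM" "x \<in> fst c" using chart_at[OF x] by (simp_all add: c_def)
  have e: "e \<in> AY" "u \<in> fst e" using chartY[OF u] by (simp_all add: e_def)
  have c': "c' \<in> restrict_atlas AM U" "x \<in> fst c'"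
    using c xU by (auto simp: c'_def restrict_atlas_def split_beta intro!: image_eqI[of _ _ c])
  have e': "e' \<in> restrict_atlas AY S" "u \<in> fst e'"
    using e uS by (auto simp: e'_def restrict_atlas_def split_beta intro!: image_eqI[of _ _ e])
  have d: "chart_at AP (\<tau> u) \<in> AP" "\<tau> u \<in> fst (chart_at AP (\<tau> u))"
    using chart_at[of "\<tau> u" AP] \<tau>u by (simp_all add: points_AP)
  obtain D where "has_chart_derivative (\<lambda>x'. \<Psi> (x', \<tau> u)) D c' e' x"
    using smooth_map_partials(2)[OF chM charted_AP chY smooth_\<Psi> c' d e'(1)] e'(2) by (simp add: \<Psi>u)
  then have D: "has_chart_derivative (\<lambda>x'. \<Psi> (x', \<tau> u)) D c' e x"
    by (rule has_chart_derivative_widen) (simp_all add: e'_def)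
  note gc' = charted_good[OF chM c'(1)] and ge = charted_good[OF charted_AY e(1)]
  have "has_chart_derivative (\<lambda>x'. \<pi> (\<Psi> (x', \<tau> u))) (\<lambda>v. differential AY AM \<pi> u (D v)) c' c x"
    by (rule has_chart_derivative_chain[OF gc' ge D])
       (use \<pi>_has_chart_derivative[OF u] in \<open>simp add: \<Psi>u c_def e_def flip: x_def\<close>)
  then have "has_chart_derivative (\<lambda>x'. x') (\<lambda>v. differential AY AM \<pi> u (D v)) c' c x"
    by (rule has_chart_derivative_cong[OF gc', rotated])
       (use \<pi>\<Psi> charted_subset[OF charted_AM c(1)] in \<open>auto simp: c'_def\<close>)
  moreover have "has_chart_derivative (\<lambda>x'. x') (\<lambda>v. v) c' c x"
    by (rule has_chart_derivative_widen[OF has_chart_derivative_id[OF gc' c'(2)]]) (simp_all add: c'_def)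
  ultimately have "(\<lambda>v. differential AY AM \<pi> u (D v)) = (\<lambda>v. v)"
    by (rule has_chart_derivative_unique)
  then have "tangent_proj AY AM \<pi> \<omega> u (\<omega> u (D v)) = v" for v
    by (simp add: tangent_proj_eq tangent_\<omega>[OF u] fun_eq_iff)
  then show ?thesis by (rule surjI)
qed

text \<open>The kernel contains the Lie algebra of \<open>P\<close>, as \<open>\<pi>\<close> is constant on orbits. By surjectivity and the
  condition on the dimensions both have the same dimension.\<close>

lemma tangent_proj_eq_0_iff:
  assumes u: "u \<in> points AY"
  shows "tangent_proj AY AM \<pi> \<omega> u X = 0 \<longleftrightarrow> X \<in> range incl"
proof -
  define tp where "tp = tangent_proj AY AM \<pi> \<omega> u"
  have lin: "linear tp" and surj: "surj tp"
    unfolding tp_def by (rule linear_tangent_proj[OF u], rule surj_tangent_proj[OF u])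
  define ker where "ker = {X. tp X = 0}"
  have ker: "subspace ker" unfolding ker_def by (rule linear_subspace_kernel[OF lin])
  have lin_incl: "linear incl" by (rule has_chart_derivative_linear[OF incl_has_chart_derivative])
  have sub: "range incl \<subseteq> ker" by (auto simp: ker_def tp_def tangent_proj_incl[OF u])
  obtain g where g: "linear g" "tp \<circ> g = id" using linear_surjective_right_inverse[OF lin surj] by blast
  then have tg: "tp (g x) = x" for x by (simp add: fun_eq_iff)
  have "inj_on tp (span (range g))"
    unfolding span_eq_iff[THEN iffD2, OF linear_subspace_image[OF g(1) subspace_UNIV]]
    by (auto simp: inj_on_def tg)
  from dim_image_eq[OF lin this] have "dim (range g) = dim (UNIV :: 'k set)"
    by (simp add: image_image tg)
  moreover have "dim (range incl) = dim (UNIV :: 'f set)"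
    by (rule dim_image_eq[OF lin_incl]) (use inj_incl[OF one_P] in \<open>simp add: inj_on_def\<close>)
  moreover have "dim {x + y |x y. x \<in> range g \<and> y \<in> ker} + dim (range g \<inter> ker) = dim (range g) + dim ker"
    by (rule dim_sums_Int[OF linear_subspace_image[OF g(1) subspace_UNIV] ker])
  moreover have "range g \<inter> ker = {0}"
    using tg by (auto simp: ker_def linear_0[OF g(1)] linear_0[OF lin] intro: image_eqI[of 0 g 0])
  moreover have "dim {x + y |x y. x \<in> range g \<and> y \<in> ker} \<le> dim (UNIV :: 'e set)"
    by (rule dim_subset) simp
  ultimately have "dim ker \<le> dim (range incl)" using dims by simp
  then have "range incl = ker"
    by (intro subspace_dim_equal linear_subspace_image[OF lin_incl subspace_UNIV] ker sub)
  then show ?thesis by (auto simp: ker_def tp_def)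
qed

lemma fund_deriv_apply:
  assumes u: "u \<in> points AY" and F: "has_chart_derivative F D (chartY u) id_chart u"
  shows "blinfun_apply (fund_deriv AY \<omega> F u) X = D (tangent u X)"
proof -
  have "differential AY euclid F u = D" by (rule differential_eqI) (simp add: F)
  moreover have "bounded_linear (\<lambda>X. D (tangent u X))"
    using linear_compose[OF linear_tangent[OF u] has_chart_derivative_linear[OF F]]
    by (simp add: o_def linear_conv_bounded_linear)
  ultimately show ?thesis by (simp add: fund_deriv_def bounded_linear_Blinfun_apply)
qed

lemma orbit_derivative:
  assumes u: "u \<in> points AY" and F: "has_chart_derivative F D (chartY u) id_chart u"
  shows "has_chart_derivative (\<lambda>h. F (r u h)) (\<lambda>a. blinfun_apply (fund_deriv AY \<omega> F u) (incl a))
    chartP id_chart \<one>"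
proof -
  have "has_chart_derivative (\<lambda>h. F (r u h)) (\<lambda>a. D (differential AP AY (r u) \<one> a)) chartP id_chart \<one>"
    by (rule has_chart_derivative_chain[OF good_chartP good_chartY[OF u] orbit_has_chart_derivative[OF u]])
       (simp add: r_one[OF u] F)
  then show ?thesis by (simp add: fund_deriv_apply[OF u F] tangent_incl[OF u])
qed

lemma restrict_to_P:
  assumes "has_chart_derivative g D chart1 id_chart \<one>"
  shows "has_chart_derivative g (\<lambda>a. D (incl a)) chartP id_chart \<one>"
  using has_chart_derivative_chain[OF good_chartP good_chart1 incl_has_chart_derivative assms] .

end

lemma has_chart_derivative_blinfun_apply:
  assumes "has_chart_derivative F D c id_chart x"
  shows "has_chart_derivative (\<lambda>v. blinfun_apply (F v) Y) (\<lambda>w. blinfun_apply (D w) Y) c id_chart x"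
proof -
  have "((\<lambda>y. F (chart_inv c y)) has_derivative D) (at (snd c x))"
    using assms by (simp add: has_chart_derivative_id_chart)
  from bounded_linear.has_derivative[OF blinfun.bounded_linear_left this, of Y]
  show ?thesis using assms by (simp add: has_chart_derivative_id_chart)
qed

section \<open>Equivariant functions and their derivatives\<close>

locale equivariant_function =
  parabolic_geometry_atlas G A P AP AY AM \<pi> r \<omega> + lie_group_action G A R dR
  for G :: "'g::{second_countable_topology,t2_space} monoid" (structure)
    and A :: "('g, 'e::euclidean_space) atlas"
    and P :: "'g set" and AP :: "('g, 'f::euclidean_space) atlas"
    and AY :: "('y::{second_countable_topology,t2_space}, 'n::euclidean_space) atlas"
    and AM :: "('m::{second_countable_topology,t2_space}, 'k::real_normed_vector) atlas"
    and \<pi> :: "'y \<Rightarrow> 'm" and r :: "'y \<Rightarrow> 'g \<Rightarrow> 'y" and \<omega> :: "'y \<Rightarrow> 'n \<Rightarrow> 'e"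
    and R :: "'g \<Rightarrow> 'w::euclidean_space \<Rightarrow> 'w" and dR :: "'e \<Rightarrow> 'w \<Rightarrow> 'w" +
  fixes f :: "'y \<Rightarrow> 'w"
  assumes section_f: "f \<in> bundle_sections G P AY r R"
begin

lemma smooth_f: "smooth_map AY euclid f"
  and f_equivariant: "u \<in> points AY \<Longrightarrow> h \<in> P \<Longrightarrow> f (r u h) = R (inv h) (f u)"
  using section_f by (simp_all add: bundle_sections_def)

lemma f_has_chart_derivative:
  "u \<in> points AY \<Longrightarrow> has_chart_derivative f (differential AY euclid f u) (chartY u) id_chart u"
  using smooth_map_differential[OF charted_AY charted_euclid smooth_f] by simp

abbreviation Df :: "'y \<Rightarrow> 'e \<Rightarrow> 'w" where
  "Df u X \<equiv> blinfun_apply (fund_deriv AY \<omega> f u) X"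

lemma Df_eq: "u \<in> points AY \<Longrightarrow> Df u X = differential AY euclid f u (tangent u X)"
  by (rule fund_deriv_apply[OF _ f_has_chart_derivative])

lemma linear_Df: "linear (Df u)"
  by (simp add: blinfun.bounded_linear_right bounded_linear.linear)

text \<open>Differentiate \<open>f (r u h) = R (inv h) (f u)\<close> at the unit.\<close>

lemma Df_vertical:
  assumes u: "u \<in> points AY"
  shows "Df u (incl a) = - dR (incl a) (f u)"
proof -
  have "has_chart_derivative (\<lambda>h. R (inv h) (f u)) (\<lambda>a. Df u (incl a)) chartP id_chart \<one>"
    by (rule has_chart_derivative_cong[OF good_chartP _
          orbit_derivative[OF u f_has_chart_derivative[OF u]]])
       (simp add: f_equivariant[OF u] chartP_P)
  from has_chart_derivative_unique[OF this restrict_to_P[OF R_inv_has_chart_derivative]]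
  show ?thesis by meson
qed

lemma Df_equivariant:
  assumes u: "u \<in> points AY" and h: "h \<in> P"
  shows "Df (r u h) Y = R (inv h) (Df u (Ad G A h Y))"
proof -
  let ?T = "differential AY AY (\<lambda>u. r u h) u"
  have v: "r u h \<in> points AY" by (rule r_points[OF u h])
  have hG: "inv h \<in> carrier G" using P_carrier[OF h] by simp
  have "has_chart_derivative (\<lambda>u. f (r u h)) (\<lambda>w. differential AY euclid f (r u h) (?T w))
      (chartY u) id_chart u"
    by (rule has_chart_derivative_chain[OF good_chartY[OF u] good_chartY[OF v]
          translation_has_chart_derivative[OF u h] f_has_chart_derivative[OF v]])
  moreover have "has_chart_derivative (\<lambda>u. f (r u h)) (\<lambda>w. R (inv h) (differential AY euclid f u w))
      (chartY u) id_chart u"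
    by (rule has_chart_derivative_cong[OF good_chartY[OF u] _
          has_chart_derivative_linear_compose[OF f_has_chart_derivative[OF u] linear_R[OF hG]]])
       (simp add: f_equivariant chartY_points[OF u] h)
  ultimately have "(\<lambda>w. differential AY euclid f (r u h) (?T w)) = (\<lambda>w. R (inv h) (differential AY euclid f u w))"
    by (rule has_chart_derivative_unique)
  then show ?thesis
    by (simp add: Df_eq u v tangent_r[OF u h] fun_eq_iff)
qed

text \<open>The charts in which \<open>fund_deriv\<close> is defined change from point to point, and so do the coordinates
  of the Cartan connection. In one fixed chart around \<open>u\<close> both the connection and the ordinary
  derivative of \<open>f\<close> have smooth coefficients \<open>\<Omega>\<close> and \<open>k\<close>, and the change of charts cancels in the
  relation \<open>fund_deriv f \<circ> \<Omega> = k\<close>. Hence \<open>differentiable_quotient\<close> applies.\<close>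

lemma fund_deriv_has_chart_derivative:
  assumes u: "u \<in> points AY"
  obtains D where "has_chart_derivative (fund_deriv AY \<omega> f) D (chartY u) id_chart u"
proof -
  define c where "c = chartY u"
  define y0 where "y0 = snd c u"
  have c: "c \<in> AY" "u \<in> fst c" "good_chart c"
    using chartY[OF u] good_chartY[OF u] by (simp_all add: c_def)
  have y0: "y0 \<in> snd c ` fst c" "chart_inv c y0 = u"
    using c by (simp_all add: y0_def chart_inv_chart)
  define T where "T y = differential euclid AY (chart_inv c) y" for y
  define \<Omega> where "\<Omega> y w = \<omega> (chart_inv c y) (T y w)" for y w
  define k where "k y w = frechet_derivative (\<lambda>y. f (chart_inv c y)) (at y) w" for y w
  have points: "chart_inv c y \<in> points AY" if "y \<in> snd c ` fst c" for y
    using chart_inv_in[OF that] chartY_points[OF u] by (simp add: c_def)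
  have T: "has_chart_derivative (chart_inv c) (T y) id_chart (chartY (chart_inv c y)) y"
    if y: "y \<in> snd c ` fst c" for y
  proof -
    obtain S where S: "has_chart_derivative (\<lambda>x. x) S c (chartY (chart_inv c y)) (chart_inv c y)"
      using smooth_map_has_chart_derivative[OF charted_AY charted_AY smooth_map_ident[OF manifold_AY]
          c(1) chartY(1)[OF points[OF y]] chart_inv_in[OF y] chartY(2)[OF points[OF y]]] by blast
    have *: "has_chart_derivative (chart_inv c) (\<lambda>v. S v) id_chart (chartY (chart_inv c y)) y"
      by (rule has_chart_derivative_chain[OF good_id_chart c(3) has_chart_derivative_chart_inv[OF c(3) y] S])
    then have "T y = S"
      unfolding T_def by (intro differential_eqI) simp
    with * show ?thesis by simp
  qed
  \<comment> \<open>the change of charts \<open>T y\<close> enters \<open>k\<close> in the same way as \<open>\<Omega>\<close>\<close>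
  have k_eq: "k y w = differential AY euclid f (chart_inv c y) (T y w)" if y: "y \<in> snd c ` fst c" for y w
  proof -
    have "has_chart_derivative (\<lambda>y. f (chart_inv c y))
        (\<lambda>w. differential AY euclid f (chart_inv c y) (T y w)) id_chart id_chart y"
      by (rule has_chart_derivative_chain[OF good_id_chart good_chartY[OF points[OF y]] T[OF y]
            f_has_chart_derivative[OF points[OF y]]])
    then have "((\<lambda>y. f (chart_inv c y)) has_derivative
        (\<lambda>w. differential AY euclid f (chart_inv c y) (T y w))) (at y)"
      by (simp add: has_chart_derivative_id_chart)
    from frechet_derivative_at[OF this] show ?thesis unfolding k_def by metis
  qed
  \<comment> \<open>at \<open>u\<close> itself the chosen chart is the fixed one, so there is no change of charts\<close>
  have y0_T: "T y0 = (\<lambda>v. v)"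
  proof -
    have "has_chart_derivative (chart_inv c) (T y0) id_chart c y0"
      using T[OF y0(1)] by (simp add: y0(2) flip: c_def)
    from has_chart_derivative_unique[OF this has_chart_derivative_chart_inv[OF c(3) y0(1)]] show ?thesis .
  qed
  have "(\<lambda>y. fund_deriv AY \<omega> f (chart_inv c y)) differentiable (at y0)"
  proof (rule differentiable_quotient[where \<Omega> = \<Omega> and k = k])
    fix w
    have "smooth_on (snd c ` fst c) (\<lambda>y. \<Omega> y w)"
      using smooth_\<omega> c(1) unfolding smooth_one_form_def case_prod_beta \<Omega>_def T_def chart_inv_def by blast
    then show "(\<lambda>y. \<Omega> y w) differentiable (at y0)"
      by (rule smooth_on_differentiable) (rule y0)
    have "(UNIV, id) \<in> (euclid :: ('w, 'w) atlas)" by (simp add: euclid_def)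
    moreover have "\<forall>c\<in>AY. \<forall>d\<in>euclid. smooth_on (snd c ` (fst c \<inter> f -` fst d)) (snd d \<circ> f \<circ> inv_into (fst c) (snd c))"
      using smooth_f unfolding smooth_map_def case_prod_beta by blast
    ultimately have "smooth_on (snd c ` fst c) (\<lambda>y. f (chart_inv c y))"
      using c(1) by (fastforce simp: chart_inv_def o_def)
    then show "(\<lambda>y. k y w) differentiable (at y0)"
      unfolding k_def by (rule smooth_on_differentiable[OF smooth_on_frechet_derivative]) (rule y0)
  next
    show "bij (\<Omega> y0)"
      unfolding \<Omega>_def y0_T y0(2) by (rule bij_\<omega>[OF u])
    have "open (snd c ` fst c)" using c(3) by (simp add: good_chart_def)
    then have "\<forall>\<^sub>F y in nhds y0. y \<in> snd c ` fst c"
      using y0(1) by (rule eventually_nhds_in_open)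
    then show "\<forall>\<^sub>F y in nhds y0. linear (\<Omega> y) \<and> linear (k y) \<and>
        (\<forall>w. blinfun_apply (fund_deriv AY \<omega> f (chart_inv c y)) (\<Omega> y w) = k y w)"
    proof eventually_elim
      fix y assume y: "y \<in> snd c ` fst c"
      note v = points[OF y]
      have lT: "linear (T y)" by (rule has_chart_derivative_linear[OF T[OF y]])
      have "linear (\<Omega> y)"
        using linear_compose[OF lT linear_\<omega>[OF v]] by (simp add: \<Omega>_def[abs_def] o_def)
      moreover have "linear (k y)"
        using linear_compose[OF lT has_chart_derivative_linear[OF f_has_chart_derivative[OF v]]]
        by (simp add: k_eq[OF y, abs_def] o_def)
      moreover have "Df (chart_inv c y) (\<Omega> y w) = k y w" for w
        by (simp add: Df_eq[OF v] \<Omega>_def tangent_\<omega>[OF v] k_eq[OF y])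
      ultimately show "linear (\<Omega> y) \<and> linear (k y) \<and> (\<forall>w. Df (chart_inv c y) (\<Omega> y w) = k y w)" by blast
    qed
  qed
  then obtain D where "((\<lambda>y. fund_deriv AY \<omega> f (chart_inv c y)) has_derivative D) (at y0)"
    by (auto simp: differentiable_def)
  then have "has_chart_derivative (fund_deriv AY \<omega> f) D (chartY u) id_chart u"
    using c by (simp add: has_chart_derivative_id_chart c_def y0_def)
  then show ?thesis by (rule that)
qed

abbreviation D2f :: "'y \<Rightarrow> 'e \<Rightarrow> 'e \<Rightarrow> 'w" where
  "D2f u X Y \<equiv> blinfun_apply (blinfun_apply (fund_deriv AY \<omega> (fund_deriv AY \<omega> f) u) X) Y"

text \<open>By \<open>Df_vertical\<close>, which holds at all points, \<open>\<lambda>v. Df v (incl a)\<close> is the composition of \<open>f\<close> with a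
  constant linear map.\<close>

lemma D2f_vertical_right:
  assumes u: "u \<in> points AY"
  shows "D2f u X (incl a) = - dR (incl a) (Df u X)"
proof -
  obtain D where D: "has_chart_derivative (fund_deriv AY \<omega> f) D (chartY u) id_chart u"
    by (rule fund_deriv_has_chart_derivative[OF u])
  have "has_chart_derivative (\<lambda>v. Df v (incl a)) (\<lambda>w. blinfun_apply (D w) (incl a)) (chartY u) id_chart u"
    by (rule has_chart_derivative_blinfun_apply[OF D])
  then have "has_chart_derivative (\<lambda>v. - dR (incl a) (f v)) (\<lambda>w. blinfun_apply (D w) (incl a))
      (chartY u) id_chart u"
    by (rule has_chart_derivative_cong[OF good_chartY[OF u], rotated])
       (simp add: Df_vertical chartY_points[OF u])
  moreover have "linear (\<lambda>w. - dR (incl a) w)"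
    using linear_dR_right linear_compose_neg by blast
  then have "has_chart_derivative (\<lambda>v. - dR (incl a) (f v))
      (\<lambda>w. - dR (incl a) (differential AY euclid f u w)) (chartY u) id_chart u"
    by (rule has_chart_derivative_linear_compose[OF f_has_chart_derivative[OF u]])
  ultimately have "(\<lambda>w. blinfun_apply (D w) (incl a)) = (\<lambda>w. - dR (incl a) (differential AY euclid f u w))"
    by (rule has_chart_derivative_unique)
  then show ?thesis
    by (simp add: fund_deriv_apply[OF u D] Df_eq[OF u] fun_eq_iff)
qed

text \<open>Differentiate \<open>Df (r u h) Y = R (inv h) (Df u (Ad h Y))\<close> at the unit. The bracket is the derivative
  of \<open>Ad h Y\<close>.\<close>

lemma D2f_vertical_left:
  assumes u: "u \<in> points AY"
  shows "D2f u (incl a) Y = - dR (incl a) (Df u Y) + Df u (lie_bracket G A (incl a) Y)"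
proof -
  obtain D where D: "has_chart_derivative (fund_deriv AY \<omega> f) D (chartY u) id_chart u"
    by (rule fund_deriv_has_chart_derivative[OF u])
  have "has_chart_derivative (\<lambda>h. Df (r u h) Y) (\<lambda>a. D2f u (incl a) Y) chartP id_chart \<one>"
    by (rule has_chart_derivative_blinfun_apply[OF orbit_derivative[OF u D]])
  then have "has_chart_derivative (\<lambda>h. R (inv h) (Df u (Ad G A h Y))) (\<lambda>a. D2f u (incl a) Y)
      chartP id_chart \<one>"
    by (rule has_chart_derivative_cong[OF good_chartP, rotated])
       (simp add: Df_equivariant[OF u] chartP_P)
  moreover have "has_chart_derivative (\<lambda>h. R (inv h) (Df u (Ad G A h Y)))
      (\<lambda>X. R (inv \<one>) (Df u (lie_bracket G A X Y)) + - dR X (Df u (Ad G A \<one> Y))) chart1 id_chart \<one>"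
  proof (rule has_chart_derivative_apply[OF good_chart1, of "\<lambda>h. R (inv h)"])
    show "linear (R (inv h))" if "h \<in> fst chart1" for h
      using that by (intro linear_R inv_closed chart1_carrier)
    show "has_chart_derivative (\<lambda>h. R (inv h) w) (\<lambda>X. - dR X w) chart1 id_chart \<one>" for w
      by (rule R_inv_has_chart_derivative)
    show "has_chart_derivative (\<lambda>h. Df u (Ad G A h Y)) (\<lambda>X. Df u (lie_bracket G A X Y)) chart1 id_chart \<one>"
      by (rule has_chart_derivative_linear_compose[OF Ad_has_chart_derivative linear_Df])
  qed
  then have "has_chart_derivative (\<lambda>h. R (inv h) (Df u (Ad G A h Y)))
      (\<lambda>a. - dR (incl a) (Df u Y) + Df u (lie_bracket G A (incl a) Y)) chartP id_chart \<one>"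
    by (rule restrict_to_P[THEN back_subst[of "\<lambda>D. has_chart_derivative _ D _ _ _"]])
       (simp add: R_one Ad_one fun_eq_iff)
  ultimately have "(\<lambda>a. D2f u (incl a) Y)
      = (\<lambda>a. - dR (incl a) (Df u Y) + Df u (lie_bracket G A (incl a) Y))"
    by (rule has_chart_derivative_unique)
  then show ?thesis by meson
qed

end

section \<open>The curved Casimir operator\<close>

theorem proposition4:
  fixes G :: "'g::{second_countable_topology,t2_space} monoid"
    and A :: "('g, 'e::euclidean_space) atlas"
    and P :: "'g set" and AP :: "('g, 'f::euclidean_space) atlas"
    and AY :: "('y::{second_countable_topology,t2_space}, 'n::euclidean_space) atlas"
    and AM :: "('m::{second_countable_topology,t2_space}, 'k::real_normed_vector) atlas"
    and \<pi> :: "'y \<Rightarrow> 'm" and r :: "'y \<Rightarrow> 'g \<Rightarrow> 'y" and \<omega> :: "'y \<Rightarrow> 'n \<Rightarrow> 'e"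
    and K :: "complex set" and sc :: "complex \<Rightarrow> 'v::euclidean_space \<Rightarrow> 'v"
    and \<rho> :: "'g \<Rightarrow> 'v \<Rightarrow> 'v" and c\<^sub>0 :: complex
    and \<sigma> :: "'y \<Rightarrow> 'v" and u :: 'y
  assumes "semisimple_lie_group G A"
    and "parabolic_subgroup G A P AP"
    and "irreducible_representation G A K sc \<rho>"
    and "c\<^sub>0 \<in> K" and "casimir_operator G A \<rho> (sc c\<^sub>0)"
    and "parabolic_geometry G A P AP AY AM \<pi> r \<omega>"
    and "\<sigma> \<in> bundle_sections G P AY r \<rho>"
    and "u \<in> points AY"
  shows "curved_casimir G A AY \<omega> \<sigma> u =
    sc c\<^sub>0 (\<sigma> u) +
    2 *\<^sub>R kostant_codifferential G A AP AY AM \<pi> \<omega> \<rho> 1 u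
      (as_one_form (tractor_connection G A AY AM \<pi> \<omega> \<rho> \<sigma> u)) []"
proof -
  define br where "br = lie_bracket G A"
  define act where "act = inf_action G A \<rho>"
  obtain \<xi> \<eta> where dual: "dual_bases (killing_form br) \<xi> \<eta>"
    and casimir: "\<And>v. sc c\<^sub>0 v = (\<Sum>l<DIM('e). act (\<xi> l) (act (\<eta> l) v))"
    using assms(5) unfolding casimir_operator_def br_def act_def by blast
  interpret lie_group_atlas G A
    by unfold_locales (use assms(1) in \<open>simp add: semisimple_lie_group_def\<close>)
  interpret ad: lie_group_action G A "Ad G A" br
    unfolding br_def by (rule adjoint_action)
  have "lie_group_action G A \<rho> act"
    unfolding act_def
    by (rule representation_action[of K sc]) (use assms(3) in \<open>simp add: irreducible_representation_def\<close>)
  then interpret rep: lie_group_action G A \<rho> act .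
  interpret equivariant_function G A P AP AY AM \<pi> r \<omega> \<rho> act \<sigma>
    by (intro equivariant_function.intro equivariant_function_axioms.intro parabolic_geometry_atlas.intro
        parabolic_geometry_atlas_axioms.intro lie_group_atlas_axioms rep.lie_group_action_axioms assms(6,7))
       (use assms(2) in \<open>simp add: parabolic_subgroup_def\<close>)
  obtain k gr where grading: "grading br k gr"
    and nonneg_gr: "subgroup_algebra G A AP = span (\<Union>i\<in>{i. i \<ge> 0}. gr i)"
    using assms(2) unfolding parabolic_subgroup_def parabolic_subalgebra_def br_def by blast
  interpret graded_killing_dual br \<xi> \<eta> k gr
    by (intro graded_killing_dual.intro killing_dual.intro graded_killing_dual_axioms.intro
        ad.linear_dR_left ad.linear_dR_right ad.dR_bracket[folded br_def] dual grading)
  have nonneg: "subgroup_algebra G A AP = nonneg" and nonneg_incl: "nonneg = range incl"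
    using nonneg_gr by (simp_all add: nonneg_def subgroup_algebra_def)
  note u = \<open>u \<in> points AY\<close>
  define N where "N X = Df u X + act X (\<sigma> u)" for X
  have linear_N: "linear N"
    unfolding N_def by (intro linear_compose_add linear_Df rep.linear_dR_left)
  have N_nonneg: "N X = 0" if "X \<in> nonneg" for X
    using that Df_vertical[OF u] by (auto simp: N_def nonneg_incl)
  define tp where "tp = tangent_proj AY AM \<pi> \<omega> u"
  have tp: "linear tp" "surj tp"
    unfolding tp_def by (rule linear_tangent_proj[OF u], rule surj_tangent_proj[OF u])
  have tp_nonneg: "X' - X \<in> nonneg" if "tp X' = tp X" for X X'
  proof -
    have "tp (X' - X) = 0" by (simp add: linear_diff[OF tp(1)] that)
    then show ?thesis unfolding tp_def tangent_proj_eq_0_iff[OF u] nonneg_incl .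
  qed
  \<comment> \<open>the connection is well defined because \<open>N\<close> vanishes on the kernel of the projection\<close>
  define \<alpha> where "\<alpha> = tractor_connection G A AY AM \<pi> \<omega> \<rho> \<sigma> u"
  have \<alpha>: "\<alpha> (tp X) = N X" for X
    unfolding \<alpha>_def tractor_connection_def
  proof (rule the_equality)
    show "\<forall>X'. tangent_proj AY AM \<pi> \<omega> u X' = tp X \<longrightarrow> N X = Df u X' + inf_action G A \<rho> X' (\<sigma> u)"
      using tp_nonneg N_nonneg linear_diff[OF linear_N] unfolding tp_def N_def act_def
      by (metis eq_iff_diff_eq_0)
  qed (auto simp: tp_def N_def act_def)
  define ct where "ct = cotangent B AY AM \<pi> \<omega> u"
  have ct: "ct \<phi> (tp X) = B \<phi> X" if "\<phi> \<in> positive" for \<phi> X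
    unfolding ct_def cotangent_def
  proof (rule the_equality)
    show "\<forall>X'. tangent_proj AY AM \<pi> \<omega> u X' = tp X \<longrightarrow> B \<phi> X = B \<phi> X'"
    proof (intro allI impI)
      fix X' assume "tangent_proj AY AM \<pi> \<omega> u X' = tp X"
      then have "B \<phi> (X' - X) = 0" using that tp_nonneg positive_iff_perp by (simp flip: tp_def)
      then show "B \<phi> X = B \<phi> X'" by (simp add: linear_diff[OF linear_B])
    qed
  qed (auto simp: tp_def)
  have codifferential: "kostant_codifferential G A AP AY AM \<pi> \<omega> \<rho> 1 u (as_one_form \<alpha>) []
      = - (\<Sum>l<DIM('e). act (\<eta> l) (N (\<xi> l)))"
    unfolding kostant_codifferential_def nonneg br_def[symmetric] act_def[symmetric] nilradical_nonneg ct_def[symmetric]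
    by (rule codiff_one_form[OF rep.linear_dR_left rep.linear_dR_right linear_N N_nonneg tp(2) ct \<alpha>])
  have linear_D2_left: "linear (\<lambda>X. D2f u X Y)" for Y
    by (intro linearI) (simp_all add: blinfun.bilinear_simps)
  have linear_D2_right: "linear (D2f u X)" for X
    by (intro linearI) (simp_all add: blinfun.bilinear_simps)
  have "curved_casimir G A AY \<omega> \<sigma> u = (\<Sum>l<DIM('e). D2f u (\<xi> l) (\<eta> l))"
    unfolding curved_casimir_def br_def[symmetric]
    by (rule contract_eq_dual_sum[OF linear_D2_left linear_D2_right])
  also have "\<dots> = (\<Sum>l<DIM('e). act (\<xi> l) (act (\<eta> l) (\<sigma> u)))
      - 2 *\<^sub>R (\<Sum>l<DIM('e). act (\<eta> l) (Df u (\<xi> l) + act (\<xi> l) (\<sigma> u)))"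
  proof (rule casimir_identity[OF rep.linear_dR_left rep.linear_dR_right _ linear_Df
        linear_D2_left linear_D2_right])
    show "act (br X Y) v = act X (act Y v) - act Y (act X v)" for X Y v
      unfolding br_def by (rule rep.dR_bracket)
    show "Df u Y = - act Y (\<sigma> u)" if "Y \<in> nonneg" for Y
      using that Df_vertical[OF u] by (auto simp: nonneg_incl)
    show "D2f u X Y = - act Y (Df u X)" if "Y \<in> nonneg" for X Y
      using that D2f_vertical_right[OF u] by (auto simp: nonneg_incl)
    show "D2f u X Y = - act X (Df u Y) + Df u (br X Y)" if "X \<in> nonneg" for X Y
      using that D2f_vertical_left[OF u] by (auto simp: nonneg_incl br_def)
  qed
  also have "\<dots> = sc c\<^sub>0 (\<sigma> u) + 2 *\<^sub>R kostant_codifferential G A AP AY AM \<pi> \<omega> \<rho> 1 u (as_one_form \<alpha>) []"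
    unfolding codifferential by (simp add: casimir N_def)
  finally show ?thesis unfolding \<alpha>_def .
qed

end
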